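(* Consider the nearest-neighbour discrete NLS lattice on the periodic ring $\mathcal J=\{-N,\dots,N\}$ with $6\le N\le 10$, i.e. $\mathrm i\dot\psi_j=\partial H/\partial\overline{\psi_j}$ with $$H=\sum_{j\in\mathcal J}|\psi_j|^2+\tfrac12\sum_{j\in\mathcal J}|\psi_j|^4+\varepsilon\sum_{j\in\mathcal J}|\psi_{j+1}-\psi_j|^2 .$$ Let $S=\{-2,-1,1\}$, let $I^*>0$ be such that $\omega=1+I^*$ satisfies $k\omega\pm1\neq0$ and $k\omega\pm2\neq0$ for all $k\in\mathbb Z\setminus\{0\}$, and let $T=2\pi/\omega$. Write $q_2=\theta_{-1}-\theta_{-2}$ and $q_3=\theta_1-\theta_{-1}$. Then: (i) the four unperturbed periodic orbits on the resonant torus (excited sites $S$, common action $I^*$) with $(q_2,q_3)\in\{(0,0),(0,\pi),(\pi,0),(\pi,\pi)\}$ can be continued to $\varepsilon>0$ small as $T$-periodic solutions; (ii) for $\varepsilon>0$ small the continuation of $(0,\pi)$ is linearly stable, while the continuations of $(0,0)$, $(\pi,0)$ and $(\pi,\pi)$ are linearly unstable; (iii) no other value of $(q_2,q_3)\in(\mathbb R/2\pi\mathbb Z)^2$ gives an unperturbed orbit which is a limit of $T$-periodic solutions: if $\varepsilon_n\to0^+$ and $\psi^{(n)}$ are $T$-periodic solutions of the system with $\varepsilon=\varepsilon_n$ converging uniformly in $t$ to the unperturbed orbit with phase differences $(q_2,q_3)$, then $q_2,q_3\in\{0,\pi\}$.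
   Context: Site indices are taken modulo $2N+1$ (periodic boundary conditions). At $\varepsilon=0$, the unperturbed periodic orbits on the resonant torus are $\psi^{(0)}_j(t)=\sqrt{I^*}\,e^{-\mathrm i(\omega t+\theta_j)}$ for $j\in S$ and $\psi^{(0)}_j(t)=0$ for $j\in\mathcal J\setminus S$; up to time translation they are labelled by the phase differences of the $\theta_j$. An unperturbed orbit "can be continued" if there is $\varepsilon^*>0$ such that for every $0<\varepsilon<\varepsilon^*$ the system has a $T$-periodic solution $\psi^{\varepsilon}$, with $\psi^\varepsilon\to\psi^{(0)}$ uniformly in $t$ as $\varepsilon\to0^+$. A periodic solution is linearly stable if all the Floquet multipliers of its monodromy matrix (over the period $T$, viewing the system as a real Hamiltonian system) lie on the unit circle, and linearly unstable if at least one Floquet multiplier lies outside the unit circle. *)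

theory Defs
  imports "HOL-Analysis.Analysis" "HOL-Library.Real_Mod" "Jordan_Normal_Form.Char_Poly"
begin

(* A state of the ring is a function on int of which only the values on the sites matter. *)
definition sites :: "nat \<Rightarrow> int set" where
  "sites N = {- int N..int N}"

definition wrap :: "nat \<Rightarrow> int \<Rightarrow> int" where
  "wrap N j = (j + int N) mod (2 * int N + 1) - int N"

definition dnls_H :: "nat \<Rightarrow> real \<Rightarrow> (int \<Rightarrow> complex) \<Rightarrow> real" where
  "dnls_H N \<epsilon> \<psi> =
     (\<Sum>j\<in>sites N. (cmod (\<psi> j))\<^sup>2) + 1/2 * (\<Sum>j\<in>sites N. cmod (\<psi> j) ^ 4)
     + \<epsilon> * (\<Sum>j\<in>sites N. (cmod (\<psi> (wrap N (j + 1)) - \<psi> j))\<^sup>2)"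

(* The Wirtinger derivative dF/d(conj psi_j) = (dF/dx_j + i dF/dy_j) / 2, where
   psi_j = x_j + i y_j. *)
definition dbar :: "((int \<Rightarrow> complex) \<Rightarrow> real) \<Rightarrow> int \<Rightarrow> (int \<Rightarrow> complex) \<Rightarrow> complex" where
  "dbar F j \<psi> =
     Complex (deriv (\<lambda>s. F (\<psi>(j := \<psi> j + complex_of_real s))) 0 / 2)
             (deriv (\<lambda>s. F (\<psi>(j := \<psi> j + \<i> * complex_of_real s))) 0 / 2)"

definition dnls_field :: "nat \<Rightarrow> real \<Rightarrow> (int \<Rightarrow> complex) \<Rightarrow> int \<Rightarrow> complex" where
  "dnls_field N \<epsilon> \<psi> j = - \<i> * dbar (dnls_H N \<epsilon>) j \<psi>"

definition dnls_solution :: "nat \<Rightarrow> real \<Rightarrow> (real \<Rightarrow> int \<Rightarrow> complex) \<Rightarrow> bool" where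
  "dnls_solution N \<epsilon> \<psi> \<longleftrightarrow>
     (\<forall>t. \<forall>j\<in>sites N. ((\<lambda>s. \<psi> s j) has_vector_derivative dnls_field N \<epsilon> (\<psi> t) j) (at t))"

definition periodic_solution :: "nat \<Rightarrow> real \<Rightarrow> real \<Rightarrow> (real \<Rightarrow> int \<Rightarrow> complex) \<Rightarrow> bool" where
  "periodic_solution N \<epsilon> T \<psi> \<longleftrightarrow>
     dnls_solution N \<epsilon> \<psi> \<and> (\<forall>t. \<forall>j\<in>sites N. \<psi> (t + T) j = \<psi> t j)"

definition unperturbed :: "int set \<Rightarrow> real \<Rightarrow> real \<Rightarrow> (int \<Rightarrow> real) \<Rightarrow> real \<Rightarrow> int \<Rightarrow> complex" where
  "unperturbed S A \<omega> \<theta> t j =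
     (if j \<in> S then complex_of_real (sqrt A) * exp (- \<i> * complex_of_real (\<omega> * t + \<theta> j)) else 0)"

definition excited :: "int set" where
  "excited = {-2, -1, 1}"

definition phase_differences :: "(int \<Rightarrow> real) \<Rightarrow> real \<Rightarrow> real \<Rightarrow> bool" where
  "phase_differences \<theta> q\<^sub>2 q\<^sub>3 \<longleftrightarrow>
     [\<theta> (-1) - \<theta> (-2) = q\<^sub>2] (rmod (2 * pi)) \<and> [\<theta> 1 - \<theta> (-1) = q\<^sub>3] (rmod (2 * pi))"

definition is_continuation ::
  "nat \<Rightarrow> real \<Rightarrow> (real \<Rightarrow> int \<Rightarrow> complex) \<Rightarrow> (real \<Rightarrow> real \<Rightarrow> int \<Rightarrow> complex) \<Rightarrow> bool" where
  "is_continuation N T \<psi>0 \<Psi> \<longleftrightarrow>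
     (\<exists>\<epsilon>star>0. \<forall>\<epsilon>. 0 < \<epsilon> \<and> \<epsilon> < \<epsilon>star \<longrightarrow> periodic_solution N \<epsilon> T (\<Psi> \<epsilon>)) \<and>
     (\<forall>j\<in>sites N. uniform_limit UNIV (\<lambda>\<epsilon> t. \<Psi> \<epsilon> t j) (\<lambda>t. \<psi>0 t j) (at_right 0))"

definition can_be_continued :: "nat \<Rightarrow> real \<Rightarrow> (real \<Rightarrow> int \<Rightarrow> complex) \<Rightarrow> bool" where
  "can_be_continued N T \<psi>0 \<longleftrightarrow> (\<exists>\<Psi>. is_continuation N T \<psi>0 \<Psi>)"

(* Real coordinates, numbered 0, ..., 2 (2 N + 1) - 1: first the real parts, then the imaginary
   parts, of the values at the sites -N, ..., N. Canonical coordinates would carry an extra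
   common factor sqrt 2, which changes neither the Jacobian nor the monodromy matrix. *)
definition real_dim :: "nat \<Rightarrow> nat" where
  "real_dim N = 2 * (2 * N + 1)"

definition coord_site :: "nat \<Rightarrow> nat \<Rightarrow> int" where
  "coord_site N a = int (a mod (2 * N + 1)) - int N"

definition coord :: "nat \<Rightarrow> nat \<Rightarrow> (int \<Rightarrow> complex) \<Rightarrow> real" where
  "coord N a \<psi> =
     (if a < 2 * N + 1 then Re (\<psi> (coord_site N a)) else Im (\<psi> (coord_site N a)))"

definition coord_shift :: "nat \<Rightarrow> nat \<Rightarrow> real \<Rightarrow> (int \<Rightarrow> complex) \<Rightarrow> int \<Rightarrow> complex" where
  "coord_shift N b s \<psi> =
     \<psi>(coord_site N b := \<psi> (coord_site N b) + complex_of_real s * (if b < 2 * N + 1 then 1 else \<i>))"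

definition field_jacobian :: "nat \<Rightarrow> real \<Rightarrow> (int \<Rightarrow> complex) \<Rightarrow> real mat" where
  "field_jacobian N \<epsilon> \<psi> = mat (real_dim N) (real_dim N)
     (\<lambda>(a, b). deriv (\<lambda>s. coord N a (dnls_field N \<epsilon> (coord_shift N b s \<psi>))) 0)"

(* The principal fundamental matrix of the variational equation X' = Df(psi(t)) X, X(0) = 1. *)
definition fundamental_matrix ::
  "nat \<Rightarrow> real \<Rightarrow> (real \<Rightarrow> int \<Rightarrow> complex) \<Rightarrow> (real \<Rightarrow> real mat) \<Rightarrow> bool" where
  "fundamental_matrix N \<epsilon> \<psi> X \<longleftrightarrow>
     X 0 = 1\<^sub>m (real_dim N) \<and>
     (\<forall>t. X t \<in> carrier_mat (real_dim N) (real_dim N)) \<and>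
     (\<forall>t. \<forall>a<real_dim N. \<forall>b<real_dim N.
        ((\<lambda>s. X s $$ (a, b)) has_real_derivative (field_jacobian N \<epsilon> (\<psi> t) * X t) $$ (a, b)) (at t))"

definition monodromy_matrix ::
  "nat \<Rightarrow> real \<Rightarrow> real \<Rightarrow> (real \<Rightarrow> int \<Rightarrow> complex) \<Rightarrow> real mat \<Rightarrow> bool" where
  "monodromy_matrix N \<epsilon> T \<psi> M \<longleftrightarrow> (\<exists>X. fundamental_matrix N \<epsilon> \<psi> X \<and> M = X T)"

definition floquet_multiplier :: "real mat \<Rightarrow> complex \<Rightarrow> bool" where
  "floquet_multiplier M \<mu> \<longleftrightarrow> eigenvalue (map_mat complex_of_real M) \<mu>"

(* The monodromy matrix exists and is unique, being given by a linear initial value problem. *)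
definition linearly_stable :: "nat \<Rightarrow> real \<Rightarrow> real \<Rightarrow> (real \<Rightarrow> int \<Rightarrow> complex) \<Rightarrow> bool" where
  "linearly_stable N \<epsilon> T \<psi> \<longleftrightarrow>
     (\<exists>M. monodromy_matrix N \<epsilon> T \<psi> M \<and> (\<forall>\<mu>. floquet_multiplier M \<mu> \<longrightarrow> cmod \<mu> = 1))"

definition linearly_unstable :: "nat \<Rightarrow> real \<Rightarrow> real \<Rightarrow> (real \<Rightarrow> int \<Rightarrow> complex) \<Rightarrow> bool" where
  "linearly_unstable N \<epsilon> T \<psi> \<longleftrightarrow>
     (\<exists>M. monodromy_matrix N \<epsilon> T \<psi> M \<and> (\<exists>\<mu>. floquet_multiplier M \<mu> \<and> cmod \<mu> > 1))"

end

theory Submission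
  imports Defs
begin

text \<open>
  In the frame rotating with frequency \<open>\<omega> = 1 + A\<close> the lattice reads
  \<open>i x' = (|x|^2 - A) x + \<epsilon> L x\<close> with \<open>L\<close> the discrete Laplacian (taken positive), and the unperturbed
  orbits become equilibria. The argument reduces everything to finite-dimensional statements about
  equilibria of this rotating system, that is, about standing waves.

  Rigidity (\<open>rigidity_step\<close>, \<open>nearby_periodic_is_standing\<close>). If \<open>x\<close> is a \<open>T\<close>-periodic solution uniformly close
  to an unperturbed equilibrium, then \<open>x'\<close> is a \<open>T\<close>-periodic solution with mean zero of a linear
  equation close to the unperturbed linearization. By the nonresonance condition the latter has no
  such solution other than zero, hence \<open>x' = 0\<close>. So every periodic solution in question is a standing
  wave, and all further questions concern solutions of an algebraic system.

  Phases (\<open>limits_have_phases_0_or_pi\<close>). For a standing wave the flux \<open>Im (cnj x_j * x_(j+1))\<close> does not depend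
  on the bond. It tends to zero on the bond from 2 to 3, so it does on the bond from -2 to -1, which gives
  \<open>sin q\<^sub>2 = 0\<close>. Divided by \<open>\<epsilon>\<close> it still tends to zero on the bond from 2 to 3, whereas on the bond from
  -1 to 0 its limit is a multiple of \<open>sin q\<^sub>3\<close>, because \<open>x_0\<close> is \<open>- \<epsilon> (x_1 + x_(-1)) / A\<close> to first order.

  Continuation. If the phases are 0 or \<open>pi\<close>, a contraction (\<open>real_wave_exists\<close>) gives a real standing wave
  \<open>u\<close>, where amplitudes are scaled so that \<open>A = 1\<close> and \<open>e = \<epsilon> / A\<close>. Conversely each standing wave
  near such an orbit is a real one times a constant phase (\<open>standing_wave_real_form\<close>).

  Stability. About \<open>u\<close> the linearization is \<open>a' = A Lm b\<close>, \<open>b' = - A Lp a\<close> with the symmetric operators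
  \<open>Lm = u^2 - 1 + e L\<close> and \<open>Lp = 3 u^2 - 1 + e L\<close>. The form
  \<open>kin(a) + pot(b)\<close>, a combination of two quadratic invariants of this system, is conserved, and the weight
  3/4 in it makes \<open>kin\<close> positive definite (\<open>kin_positive\<close>). The system thus has the structure of
  a kinetic and a potential energy, and the sign of \<open>pot\<close> decides. For the phases \<open>(0, pi)\<close> the form \<open>pot\<close> is
  positive apart from the phase direction \<open>u\<close> (\<open>pot_stable\<close>), which forces all multipliers onto the unit circle. In
  the other three cases \<open>pot\<close> is negative on the indicator of a single excited site, and minimizing a Rayleigh quotient
  produces a real exponentially growing mode (\<open>negative_direction_gives_eigenvector\<close>). The effective
  coupling of two excited sites is of order \<open>e\<close> and attractive for neighbours in phase; it is of
  order \<open>e^2\<close> and, since it passes through a site on which \<open>Lm\<close> is negative, attractive for opposite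
  phases when one site lies in between. This is why only \<open>(0, pi)\<close> is stable.

  In the frame of the unperturbed rotation the linearization is autonomous, so that the monodromy matrix is the time \<open>T\<close> map
  of an exponential series (\<open>fundamental_matrix_fund\<close>).
\<close>

section \<open>The ring and the vector field\<close>

definition nx :: "nat \<Rightarrow> int \<Rightarrow> int" where "nx N j = wrap N (j + 1)"
definition pv :: "nat \<Rightarrow> int \<Rightarrow> int" where "pv N j = wrap N (j - 1)"

text \<open>The sign is chosen so that the operator is positive, as in the quadratic form of the coupling energy.\<close>

definition lap :: "nat \<Rightarrow> (int \<Rightarrow> 'a::comm_ring_1) \<Rightarrow> int \<Rightarrow> 'a" where
  "lap N f j = 2 * f j - f (nx N j) - f (pv N j)"

lemma finite_sites [simp]: "finite (sites N)"
  by (simp add: sites_def)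

lemma wrap_in_sites [simp]: "wrap N j \<in> sites N"
proof -
  have "0 \<le> (j + int N) mod (2 * int N + 1)" "(j + int N) mod (2 * int N + 1) < 2 * int N + 1"
    by (intro pos_mod_sign pos_mod_bound; simp)+
  then show ?thesis by (auto simp: wrap_def sites_def)
qed

lemma wrap_site: "j \<in> sites N \<Longrightarrow> wrap N j = j"
  by (auto simp: wrap_def sites_def)

lemma nx_in_sites [simp]: "nx N j \<in> sites N" and pv_in_sites [simp]: "pv N j \<in> sites N"
  by (simp_all add: nx_def pv_def)

lemma nx_pv [simp]: "j \<in> sites N \<Longrightarrow> nx N (pv N j) = j"
  and pv_nx [simp]: "j \<in> sites N \<Longrightarrow> pv N (nx N j) = j"
proof -
  assume j: "j \<in> sites N"
  have "nx N (pv N j) = wrap N j" "pv N (nx N j) = wrap N j"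
    by (simp_all add: nx_def pv_def wrap_def mod_simps algebra_simps)
  then show "nx N (pv N j) = j" "pv N (nx N j) = j" using wrap_site[OF j] by simp_all
qed

lemma nx_interior: "- int N \<le> j \<Longrightarrow> j < int N \<Longrightarrow> nx N j = j + 1"
  unfolding nx_def by (rule wrap_site) (simp add: sites_def)

lemma pv_interior: "- int N < j \<Longrightarrow> j \<le> int N \<Longrightarrow> pv N j = j - 1"
  unfolding pv_def by (rule wrap_site) (simp add: sites_def)

lemma bij_nx: "bij_betw (nx N) (sites N) (sites N)" and bij_pv: "bij_betw (pv N) (sites N) (sites N)"
  by (rule bij_betw_byWitness[where f' = "pv N"]; auto; fail)
     (rule bij_betw_byWitness[where f' = "nx N"]; auto; fail)

lemma sum_nx: "(\<Sum>j\<in>sites N. f (nx N j)) = (\<Sum>j\<in>sites N. f j)"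
  by (rule sum.reindex_bij_betw[OF bij_nx])

lemma sum_pv: "(\<Sum>j\<in>sites N. f (pv N j)) = (\<Sum>j\<in>sites N. f j)"
  by (rule sum.reindex_bij_betw[OF bij_pv])

lemma sum_pv_nx: "(\<Sum>j\<in>sites N. f j (nx N j)) = (\<Sum>j\<in>sites N. f (pv N j) j)"
proof -
  have "(\<Sum>j\<in>sites N. f (pv N j) j) = (\<Sum>j\<in>sites N. f (pv N (nx N j)) (nx N j))"
    by (rule sum_nx[symmetric])
  also have "\<dots> = (\<Sum>j\<in>sites N. f j (nx N j))"
    by (rule sum.cong) auto
  finally show ?thesis by simp
qed

text \<open>Summation by parts on the ring. With \<open>d\<close> the direction of a variation this is the derivative of the coupling energy;
  with two real functions it is the symmetry of the Laplacian.\<close>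

lemma sum_lap:
  fixes d \<psi> :: "int \<Rightarrow> 'a::comm_ring_1"
  shows "(\<Sum>j\<in>sites N. (d (nx N j) - d j) * (\<psi> (nx N j) - \<psi> j)) = (\<Sum>j\<in>sites N. d j * lap N \<psi> j)"
proof -
  have "(\<Sum>j\<in>sites N. (d (nx N j) - d j) * (\<psi> (nx N j) - \<psi> j)) =
      (\<Sum>j\<in>sites N. d (nx N j) * (\<psi> (nx N j) - \<psi> j)) - (\<Sum>j\<in>sites N. d j * (\<psi> (nx N j) - \<psi> j))"
    by (simp add: algebra_simps sum_subtractf sum.distrib)
  also have "(\<Sum>j\<in>sites N. d (nx N j) * (\<psi> (nx N j) - \<psi> j)) = (\<Sum>j\<in>sites N. d j * (\<psi> j - \<psi> (pv N j)))"
    by (rule sum_pv_nx)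
  also have "(\<Sum>j\<in>sites N. d j * (\<psi> j - \<psi> (pv N j))) - (\<Sum>j\<in>sites N. d j * (\<psi> (nx N j) - \<psi> j))
      = (\<Sum>j\<in>sites N. d j * lap N \<psi> j)"
    by (simp add: lap_def sum_subtractf[symmetric] algebra_simps mult_2)
  finally show ?thesis .
qed

lemma has_derivative_cmod_square_line:
  "((\<lambda>s. (cmod (x + d * complex_of_real s))\<^sup>2) has_real_derivative 2 * Re (cnj d * x)) (at 0)"
  unfolding cmod_power2
  by (auto intro!: derivative_eq_intros simp: algebra_simps)

lemma dnls_H_derivative:
  fixes v :: complex and \<psi> :: "int \<Rightarrow> complex"
  assumes j: "j \<in> sites N"
  shows "((\<lambda>s. dnls_H N \<epsilon> (\<psi>(j := \<psi> j + v * complex_of_real s))) has_real_derivative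
    2 * Re (cnj v * (\<psi> j + (cmod (\<psi> j))\<^sup>2 * \<psi> j + \<epsilon> * lap N \<psi> j))) (at 0)"
proof -
  define d where "d k = (if k = j then v else 0)" for k
  have upd: "(\<psi>(j := \<psi> j + v * complex_of_real s)) k = \<psi> k + d k * complex_of_real s" for k s
    by (simp add: d_def)
  have diff: "\<psi> k' + d k' * complex_of_real s - (\<psi> k + d k * complex_of_real s)
    = (\<psi> k' - \<psi> k) + (d k' - d k) * complex_of_real s" for k k' s
    by (simp add: algebra_simps)
  have pow4: "cmod x ^ 4 = ((cmod x)\<^sup>2)\<^sup>2" for x by simp
  note D = has_derivative_cmod_square_line
  have D4: "((\<lambda>s. ((cmod (x + d * complex_of_real s))\<^sup>2)\<^sup>2) has_real_derivative
      2 * (cmod x)\<^sup>2 * (2 * Re (cnj d * x))) (at 0)" for x d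
    using DERIV_power[OF D[of x d], of 2] by (simp add: mult_ac)
  have "((\<lambda>s. dnls_H N \<epsilon> (\<psi>(j := \<psi> j + v * complex_of_real s))) has_real_derivative
     (\<Sum>k\<in>sites N. 2 * Re (cnj (d k) * \<psi> k))
     + 1/2 * (\<Sum>k\<in>sites N. 2 * (cmod (\<psi> k))\<^sup>2 * (2 * Re (cnj (d k) * \<psi> k)))
     + \<epsilon> * (\<Sum>k\<in>sites N. 2 * Re (cnj (d (nx N k) - d k) * (\<psi> (nx N k) - \<psi> k)))) (at 0)"
    unfolding dnls_H_def upd diff pow4 nx_def[symmetric]
    by (intro DERIV_add DERIV_sum D D4 DERIV_cmult)
  also have "(\<Sum>k\<in>sites N. 2 * Re (cnj (d k) * \<psi> k)) = (\<Sum>k\<in>sites N. if k = j then 2 * Re (cnj v * \<psi> k) else 0)"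
    by (rule sum.cong) (auto simp: d_def)
  also have "\<dots> = 2 * Re (cnj v * \<psi> j)" using j by simp
  also have "(\<Sum>k\<in>sites N. 2 * (cmod (\<psi> k))\<^sup>2 * (2 * Re (cnj (d k) * \<psi> k)))
     = (\<Sum>k\<in>sites N. if k = j then 2 * (cmod (\<psi> k))\<^sup>2 * (2 * Re (cnj v * \<psi> k)) else 0)"
    by (rule sum.cong) (auto simp: d_def)
  also have "\<dots> = 2 * (cmod (\<psi> j))\<^sup>2 * (2 * Re (cnj v * \<psi> j))" using j by simp
  also have "(\<Sum>k\<in>sites N. 2 * Re (cnj (d (nx N k) - d k) * (\<psi> (nx N k) - \<psi> k)))
     = 2 * Re (\<Sum>k\<in>sites N. (cnj (d (nx N k)) - cnj (d k)) * (\<psi> (nx N k) - \<psi> k))"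
    by (simp add: sum_distrib_left)
  also have "(\<Sum>k\<in>sites N. (cnj (d (nx N k)) - cnj (d k)) * (\<psi> (nx N k) - \<psi> k))
     = (\<Sum>k\<in>sites N. cnj (d k) * lap N \<psi> k)" by (rule sum_lap)
  also have "\<dots> = (\<Sum>k\<in>sites N. if k = j then cnj v * lap N \<psi> k else 0)"
    by (rule sum.cong) (auto simp: d_def)
  also have "\<dots> = cnj v * lap N \<psi> j" using j by simp
  finally show ?thesis by (simp add: algebra_simps del: fun_upd_apply)
qed

lemma dnls_field_eq:
  fixes \<psi> :: "int \<Rightarrow> complex"
  assumes "j \<in> sites N"
  shows "dnls_field N \<epsilon> \<psi> j = - \<i> * (\<psi> j + (cmod (\<psi> j))\<^sup>2 * \<psi> j + \<epsilon> * lap N \<psi> j)"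
  using DERIV_imp_deriv[OF dnls_H_derivative[OF assms, of \<epsilon> \<psi> 1]]
    DERIV_imp_deriv[OF dnls_H_derivative[OF assms, of \<epsilon> \<psi> \<i>]]
  by (simp add: dnls_field_def dbar_def complex_eq_iff add_divide_distrib diff_divide_distrib del: fun_upd_apply)

section \<open>Periodic solutions near an unperturbed orbit are standing waves\<close>

text \<open>The vector field in the frame rotating with frequency \<open>1 + A\<close>. For \<open>A = - 1\<close> it is the original field, which lets one
  linearization serve both frames.\<close>

definition rot_field :: "nat \<Rightarrow> real \<Rightarrow> real \<Rightarrow> (int \<Rightarrow> complex) \<Rightarrow> int \<Rightarrow> complex" where
  "rot_field N A \<epsilon> \<xi> j = - \<i> * (complex_of_real ((cmod (\<xi> j))\<^sup>2 - A) * \<xi> j + complex_of_real \<epsilon> * lap N \<xi> j)"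

definition lin_field :: "nat \<Rightarrow> real \<Rightarrow> real \<Rightarrow> (int \<Rightarrow> complex) \<Rightarrow> (int \<Rightarrow> complex) \<Rightarrow> int \<Rightarrow> complex" where
  "lin_field N A \<epsilon> \<xi> \<eta> j =
     - \<i> * (complex_of_real (2 * (cmod (\<xi> j))\<^sup>2 - A) * \<eta> j + (\<xi> j)\<^sup>2 * cnj (\<eta> j) + complex_of_real \<epsilon> * lap N \<eta> j)"

lemma norm_lap_le:
  fixes f :: "int \<Rightarrow> complex"
  assumes "\<And>k. k \<in> sites N \<Longrightarrow> cmod (f k) \<le> M" "j \<in> sites N"
  shows "cmod (lap N f j) \<le> 4 * M"
proof -
  have "cmod (lap N f j) \<le> cmod (2 * f j) + cmod (f (nx N j)) + cmod (f (pv N j))"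
    unfolding lap_def by (meson add_mono norm_triangle_ineq4 order_refl order_trans)
  moreover have "cmod (2 * f j) \<le> 2 * M" using assms by (simp add: norm_mult)
  ultimately show ?thesis using assms(1)[of "nx N j"] assms(1)[of "pv N j"] by simp
qed

lemma rotating_frame:
  fixes A :: real
  assumes sol: "dnls_solution N \<epsilon> \<psi>" and j: "j \<in> sites N"
  defines "\<xi> \<equiv> \<lambda>t j. exp (\<i> * complex_of_real ((1 + A) * t)) * \<psi> t j"
  shows "((\<lambda>t. \<xi> t j) has_vector_derivative rot_field N A \<epsilon> (\<xi> t) j) (at t)"
proof -
  let ?e = "\<lambda>t. exp (\<i> * complex_of_real ((1 + A) * t))"
  have D: "((\<lambda>s. \<psi> s j) has_vector_derivative dnls_field N \<epsilon> (\<psi> t) j) (at t)"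
    using sol j by (simp add: dnls_solution_def)
  have De: "(?e has_vector_derivative \<i> * (1 + A) * ?e t) (at t)"
    by (auto intro!: derivative_eq_intros has_vector_derivative_real_field simp: algebra_simps)
  have "((\<lambda>t. \<xi> t j) has_vector_derivative (?e t * dnls_field N \<epsilon> (\<psi> t) j + \<i> * (1 + A) * ?e t * \<psi> t j)) (at t)"
    unfolding \<xi>_def by (rule has_vector_derivative_mult[OF De D])
  moreover have "cmod (\<xi> t j) = cmod (\<psi> t j)" by (simp add: \<xi>_def norm_mult)
  moreover have "lap N (\<xi> t) j = ?e t * lap N (\<psi> t) j" by (simp add: \<xi>_def lap_def algebra_simps)
  ultimately show ?thesis
    using j by (simp add: dnls_field_eq rot_field_def \<xi>_def algebra_simps)
qed

lemma lin_field_is_derivative: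
  assumes D: "\<And>k. k \<in> sites N \<Longrightarrow> ((\<lambda>t. \<xi> t k) has_vector_derivative \<eta> k) (at t)" and j: "j \<in> sites N"
  shows "((\<lambda>t. rot_field N A \<epsilon> (\<xi> t) j) has_vector_derivative lin_field N A \<epsilon> (\<xi> t) \<eta> j) (at t)"
proof -
  note D[OF j, derivative_intros] D[of "nx N j", simplified, derivative_intros] D[of "pv N j", simplified, derivative_intros]
  have "((\<lambda>t. cnj (\<xi> t j)) has_vector_derivative cnj (\<eta> j)) (at t)"
    by (rule has_vector_derivative_cnj[OF D[OF j]])
  note this [derivative_intros]
  have *: "rot_field N A \<epsilon> x j = - \<i> * ((x j * cnj (x j) - A) * x j + \<epsilon> * (2 * x j - x (nx N j) - x (pv N j)))" for x :: "int \<Rightarrow> complex"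
    unfolding rot_field_def lap_def of_real_diff complex_norm_square by simp
  have "of_real ((cmod (\<xi> t j))\<^sup>2) = \<xi> t j * cnj (\<xi> t j)" by (rule complex_norm_square)
  then show ?thesis unfolding *
    by (auto intro!: derivative_eq_intros simp: lin_field_def lap_def algebra_simps power2_eq_square)
qed

lemma has_vector_derivative_bound:
  fixes f :: "real \<Rightarrow> 'a::real_normed_vector"
  assumes "\<And>t. (f has_vector_derivative f' t) (at t)" "\<And>t. norm (f' t) \<le> B"
  shows "norm (f x - f y) \<le> B * \<bar>x - y\<bar>"
proof -
  have "norm (f x - f y) \<le> B * norm (x - y)"
  proof (rule differentiable_bound[where S = UNIV and f' = "\<lambda>t h. h *\<^sub>R f' t"])
    show "onorm (\<lambda>h. h *\<^sub>R f' t) \<le> B" for t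
      by (rule onorm_le) (use assms(2)[of t] in \<open>simp add: mult.commute[of B] mult_left_mono\<close>)
  qed (use assms(1) in \<open>auto simp: has_vector_derivative_def\<close>)
  then show ?thesis by simp
qed

text \<open>The derivative of a periodic function vanishes somewhere, so a bound on the second derivative bounds the first. This replaces
  inverting a differential operator on functions of mean zero.\<close>

lemma periodic_derivative_bound:
  fixes p q r :: "real \<Rightarrow> real"
  assumes T: "T > 0" and p: "\<And>t. (p has_real_derivative q t) (at t)" "\<And>t. p (t + T) = p t"
    and q: "\<And>t. (q has_real_derivative r t) (at t)" "\<And>t. \<bar>r t\<bar> \<le> B"
  shows "\<bar>q t\<bar> \<le> T * B"
proof -
  have "\<exists>z>t. z < t + T \<and> p (t + T) - p t = (t + T - t) * q z"
    by (rule MVT2) (use T p in auto)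
  then obtain z where z: "t < z" "z < t + T" "q z = 0" using T p(2) by auto
  have "norm (q t - q z) \<le> B * \<bar>t - z\<bar>"
    by (rule has_vector_derivative_bound)
       (use q in \<open>auto simp: has_real_derivative_iff_has_vector_derivative\<close>)
  also have "\<dots> \<le> B * T" using z q(2)[of t] by (intro mult_left_mono) auto
  finally show ?thesis using z by (simp add: mult.commute)
qed

lemma cmod_square_diff:
  assumes "cmod (x - y) \<le> \<delta>" "cmod y \<le> R" "\<delta> \<le> 1"
  shows "\<bar>(cmod x)\<^sup>2 - (cmod y)\<^sup>2\<bar> \<le> \<delta> * (2 * R + 1)" "cmod (x\<^sup>2 - y\<^sup>2) \<le> \<delta> * (2 * R + 1)"
proof -
  have x: "cmod x \<le> cmod y + \<delta>" "\<bar>cmod x - cmod y\<bar> \<le> \<delta>"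
    using norm_triangle_ineq3[of x y] assms by linarith+
  have "\<bar>(cmod x)\<^sup>2 - (cmod y)\<^sup>2\<bar> = \<bar>cmod x - cmod y\<bar> * (cmod x + cmod y)"
    by (simp add: power2_eq_square square_diff_square_factored abs_mult mult.commute)
  also have "\<dots> \<le> \<delta> * (2 * R + 1)" using x assms by (intro mult_mono) auto
  finally show "\<bar>(cmod x)\<^sup>2 - (cmod y)\<^sup>2\<bar> \<le> \<delta> * (2 * R + 1)" .
  have "cmod (x\<^sup>2 - y\<^sup>2) = cmod (x - y) * cmod (x + y)"
    by (simp add: power2_eq_square square_diff_square_factored norm_mult mult.commute)
  also have "cmod (x + y) \<le> 2 * R + 1" using norm_triangle_ineq[of x y] x assms by linarith
  then have "cmod (x - y) * cmod (x + y) \<le> \<delta> * (2 * R + 1)"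
    using assms order_trans[OF norm_ge_zero assms(1)] by (intro mult_mono) auto
  finally show "cmod (x\<^sup>2 - y\<^sup>2) \<le> \<delta> * (2 * R + 1)" .
qed

text \<open>The velocity \<open>\<eta>\<close> of a periodic solution solves the linearized equation, which differs from the one at \<open>\<phi>\<close> by a term of size
  \<open>\<kappa> M\<close>. At a quiet site the unperturbed equation is \<open>\<eta>' = i A \<eta>\<close>, and nonresonance bounds its periodic
  solutions by their forcing. At an excited site \<open>\<zeta> = cnj \<phi> \<eta> / A\<close> satisfies \<open>\<zeta>' = - 2 i A Re \<zeta>\<close> up to the forcing;
  as \<open>\<zeta>\<close> is itself the derivative of a periodic function, first its real and then its imaginary part is small.
  Halving any bound on the velocity forces the velocity to vanish.\<close>

lemma rigidity_step:
  fixes \<xi> :: "real \<Rightarrow> int \<Rightarrow> complex" and \<phi> :: "int \<Rightarrow> complex"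
  assumes T: "T > 0" and A: "A > 0" and \<delta>: "0 \<le> \<delta>" "\<delta> \<le> 1" and \<epsilon>: "0 < \<epsilon>" "\<epsilon> \<le> \<delta>"
    and nonres: "exp (- \<i> * complex_of_real (A * T)) \<noteq> 1"
    and D: "\<And>t j. j \<in> sites N \<Longrightarrow> ((\<lambda>t. \<xi> t j) has_vector_derivative rot_field N A \<epsilon> (\<xi> t) j) (at t)"
    and per: "\<And>t j. j \<in> sites N \<Longrightarrow> \<xi> (t + T) j = \<xi> t j"
    and near: "\<And>t j. j \<in> sites N \<Longrightarrow> cmod (\<xi> t j - \<phi> j) \<le> \<delta>"
    and \<phi>: "\<And>j. j \<in> sites N \<Longrightarrow> \<phi> j = 0 \<or> cmod (\<phi> j) = sqrt A"
    and small1: "T * (\<delta> * (6 * sqrt A + 7)) \<le> cmod (exp (- \<i> * complex_of_real (A * T)) - 1) / 2"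
    and small2: "T * (2 * A * T + 2) * (\<delta> * (6 * sqrt A + 7)) \<le> 1 / 2"
    and M: "\<And>t j. j \<in> sites N \<Longrightarrow> cmod (rot_field N A \<epsilon> (\<xi> t) j) \<le> M"
    and j: "j \<in> sites N"
  shows "cmod (rot_field N A \<epsilon> (\<xi> t) j) \<le> M / 2"
proof -
  define \<eta> where "\<eta> t = rot_field N A \<epsilon> (\<xi> t)" for t
  \<comment> \<open>three times the variation \<open>\<delta> (2 sqrt A + 1)\<close> of a square, and 4 for the Laplacian\<close>
  define \<kappa> where "\<kappa> = \<delta> * (6 * sqrt A + 7)"
  have M0: "0 \<le> M" using M[OF j, of 0] norm_ge_zero order_trans by blast
  have \<kappa>0: "0 \<le> \<kappa>" using \<delta> A by (simp add: \<kappa>_def)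
  have D\<eta>: "((\<lambda>t. \<eta> t j) has_vector_derivative lin_field N A \<epsilon> (\<xi> t) (\<eta> t) j) (at t)" for t
    unfolding \<eta>_def by (rule lin_field_is_derivative[OF D j])
  have \<eta>per: "\<eta> (t + T) j = \<eta> t j" for t
    using per j by (simp add: \<eta>_def rot_field_def lap_def)
  have M': "cmod (\<eta> t k) \<le> M" if "k \<in> sites N" for t k using M that by (simp add: \<eta>_def)
  define h where "h t = lin_field N A \<epsilon> (\<xi> t) (\<eta> t) j
     + \<i> * ((2 * (cmod (\<phi> j))\<^sup>2 - A) * \<eta> t j + (\<phi> j)\<^sup>2 * cnj (\<eta> t j))" for t
  have h: "cmod (h t) \<le> \<kappa> * M" for t
  proof -
    have cm: "cmod (\<phi> j) \<le> sqrt A" using \<phi>[OF j] A by auto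
    note sq = cmod_square_diff[OF near[OF j, of t] cm \<delta>(2)]
    have "h t = - \<i> * (2 * complex_of_real ((cmod (\<xi> t j))\<^sup>2 - (cmod (\<phi> j))\<^sup>2) * \<eta> t j
        + ((\<xi> t j)\<^sup>2 - (\<phi> j)\<^sup>2) * cnj (\<eta> t j) + \<epsilon> * lap N (\<eta> t) j)"
      by (simp add: h_def lin_field_def algebra_simps)
    then have "cmod (h t) = cmod (2 * complex_of_real ((cmod (\<xi> t j))\<^sup>2 - (cmod (\<phi> j))\<^sup>2) * \<eta> t j
        + ((\<xi> t j)\<^sup>2 - (\<phi> j)\<^sup>2) * cnj (\<eta> t j) + \<epsilon> * lap N (\<eta> t) j)"
      by (simp only: norm_mult norm_minus_cancel norm_ii mult_1)
    also have "\<dots> \<le> cmod (2 * complex_of_real ((cmod (\<xi> t j))\<^sup>2 - (cmod (\<phi> j))\<^sup>2) * \<eta> t j)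
       + cmod (((\<xi> t j)\<^sup>2 - (\<phi> j)\<^sup>2) * cnj (\<eta> t j)) + cmod (\<epsilon> * lap N (\<eta> t) j)"
      by (meson add_mono norm_triangle_ineq order_refl order_trans)
    also have "\<dots> \<le> 2 * (\<delta> * (2 * sqrt A + 1)) * M + (\<delta> * (2 * sqrt A + 1)) * M + \<delta> * (4 * M)"
    proof (intro add_mono)
      show "cmod (2 * complex_of_real ((cmod (\<xi> t j))\<^sup>2 - (cmod (\<phi> j))\<^sup>2) * \<eta> t j) \<le> 2 * (\<delta> * (2 * sqrt A + 1)) * M"
        unfolding norm_mult norm_of_real using sq(1) M'[OF j] M0 \<delta> A by (intro mult_mono) auto
      show "cmod (((\<xi> t j)\<^sup>2 - (\<phi> j)\<^sup>2) * cnj (\<eta> t j)) \<le> (\<delta> * (2 * sqrt A + 1)) * M"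
        unfolding norm_mult complex_mod_cnj using sq(2) M'[OF j] M0 \<delta> A by (intro mult_mono) auto
      show "cmod (\<epsilon> * lap N (\<eta> t) j) \<le> \<delta> * (4 * M)"
        unfolding norm_mult norm_of_real
        using norm_lap_le[of N "\<eta> t" M j, OF M' j] M0 \<delta> \<epsilon> by (intro mult_mono) auto
    qed
    also have "\<dots> = \<kappa> * M" by (simp add: \<kappa>_def algebra_simps)
    finally show ?thesis .
  qed
  have D\<eta>': "((\<lambda>t. \<eta> t j) has_vector_derivative
      h t - \<i> * ((2 * (cmod (\<phi> j))\<^sup>2 - A) * \<eta> t j + (\<phi> j)\<^sup>2 * cnj (\<eta> t j))) (at t)" for t
    using D\<eta>[of t] by (simp add: h_def)
  have "cmod (\<eta> t j) \<le> M / 2"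
  proof (cases "\<phi> j = 0")
    case True
    define e where "e t = exp (- \<i> * complex_of_real (A * t))" for t
    have De: "(e has_vector_derivative - \<i> * A * e t) (at t)" for t
      unfolding e_def[abs_def]
      by (auto intro!: derivative_eq_intros has_vector_derivative_real_field simp: algebra_simps)
    have "((\<lambda>t. e t * \<eta> t j) has_vector_derivative
       (e t * (h t - \<i> * ((2 * (cmod (\<phi> j))\<^sup>2 - A) * \<eta> t j + (\<phi> j)\<^sup>2 * cnj (\<eta> t j))) + - \<i> * A * e t * \<eta> t j)) (at t)" for t
      by (rule has_vector_derivative_mult[OF De D\<eta>'])
    then have "((\<lambda>t. e t * \<eta> t j) has_vector_derivative e t * h t) (at t)" for t
      using True by (simp add: algebra_simps)
    then have "cmod (e (t + T) * \<eta> (t + T) j - e t * \<eta> t j) \<le> (\<kappa> * M) * \<bar>(t + T) - t\<bar>"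
      by (rule has_vector_derivative_bound) (use h in \<open>auto simp: norm_mult e_def\<close>)
    also have "e (t + T) * \<eta> (t + T) j - e t * \<eta> t j = e t * (e T - 1) * \<eta> t j"
      using \<eta>per[of t] by (simp add: e_def algebra_simps exp_add[symmetric])
    finally have "cmod (e T - 1) * cmod (\<eta> t j) \<le> T * \<kappa> * M" using T by (simp add: norm_mult mult_ac) (simp add: e_def)
    also have "\<dots> \<le> cmod (e T - 1) / 2 * M"
      using small1 M0 by (intro mult_right_mono) (auto simp: \<kappa>_def e_def)
    finally have "cmod (e T - 1) * cmod (\<eta> t j) \<le> cmod (e T - 1) * (M / 2)" by simp
    then show ?thesis by (rule mult_left_le_imp_le) (use nonres in \<open>simp add: e_def\<close>)
  next
    case False
    then have cA: "cmod (\<phi> j) = sqrt A" using \<phi> j by auto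
    then have cA2: "\<phi> j * cnj (\<phi> j) = A" using A complex_norm_square[of "\<phi> j"] by (simp del: of_real_power)
    define c where "c = cnj (\<phi> j) / A"
    have cmc: "cmod c = 1 / sqrt A" using cA A by (simp add: c_def norm_divide real_div_sqrt field_simps)
    define \<zeta> where "\<zeta> t = c * \<eta> t j" for t
    define B where "B = \<kappa> * M / sqrt A"
    have ch: "cmod (c * h t) \<le> B" for t using h[of t] A by (simp add: norm_mult cmc B_def divide_right_mono)
    have D\<xi>: "((\<lambda>t. c * \<xi> t j) has_vector_derivative \<zeta> t) (at t)" for t
      using has_vector_derivative_mult_right[OF D[OF j, of t], of c] by (simp add: \<zeta>_def \<eta>_def)
    have "c * (\<i> * ((2 * (cmod (\<phi> j))\<^sup>2 - A) * \<eta> t j + (\<phi> j)\<^sup>2 * cnj (\<eta> t j)))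
       = \<i> * (A * (\<zeta> t + cnj (\<zeta> t)))" for t
    proof -
      have "c * (\<phi> j)\<^sup>2 * cnj (\<eta> t j) = (\<phi> j * cnj (\<phi> j)) * \<phi> j * cnj (\<eta> t j) / A"
        by (simp add: c_def power2_eq_square)
      also have "\<dots> = A * cnj (\<zeta> t)" unfolding cA2 by (simp add: \<zeta>_def c_def)
      finally show ?thesis using A unfolding cA by (simp add: \<zeta>_def algebra_simps)
    qed
    moreover have "\<zeta> t + cnj (\<zeta> t) = 2 * Re (\<zeta> t)" for t by (rule complex_add_cnj)
    ultimately have split: "c * (h t - \<i> * ((2 * (cmod (\<phi> j))\<^sup>2 - A) * \<eta> t j + (\<phi> j)\<^sup>2 * cnj (\<eta> t j)))
       = c * h t - \<i> * (2 * A * Re (\<zeta> t))" for t by (simp add: right_diff_distrib)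
    have D\<zeta>: "(\<zeta> has_vector_derivative c * h t - \<i> * (2 * A * Re (\<zeta> t))) (at t)" for t
      using has_vector_derivative_mult_right[OF D\<eta>'[of t], of c] unfolding split \<zeta>_def[abs_def] by simp
    have DRe: "((\<lambda>t. Re (f t)) has_real_derivative Re f') (at t)"
      and DIm: "((\<lambda>t. Im (f t)) has_real_derivative Im f') (at t)"
      if "(f has_vector_derivative f') (at t)" for f f' and t :: real
      using that by (auto simp: has_real_derivative_iff_has_vector_derivative
          intro: bounded_linear.has_vector_derivative bounded_linear_Re bounded_linear_Im)
    have Re: "\<bar>Re (\<zeta> t)\<bar> \<le> T * B" for t
    proof (rule periodic_derivative_bound[OF T DRe[OF D\<xi>] _ DRe[OF D\<zeta>]])
      show "\<bar>Re (c * h t - \<i> * (2 * A * Re (\<zeta> t)))\<bar> \<le> B" for t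
        using abs_Re_le_cmod[of "c * h t"] ch[of t] by simp
    qed (use per j in auto)
    have "\<bar>Im (\<zeta> t)\<bar> \<le> T * (B + 2 * A * (T * B))"
    proof (rule periodic_derivative_bound[OF T DIm[OF D\<xi>] _ DIm[OF D\<zeta>]])
      show "\<bar>Im (c * h t - \<i> * (2 * A * Re (\<zeta> t)))\<bar> \<le> B + 2 * A * (T * B)" for t
      proof -
        have "\<bar>2 * A * Re (\<zeta> t)\<bar> \<le> 2 * A * (T * B)" using Re[of t] A by (simp add: abs_mult)
        then show ?thesis using abs_Im_le_cmod[of "c * h t"] ch[of t] by simp
      qed
    qed (use per j in auto)
    then have "cmod (\<zeta> t) \<le> T * B + T * (B + 2 * A * (T * B))"
      using cmod_le[of "\<zeta> t"] Re[of t] by linarith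
    moreover have "cmod (\<eta> t j) = sqrt A * cmod (\<zeta> t)" using A by (simp add: \<zeta>_def norm_mult cmc)
    ultimately have "cmod (\<eta> t j) \<le> sqrt A * (T * B + T * (B + 2 * A * (T * B)))"
      using A by simp
    also have "\<dots> = (T * (2 * A * T + 2) * \<kappa>) * M" using A by (simp add: B_def field_simps)
    also have "\<dots> \<le> 1 / 2 * M" using small2 M0 by (intro mult_right_mono) (auto simp: \<kappa>_def)
    finally show ?thesis by simp
  qed
  then show ?thesis by (simp add: \<eta>_def)
qed

definition standing_wave :: "nat \<Rightarrow> real \<Rightarrow> real \<Rightarrow> (int \<Rightarrow> complex) \<Rightarrow> bool" where
  "standing_wave N A \<epsilon> \<phi> \<longleftrightarrow>
     (\<forall>j\<in>sites N. complex_of_real ((cmod (\<phi> j))\<^sup>2 - A) * \<phi> j + complex_of_real \<epsilon> * lap N \<phi> j = 0)"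

text \<open>The admissible distance depends on \<open>A\<close> and \<open>T\<close> only, not on the solution; it is what turns uniform convergence into an exact statement.\<close>

lemma rigidity:
  assumes T: "T > 0" and A: "A > 0" and nonres: "exp (- \<i> * complex_of_real (A * T)) \<noteq> 1"
  shows "\<exists>\<delta>>0. \<forall>N \<epsilon> \<xi> \<phi>. 0 < \<epsilon> \<and> \<epsilon> \<le> \<delta> \<and>
       (\<forall>t. \<forall>j\<in>sites N. ((\<lambda>t. \<xi> t j) has_vector_derivative rot_field N A \<epsilon> (\<xi> t) j) (at t) \<and>
           \<xi> (t + T) j = \<xi> t j \<and> cmod (\<xi> t j - \<phi> j) \<le> \<delta>) \<and>
       (\<forall>j\<in>sites N. \<phi> j = 0 \<or> cmod (\<phi> j) = sqrt A)
     \<longrightarrow> (\<forall>t. \<forall>j\<in>sites N. \<xi> t j = \<xi> 0 j \<and> rot_field N A \<epsilon> (\<xi> t) j = 0)"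
proof -
  define K where "K = 6 * sqrt A + 7"
  define c where "c = cmod (exp (- \<i> * complex_of_real (A * T)) - 1)"
  have K: "K > 0" using A by (simp add: K_def add_pos_pos)
  have c: "c > 0" using nonres by (simp add: c_def)
  have TA: "2 * A * T + 2 > 0" using A T by (simp add: add_pos_pos)
  define \<delta> where "\<delta> = Min {1, c / (2 * T * K), 1 / (2 * T * (2 * A * T + 2) * K)}"
  have d0: "\<delta> > 0" using K c T TA by (simp add: \<delta>_def)
  have d: "\<delta> \<le> 1" "\<delta> \<le> c / (2 * T * K)" "\<delta> \<le> 1 / (2 * T * (2 * A * T + 2) * K)"
    unfolding \<delta>_def by (rule Min_le; simp)+
  have s1: "T * (\<delta> * K) \<le> c / 2"
    using d(2) K T by (simp add: pos_le_divide_eq mult_ac)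
  have s2: "T * (2 * A * T + 2) * (\<delta> * K) \<le> 1 / 2"
    using d(3) K T TA by (simp add: pos_le_divide_eq mult_ac)
  show ?thesis
  proof (rule exI[of _ \<delta>], intro conjI d0 allI impI ballI; elim conjE)
    fix N \<epsilon> \<xi> \<phi> t j
    assume \<epsilon>: "0 < \<epsilon>" "\<epsilon> \<le> \<delta>"
      and hyp: "\<forall>t. \<forall>j\<in>sites N. ((\<lambda>t. \<xi> t j) has_vector_derivative rot_field N A \<epsilon> (\<xi> t) j) (at t) \<and>
           \<xi> (t + T) j = \<xi> t j \<and> cmod (\<xi> t j - \<phi> j) \<le> \<delta>"
      and \<phi>': "\<forall>j\<in>sites N. \<phi> j = 0 \<or> cmod (\<phi> j) = sqrt A" and j: "j \<in> sites N"
    have D: "((\<lambda>t. \<xi> t j) has_vector_derivative rot_field N A \<epsilon> (\<xi> t) j) (at t)"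
      and per: "\<xi> (t + T) j = \<xi> t j"
      and near: "cmod (\<xi> t j - \<phi> j) \<le> \<delta>" if "j \<in> sites N" for t j
      using hyp that by auto
    have \<phi>: "\<phi> j = 0 \<or> cmod (\<phi> j) = sqrt A" if "j \<in> sites N" for j using \<phi>' that by auto
    define R where "R = sqrt A + 1"
    define M where "M = (R\<^sup>2 + A) * R + 1 * (4 * R)"
    have R0: "R > 0" using A by (simp add: R_def add_pos_pos)
    have R: "cmod (\<xi> t j) \<le> R" if "j \<in> sites N" for t j
    proof -
      have "cmod (\<phi> j) \<le> sqrt A" using \<phi>[OF that] A by auto
      then show ?thesis
        using near[OF that, of t] norm_triangle_ineq2[of "\<xi> t j" "\<phi> j"] d(1) unfolding R_def by linarith
    qed
    have M: "cmod (rot_field N A \<epsilon> (\<xi> t) j) \<le> M" if j: "j \<in> sites N" for t j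
    proof -
      have "cmod (rot_field N A \<epsilon> (\<xi> t) j)
        = cmod (complex_of_real ((cmod (\<xi> t j))\<^sup>2 - A) * \<xi> t j + \<epsilon> * lap N (\<xi> t) j)"
        by (simp only: rot_field_def norm_mult norm_minus_cancel norm_ii mult_1)
      also have "\<dots> \<le> cmod (complex_of_real ((cmod (\<xi> t j))\<^sup>2 - A) * \<xi> t j) + cmod (\<epsilon> * lap N (\<xi> t) j)"
        by (rule norm_triangle_ineq)
      also have "\<dots> \<le> M" unfolding M_def norm_mult norm_of_real
      proof (intro add_mono mult_mono)
        have "(cmod (\<xi> t j))\<^sup>2 \<le> R\<^sup>2" using R[OF j, of t] by (rule power_mono) simp
        then show "\<bar>(cmod (\<xi> t j))\<^sup>2 - A\<bar> \<le> R\<^sup>2 + A"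
          using A zero_le_power2[of "cmod (\<xi> t j)"] by linarith
        show "cmod (lap N (\<xi> t) j) \<le> 4 * R" by (rule norm_lap_le[OF R j])
      qed (use R[OF j] R0 \<epsilon> d A in auto)
      finally show ?thesis .
    qed
    have iter: "\<forall>t. \<forall>j\<in>sites N. cmod (rot_field N A \<epsilon> (\<xi> t) j) \<le> M / 2 ^ n" for n
    proof (induction n)
      case 0
      then show ?case using M by simp
    next
      case (Suc n)
      have "cmod (rot_field N A \<epsilon> (\<xi> t) j) \<le> (M / 2 ^ n) / 2" if j: "j \<in> sites N" for t j
      proof (rule rigidity_step[where \<phi> = \<phi> and \<delta> = \<delta> and T = T])
        show "T * (\<delta> * (6 * sqrt A + 7)) \<le> cmod (exp (- \<i> * complex_of_real (A * T)) - 1) / 2"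
          using s1 by (simp add: K_def c_def)
        show "T * (2 * A * T + 2) * (\<delta> * (6 * sqrt A + 7)) \<le> 1 / 2" using s2 by (simp add: K_def)
      qed (fact T A \<epsilon> nonres d(1) j less_imp_le[OF d0] D per near \<phi> | use Suc in blast)+
      then show ?case by (auto simp: field_simps)
    qed
    have rot0: "rot_field N A \<epsilon> (\<xi> t) j = 0" for t
    proof -
      have "(\<lambda>n. M / 2 ^ n) \<longlonglongrightarrow> 0" by (rule LIMSEQ_divide_realpow_zero) simp
      then have "cmod (rot_field N A \<epsilon> (\<xi> t) j) \<le> 0"
        by (rule LIMSEQ_le_const) (use iter j in auto)
      then show ?thesis by simp
    qed
    have "cmod (\<xi> t j - \<xi> 0 j) \<le> 0 * \<bar>t - 0\<bar>"
      by (rule has_vector_derivative_bound[OF D[OF j]]) (simp add: rot0)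
    then show "\<xi> t j = \<xi> 0 j" "rot_field N A \<epsilon> (\<xi> t) j = 0" using rot0 by simp_all
  qed
qed

lemma nearby_periodic_is_standing:
  fixes A \<omega> T :: real
  assumes A: "A > 0" and \<omega>: "\<omega> = 1 + A" and T: "T = 2 * pi / \<omega>"
    and nonres: "\<And>k::int. k \<noteq> 0 \<Longrightarrow> of_int k * \<omega> - 1 \<noteq> 0"
  shows "\<exists>\<delta>>0. \<forall>N S \<theta> \<epsilon> \<psi>. 0 < \<epsilon> \<and> \<epsilon> \<le> \<delta> \<and> periodic_solution N \<epsilon> T \<psi> \<and>
       (\<forall>t. \<forall>j\<in>sites N. cmod (\<psi> t j - unperturbed S A \<omega> \<theta> t j) \<le> \<delta>)
     \<longrightarrow> standing_wave N A \<epsilon> (\<psi> 0) \<and>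
        (\<forall>t. \<forall>j\<in>sites N. \<psi> t j = exp (- \<i> * complex_of_real (\<omega> * t)) * \<psi> 0 j)"
proof -
  have w0: "\<omega> > 0" using A \<omega> by simp
  have T0: "T > 0" using w0 by (simp add: T)
  have "exp (- \<i> * complex_of_real (A * T)) \<noteq> 1"
  proof
    assume "exp (- \<i> * complex_of_real (A * T)) = 1"
    then obtain n :: int where "- (A * T) = of_int (2 * n) * pi" by (auto simp: exp_eq_1)
    then have "- A * (2 * pi) = of_int (2 * n) * pi * \<omega>" using w0 by (simp add: T field_simps)
    then have "(- A) * pi = (of_int n * \<omega>) * pi" by (simp add: algebra_simps)
    then have "- A = of_int n * \<omega>" by (rule mult_right_cancel[THEN iffD1, rotated]) simp
    then have "of_int (n + 1) * \<omega> - 1 = 0" by (simp add: \<omega> algebra_simps)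
    then show False using nonres[of "n + 1"] by (cases "n + 1 = 0") auto
  qed
  from rigidity[OF T0 A this] obtain \<delta> where d: "\<delta> > 0" and rig:
    "\<forall>N \<epsilon> \<xi> \<phi>. 0 < \<epsilon> \<and> \<epsilon> \<le> \<delta> \<and>
       (\<forall>t. \<forall>j\<in>sites N. ((\<lambda>t. \<xi> t j) has_vector_derivative rot_field N A \<epsilon> (\<xi> t) j) (at t) \<and>
           \<xi> (t + T) j = \<xi> t j \<and> cmod (\<xi> t j - \<phi> j) \<le> \<delta>) \<and>
       (\<forall>j\<in>sites N. \<phi> j = 0 \<or> cmod (\<phi> j) = sqrt A)
     \<longrightarrow> (\<forall>t. \<forall>j\<in>sites N. \<xi> t j = \<xi> 0 j \<and> rot_field N A \<epsilon> (\<xi> t) j = 0)"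
    by blast
  show ?thesis
  proof (rule exI[of _ \<delta>], intro conjI d allI impI; elim conjE)
    fix N S \<theta> \<epsilon> \<psi>
    assume \<epsilon>: "0 < \<epsilon>" "\<epsilon> \<le> \<delta>" and per: "periodic_solution N \<epsilon> T \<psi>"
      and near: "\<forall>t. \<forall>j\<in>sites N. cmod (\<psi> t j - unperturbed S A \<omega> \<theta> t j) \<le> \<delta>"
    define \<xi> where "\<xi> t j = exp (\<i> * complex_of_real ((1 + A) * t)) * \<psi> t j" for t j
    have *: "\<forall>t. \<forall>j\<in>sites N. \<xi> t j = \<xi> 0 j \<and> rot_field N A \<epsilon> (\<xi> t) j = 0"
    proof (rule rig[THEN spec, THEN spec, THEN spec, THEN spec, THEN mp, of \<epsilon> N \<xi> "unperturbed S A \<omega> \<theta> 0"], intro conjI \<epsilon> allI ballI)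
      show "((\<lambda>t. \<xi> t j) has_vector_derivative rot_field N A \<epsilon> (\<xi> t) j) (at t)" if "j \<in> sites N" for t j
        unfolding \<xi>_def[abs_def] by (rule rotating_frame) (use per that in \<open>auto simp: periodic_solution_def\<close>)
      have "exp (\<i> * complex_of_real ((1 + A) * T)) = 1"
        using w0 by (simp add: T \<omega>[symmetric] exp_eq_1)
      then show "\<xi> (t + T) j = \<xi> t j" if "j \<in> sites N" for t j
        using per that by (simp add: \<xi>_def periodic_solution_def distrib_left exp_add)
      show "cmod (\<xi> t j - unperturbed S A \<omega> \<theta> 0 j) \<le> \<delta>" if "j \<in> sites N" for t j
      proof -
        have "exp (\<i> * complex_of_real ((1 + A) * t)) * unperturbed S A \<omega> \<theta> t j = unperturbed S A \<omega> \<theta> 0 j"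
          by (simp add: unperturbed_def \<omega> mult_exp_exp) (simp add: algebra_simps)
        then have "\<xi> t j - unperturbed S A \<omega> \<theta> 0 j
          = exp (\<i> * complex_of_real ((1 + A) * t)) * (\<psi> t j - unperturbed S A \<omega> \<theta> t j)"
          by (simp add: \<xi>_def right_diff_distrib)
        then show ?thesis using near that by (simp add: norm_mult)
      qed
      show "unperturbed S A \<omega> \<theta> 0 j = 0 \<or> cmod (unperturbed S A \<omega> \<theta> 0 j) = sqrt A" for j
        using A by (simp add: unperturbed_def norm_mult)
    qed
    have \<xi>0: "\<xi> 0 = \<psi> 0" by (simp add: \<xi>_def fun_eq_iff)
    have "standing_wave N A \<epsilon> (\<psi> 0)"
      using *[THEN spec, of 0] by (simp add: standing_wave_def rot_field_def \<xi>0)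
    moreover have "\<psi> t j = exp (- \<i> * complex_of_real (\<omega> * t)) * \<psi> 0 j" if "j \<in> sites N" for t j
    proof -
      have "exp (- \<i> * complex_of_real (\<omega> * t)) * \<xi> t j = \<psi> t j"
        unfolding \<xi>_def \<omega> mult.assoc[symmetric] mult_exp_exp by (simp add: algebra_simps)
      then show ?thesis using * that by (simp add: \<xi>0)
    qed
    ultimately show "standing_wave N A \<epsilon> (\<psi> 0)"
      "\<And>t. \<forall>j\<in>sites N. \<psi> t j = exp (- \<i> * complex_of_real (\<omega> * t)) * \<psi> 0 j" by blast+
  qed
qed

section \<open>The flux obstruction\<close>

text \<open>The equation at a site multiplied by the conjugate amplitude has a real local part, so its imaginary part says that the flux
  entering the site leaves it.\<close>

lemma standing_wave_flux:
  assumes w: "standing_wave N A \<epsilon> \<phi>" and \<epsilon>: "\<epsilon> \<noteq> 0" and j: "- int N < j" "j < int N"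
  shows "Im (cnj (\<phi> (j - 1)) * \<phi> j) = Im (cnj (\<phi> j) * \<phi> (j + 1))"
proof -
  have jN: "j \<in> sites N" using j by (simp add: sites_def)
  have "nx N j = j + 1" "pv N j = j - 1" using j nx_interior[of N j] pv_interior[of N j] by simp_all
  then have "complex_of_real ((cmod (\<phi> j))\<^sup>2 - A) * \<phi> j + complex_of_real \<epsilon> * (2 * \<phi> j - \<phi> (j + 1) - \<phi> (j - 1)) = 0"
    using bspec[OF w[unfolded standing_wave_def lap_def] jN] by simp
  then have "Im (cnj (\<phi> j) * (complex_of_real ((cmod (\<phi> j))\<^sup>2 - A) * \<phi> j
     + complex_of_real \<epsilon> * (2 * \<phi> j - \<phi> (j + 1) - \<phi> (j - 1)))) = 0" by simp
  then have "\<epsilon> * (Im (cnj (\<phi> (j - 1)) * \<phi> j) - Im (cnj (\<phi> j) * \<phi> (j + 1))) = 0"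
    by (simp add: algebra_simps)
  then show ?thesis using \<epsilon> by simp
qed

text \<open>At a site that is empty in the limit the local factor \<open>|x_j|^2 - A + 2 \<epsilon>\<close> tends to \<open>- A\<close>, and solving the equation there
  for \<open>x_j\<close> determines its first order in \<open>\<epsilon>\<close>.\<close>

lemma standing_wave_quiet_site:
  fixes x :: "nat \<Rightarrow> int \<Rightarrow> complex"
  assumes w: "\<forall>\<^sub>F n in sequentially. standing_wave N A (eps n) (x n)" and A: "A > 0"
    and eps: "\<And>n. eps n > 0" "eps \<longlonglongrightarrow> 0" and j: "- int N < j" "j < int N"
    and lim: "\<And>k. k \<in> sites N \<Longrightarrow> (\<lambda>n. x n k) \<longlonglongrightarrow> c k" and cj: "c j = 0"
  shows "(\<lambda>n. x n j / complex_of_real (eps n)) \<longlonglongrightarrow> - (c (j + 1) + c (j - 1)) / complex_of_real A"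
proof -
  have jN: "j \<in> sites N" "j + 1 \<in> sites N" "j - 1 \<in> sites N" using j by (auto simp: sites_def)
  define D where "D n = (cmod (x n j))\<^sup>2 - A + 2 * eps n" for n
  have D: "D \<longlonglongrightarrow> - A"
    unfolding D_def by (auto intro!: tendsto_eq_intros lim[OF jN(1)] eps simp: cj)
  have "\<forall>\<^sub>F n in sequentially. D n < 0"
    using D A by (auto intro: order_tendstoD)
  with w have ev: "\<forall>\<^sub>F n in sequentially.
      (x n (j + 1) + x n (j - 1)) / complex_of_real (D n) = x n j / complex_of_real (eps n)"
  proof eventually_elim
    case (elim n)
    have "nx N j = j + 1" "pv N j = j - 1" using j nx_interior[of N j] pv_interior[of N j] by simp_all
    then have "complex_of_real ((cmod (x n j))\<^sup>2 - A) * x n j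
        + complex_of_real (eps n) * (2 * x n j - x n (j + 1) - x n (j - 1)) = 0"
      using bspec[OF elim(1)[unfolded standing_wave_def lap_def] jN(1)] by simp
    then have "complex_of_real (D n) * x n j = complex_of_real (eps n) * (x n (j + 1) + x n (j - 1))"
      by (simp add: D_def algebra_simps)
    then show ?case using elim(2) eps(1)[of n] by (simp add: field_simps)
  qed
  have "(\<lambda>n. (x n (j + 1) + x n (j - 1)) / complex_of_real (D n)) \<longlonglongrightarrow> (c (j + 1) + c (j - 1)) / complex_of_real (- A)"
    by (intro tendsto_intros lim jN D) (use A in auto)
  from Lim_transform_eventually[OF this ev] show ?thesis by (simp add: minus_divide_left)
qed

lemma sin_zero_rcong:
  assumes "sin d = 0" "[d = q] (rmod (2 * pi))"
  shows "[q = 0] (rmod (2 * pi)) \<or> [q = pi] (rmod (2 * pi))"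
proof -
  obtain i :: int where i: "d = of_int i * pi" using assms(1) by (auto simp: sin_zero_iff_int2)
  obtain k where "i = 2 * k \<or> i = 2 * k + 1" by (metis evenE oddE)
  then have "d = 0 + of_int k * (2 * pi) \<or> d = pi + of_int k * (2 * pi)" using i by (auto simp: algebra_simps)
  then have "[d = 0] (rmod (2 * pi)) \<or> [d = pi] (rmod (2 * pi))"
    by (metis rcong_altdef rcong_sym)
  then show ?thesis using assms(2) rcong_trans rcong_sym by blast
qed

lemma limits_have_phases_0_or_pi:
  fixes N :: nat and A \<omega> T :: real
  assumes N: "6 \<le> N" and A: "A > 0" and \<omega>: "\<omega> = 1 + A" and T: "T = 2 * pi / \<omega>"
    and nonres: "\<And>k::int. k \<noteq> 0 \<Longrightarrow> of_int k * \<omega> - 1 \<noteq> 0"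
    and q: "phase_differences \<theta> q\<^sub>2 q\<^sub>3"
    and eps: "\<And>n. eps n > 0" "eps \<longlonglongrightarrow> 0"
    and sol: "\<And>n. periodic_solution N (eps n) T (\<psi> n)"
    and lim: "\<And>j. j \<in> sites N \<Longrightarrow> uniform_limit UNIV (\<lambda>n t. \<psi> n t j)
           (\<lambda>t. unperturbed excited A \<omega> \<theta> t j) sequentially"
  shows "([q\<^sub>2 = 0] (rmod (2 * pi)) \<or> [q\<^sub>2 = pi] (rmod (2 * pi))) \<and>
        ([q\<^sub>3 = 0] (rmod (2 * pi)) \<or> [q\<^sub>3 = pi] (rmod (2 * pi)))"
proof -
  from nearby_periodic_is_standing[OF A \<omega> T nonres]
  obtain \<delta> where d: "\<delta> > 0" and std: "\<forall>N S \<theta> \<epsilon> \<psi>. 0 < \<epsilon> \<and> \<epsilon> \<le> \<delta> \<and> periodic_solution N \<epsilon> T \<psi> \<and>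
       (\<forall>t. \<forall>j\<in>sites N. cmod (\<psi> t j - unperturbed S A \<omega> \<theta> t j) \<le> \<delta>)
     \<longrightarrow> standing_wave N A \<epsilon> (\<psi> 0) \<and>
        (\<forall>t. \<forall>j\<in>sites N. \<psi> t j = exp (- \<i> * complex_of_real (\<omega> * t)) * \<psi> 0 j)"
    by blast
  have "\<forall>\<^sub>F n in sequentially. \<forall>j\<in>sites N. \<forall>t\<in>UNIV. dist (\<psi> n t j) (unperturbed excited A \<omega> \<theta> t j) < \<delta>"
    using uniform_limitD[OF lim d] by (intro eventually_ball_finite) auto
  moreover have "\<forall>\<^sub>F n in sequentially. eps n < \<delta>"
    using eps(2) d by (auto intro: order_tendstoD)
  ultimately have w: "\<forall>\<^sub>F n in sequentially. standing_wave N A (eps n) (\<psi> n 0)"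
  proof eventually_elim
    case (elim n)
    have "\<forall>t. \<forall>j\<in>sites N. cmod (\<psi> n t j - unperturbed excited A \<omega> \<theta> t j) \<le> \<delta>"
      using elim by (auto simp: dist_norm less_imp_le)
    then show ?case using std eps(1)[of n] elim(2) sol[of n] less_imp_le by blast
  qed
  define c where "c j = unperturbed excited A \<omega> \<theta> 0 j" for j
  have x: "(\<lambda>n. \<psi> n 0 k) \<longlonglongrightarrow> c k" if "k \<in> sites N" for k
    unfolding c_def by (rule tendsto_uniform_limitI[OF lim[OF that]]) simp
  have sites: "-2 \<in> sites N" "-1 \<in> sites N" "0 \<in> sites N" "1 \<in> sites N" "2 \<in> sites N" "3 \<in> sites N"
    using N by (auto simp: sites_def)
  have c0: "c 0 = 0" "c 2 = 0" "c 3 = 0" by (auto simp: c_def unperturbed_def excited_def)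
  have cc: "Im (cnj (c i) * c j) = - A * sin (\<theta> j - \<theta> i)" if "i \<in> excited" "j \<in> excited" for i j
  proof -
    have "cnj (c i) * c j = (complex_of_real (sqrt A) * complex_of_real (sqrt A)) * exp (- \<i> * complex_of_real (\<theta> j - \<theta> i))"
      using that by (simp add: c_def unperturbed_def exp_cnj mult_exp_exp algebra_simps)
    also have "complex_of_real (sqrt A) * complex_of_real (sqrt A) = A"
      using A by (simp flip: of_real_mult)
    finally show ?thesis using sin_minus[of "\<theta> j - \<theta> i"] by (simp add: Im_exp)
  qed
  have chain: "\<forall>\<^sub>F n in sequentially. Im (cnj (\<psi> n 0 (-2)) * \<psi> n 0 (-1)) = Im (cnj (\<psi> n 0 2) * \<psi> n 0 3)
      \<and> Im (cnj (\<psi> n 0 (-1)) * \<psi> n 0 0) = Im (cnj (\<psi> n 0 2) * \<psi> n 0 3)"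
    using w
  proof eventually_elim
    case (elim n)
    have e: "eps n \<noteq> 0" using eps(1)[of n] by simp
    note f = standing_wave_flux[OF elim e]
    show ?case using f[of "-1"] f[of 0] f[of 1] f[of 2] N by simp
  qed
  have "(\<lambda>n. Im (cnj (\<psi> n 0 (-2)) * \<psi> n 0 (-1))) \<longlonglongrightarrow> Im (cnj (c (-2)) * c (-1))"
    by (intro tendsto_intros x sites)
  moreover have "(\<lambda>n. Im (cnj (\<psi> n 0 2) * \<psi> n 0 3)) \<longlonglongrightarrow> Im (cnj (c 2) * c 3)"
    by (intro tendsto_intros x sites)
  then have "(\<lambda>n. Im (cnj (\<psi> n 0 (-2)) * \<psi> n 0 (-1))) \<longlonglongrightarrow> Im (cnj (c 2) * c 3)"
    by (rule Lim_transform_eventually) (use chain in eventually_elim, simp)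
  ultimately have "Im (cnj (c (-2)) * c (-1)) = Im (cnj (c 2) * c 3)"
    using LIMSEQ_unique by blast
  then have s2: "sin (\<theta> (-1) - \<theta> (-2)) = 0"
    using cc[of "-2" "-1"] A c0 by (simp add: excited_def)
  note quiet = standing_wave_quiet_site[OF w A eps _ _ x]
  have y0: "(\<lambda>n. \<psi> n 0 0 / complex_of_real (eps n)) \<longlonglongrightarrow> - (c 1 + c (-1)) / complex_of_real A"
    using quiet[of 0] N c0 by simp
  have y2: "(\<lambda>n. \<psi> n 0 2 / complex_of_real (eps n)) \<longlonglongrightarrow> - (c 3 + c 1) / complex_of_real A"
    using quiet[of 2] N c0 by simp
  have "(\<lambda>n. Im (cnj (\<psi> n 0 (-1)) * (\<psi> n 0 0 / complex_of_real (eps n))))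
     \<longlonglongrightarrow> Im (cnj (c (-1)) * (- (c 1 + c (-1)) / complex_of_real A))"
    by (intro tendsto_intros x sites y0)
  moreover have "(\<lambda>n. Im (cnj (\<psi> n 0 2 / complex_of_real (eps n)) * \<psi> n 0 3))
     \<longlonglongrightarrow> Im (cnj (- (c 3 + c 1) / complex_of_real A) * c 3)"
    by (intro tendsto_intros x sites y2)
  then have "(\<lambda>n. Im (cnj (\<psi> n 0 (-1)) * (\<psi> n 0 0 / complex_of_real (eps n))))
     \<longlonglongrightarrow> Im (cnj (- (c 3 + c 1) / complex_of_real A) * c 3)"
  proof (rule Lim_transform_eventually)
    show "\<forall>\<^sub>F n in sequentially. Im (cnj (\<psi> n 0 2 / complex_of_real (eps n)) * \<psi> n 0 3)
       = Im (cnj (\<psi> n 0 (-1)) * (\<psi> n 0 0 / complex_of_real (eps n)))"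
      using chain
    proof eventually_elim
      case (elim n)
      have "Im (cnj (\<psi> n 0 2 / complex_of_real (eps n)) * \<psi> n 0 3) = Im (cnj (\<psi> n 0 2) * \<psi> n 0 3) / eps n"
        "Im (cnj (\<psi> n 0 (-1)) * (\<psi> n 0 0 / complex_of_real (eps n))) = Im (cnj (\<psi> n 0 (-1)) * \<psi> n 0 0) / eps n"
        by (simp_all add: add_divide_distrib diff_divide_distrib)
      then show ?case using elim by simp
    qed
  qed
  ultimately have "Im (cnj (c (-1)) * (- (c 1 + c (-1)) / complex_of_real A)) = 0"
    using LIMSEQ_unique c0 by fastforce
  moreover have "cnj (c (-1)) * (- (c 1 + c (-1)) / complex_of_real A)
     = - (cnj (c (-1)) * c 1 + cnj (c (-1)) * c (-1)) / complex_of_real A"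
    using A by (simp add: field_simps)
  ultimately have "Im (cnj (c (-1)) * c 1) + Im (cnj (c (-1)) * c (-1)) = 0"
    using A by (simp only: Im_divide_of_real) simp
  then have s3: "sin (\<theta> 1 - \<theta> (-1)) = 0"
    using cc[of "-1" 1] cc[of "-1" "-1"] A by (simp add: excited_def)
  show ?thesis using sin_zero_rcong[OF s2] sin_zero_rcong[OF s3] q by (simp add: phase_differences_def)
qed

section \<open>Real standing waves\<close>

text \<open>The contraction is measured by bounds at finitely many or infinitely many coordinates in \<open>J\<close>, so that no norm on lattice functions
  has to be introduced. Starting from \<open>c\<close> the iterates move by at most \<open>r / 2\<close>, hence stay in the ball.\<close>

lemma contraction_fixpoint:
  fixes G :: "('a \<Rightarrow> real) \<Rightarrow> 'a \<Rightarrow> real"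
  assumes r: "0 \<le> r" and base: "\<And>j. j \<in> J \<Longrightarrow> \<bar>G c j - c j\<bar> \<le> r / 2"
    and contr: "\<And>f g m j. \<forall>k\<in>J. \<bar>f k - c k\<bar> \<le> r \<Longrightarrow> \<forall>k\<in>J. \<bar>g k - c k\<bar> \<le> r \<Longrightarrow>
      \<forall>k\<in>J. \<bar>f k - g k\<bar> \<le> m \<Longrightarrow> j \<in> J \<Longrightarrow> \<bar>G f j - G g j\<bar> \<le> m / 2"
  shows "\<exists>f. \<forall>j\<in>J. \<bar>f j - c j\<bar> \<le> r \<and> G f j = f j"
proof -
  define it where "it n = (G ^^ n) c" for n
  have it0: "it 0 = c" and itS: "it (Suc n) = G (it n)" for n by (simp_all add: it_def)
  have ball: "\<forall>j\<in>J. \<bar>it n j - c j\<bar> \<le> r" for n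
  proof (induction n)
    case 0
    then show ?case using r by (simp add: it0)
  next
    case (Suc n)
    show ?case
    proof
      fix j assume j: "j \<in> J"
      have "\<bar>G (it n) j - G c j\<bar> \<le> r / 2"
        by (rule contr[OF Suc _ Suc j]) (use r in auto)
      then show "\<bar>it (Suc n) j - c j\<bar> \<le> r" using base[OF j] unfolding itS by linarith
    qed
  qed
  have close: "\<forall>j\<in>J. \<bar>it (n + k) j - it n j\<bar> \<le> r / 2 ^ n" for n k
  proof (induction n)
    case 0
    then show ?case using ball[of k] by (simp add: it0)
  next
    case (Suc n)
    show ?case
    proof
      fix j assume j: "j \<in> J"
      have "\<bar>G (it (n + k)) j - G (it n) j\<bar> \<le> r / 2 ^ n / 2" by (rule contr[OF ball ball Suc j])
      then show "\<bar>it (Suc n + k) j - it (Suc n) j\<bar> \<le> r / 2 ^ Suc n" by (simp add: itS)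
    qed
  qed
  have small: "(\<lambda>n. r / 2 ^ n) \<longlonglongrightarrow> 0" by (rule LIMSEQ_divide_realpow_zero) simp
  have "convergent (\<lambda>n. it n j)" if j: "j \<in> J" for j
  proof (rule Cauchy_convergent, unfold Cauchy_altdef2, intro allI impI)
    fix \<eta> :: real assume "0 < \<eta>"
    with small have "\<forall>\<^sub>F n in sequentially. r / 2 ^ n < \<eta>" by (rule order_tendstoD)
    then obtain n where n: "r / 2 ^ n < \<eta>" by (auto simp: eventually_sequentially)
    have "dist (it m j) (it n j) < \<eta>" if "m \<ge> n" for m
      using close[of n "m - n"] n that j by (auto simp: dist_norm intro: le_less_trans)
    then show "\<exists>n. \<forall>m\<ge>n. dist (it m j) (it n j) < \<eta>" by blast
  qed
  then have lim: "(\<lambda>n. it n j) \<longlonglongrightarrow> lim (\<lambda>n. it n j)" if "j \<in> J" for j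
    using that convergent_LIMSEQ_iff by blast
  define f where "f j = lim (\<lambda>n. it n j)" for j
  have near: "\<forall>j\<in>J. \<bar>f j - it n j\<bar> \<le> r / 2 ^ n" for n
  proof
    fix j assume j: "j \<in> J"
    have "(\<lambda>k. \<bar>it (n + k) j - it n j\<bar>) \<longlonglongrightarrow> \<bar>f j - it n j\<bar>"
    proof (intro tendsto_rabs tendsto_diff tendsto_const)
      show "(\<lambda>k. it (n + k) j) \<longlonglongrightarrow> f j"
        using LIMSEQ_ignore_initial_segment[OF lim[OF j], of n] by (simp add: f_def add.commute)
    qed
    then show "\<bar>f j - it n j\<bar> \<le> r / 2 ^ n" by (rule LIMSEQ_le_const2) (use close j in auto)
  qed
  have "G f j = f j" if j: "j \<in> J" for j
  proof -
    have "\<bar>G f j - f j\<bar> \<le> r / 2 ^ n" for n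
    proof -
      have "\<bar>G f j - G (it n) j\<bar> \<le> (r / 2 ^ n) / 2"
        by (rule contr[OF _ ball near j]) (use near[of 0] in \<open>simp add: it0\<close>)
      moreover have "\<bar>f j - it (Suc n) j\<bar> \<le> r / 2 ^ Suc n" using near j by blast
      ultimately show ?thesis unfolding itS by simp
    qed
    then have "\<bar>G f j - f j\<bar> \<le> 0" by (intro LIMSEQ_le_const[OF small]) auto
    then show ?thesis by simp
  qed
  moreover have "\<bar>f j - c j\<bar> \<le> r" if "j \<in> J" for j using near[of 0] that by (simp add: it0)
  ultimately show ?thesis by (intro exI[of _ f]) auto
qed

text \<open>The standing wave equation for real amplitudes in units of \<open>sqrt A\<close>, with \<open>e = \<epsilon> / A\<close>.\<close>

definition real_wave :: "nat \<Rightarrow> real \<Rightarrow> (int \<Rightarrow> real) \<Rightarrow> bool" where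
  "real_wave N e u \<longleftrightarrow> (\<forall>j\<in>sites N. ((u j)\<^sup>2 - 1) * u j + e * lap N u j = 0)"

lemma abs_lap_le:
  fixes f :: "int \<Rightarrow> real"
  assumes "\<forall>k\<in>sites N. \<bar>f k\<bar> \<le> M" "j \<in> sites N"
  shows "\<bar>lap N f j\<bar> \<le> 4 * M"
  using assms(1)[rule_format, of j] assms(1)[rule_format, of "nx N j"] assms(1)[rule_format, of "pv N j"] assms(2)
  by (simp add: lap_def)

lemma lap_diff: "lap N (\<lambda>j. f j - g j) j = lap N f j - lap N g j"
  by (simp add: lap_def algebra_simps)

text \<open>Newton iteration with the derivative frozen at the uncoupled state \<open>\<sigma>\<close>, which is diagonal with entries \<open>2\<close> and \<open>- 1\<close>. The ball
  of radius \<open>8 e\<close> is a bound on the distance as well, hence gives the convergence as \<open>e\<close> tends to zero.\<close>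

lemma real_wave_exists:
  fixes \<sigma> :: "int \<Rightarrow> real"
  assumes e: "0 < e" "e \<le> 1 / 120" and \<sigma>: "\<And>j. \<sigma> j \<in> {-1, 0, 1}"
  shows "\<exists>u. real_wave N e u \<and> (\<forall>j\<in>sites N. \<bar>u j - \<sigma> j\<bar> \<le> 8 * e)"
proof -
  define D where "D j = 3 * (\<sigma> j)\<^sup>2 - 1" for j
  have D: "D j = 2 \<or> D j = - 1" for j using \<sigma>[of j] by (auto simp: D_def)
  have D1: "1 \<le> \<bar>D j\<bar>" "D j \<noteq> 0" for j using D[of j] by auto
  have \<sigma>1: "\<bar>\<sigma> j\<bar> \<le> 1" for j using \<sigma>[of j] by auto
  define G where "G u j = u j - (((u j)\<^sup>2 - 1) * u j + e * lap N u j) / D j" for u :: "int \<Rightarrow> real" and j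
  have "\<exists>u. \<forall>j\<in>sites N. \<bar>u j - \<sigma> j\<bar> \<le> 8 * e \<and> G u j = u j"
  proof (rule contraction_fixpoint)
    fix j assume j: "j \<in> sites N"
    have "((\<sigma> j)\<^sup>2 - 1) * \<sigma> j = 0" using \<sigma>[of j] by auto
    then have "G \<sigma> j - \<sigma> j = - (e * lap N \<sigma> j / D j)" unfolding G_def by simp
    then have "\<bar>G \<sigma> j - \<sigma> j\<bar> = e * \<bar>lap N \<sigma> j\<bar> / \<bar>D j\<bar>" using e by (simp add: abs_mult)
    also have "\<dots> \<le> e * (4 * 1) / 1"
      using D1[of j] e abs_lap_le[OF _ j, of \<sigma> 1] \<sigma>1 by (intro frac_le mult_mono) auto
    finally show "\<bar>G \<sigma> j - \<sigma> j\<bar> \<le> 8 * e / 2" by simp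
  next
    fix f g :: "int \<Rightarrow> real" and m j
    assume f: "\<forall>k\<in>sites N. \<bar>f k - \<sigma> k\<bar> \<le> 8 * e" and g: "\<forall>k\<in>sites N. \<bar>g k - \<sigma> k\<bar> \<le> 8 * e"
      and fg: "\<forall>k\<in>sites N. \<bar>f k - g k\<bar> \<le> m" and j: "j \<in> sites N"
    have m: "0 \<le> m" using fg j by force
    define x y where "x = f j - \<sigma> j" and "y = g j - \<sigma> j"
    have xy: "\<bar>x\<bar> \<le> 8 * e" "\<bar>y\<bar> \<le> 8 * e" using f g j by (simp_all add: x_def y_def)
    define P where "P = 3 * \<sigma> j * (x + y) + x * x + x * y + y * y"
    have b1: "\<bar>3 * \<sigma> j * (x + y)\<bar> \<le> 3 * 1 * (16 * e)"
      unfolding abs_mult using \<sigma>1[of j] xy by (intro mult_mono) auto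
    have b: "\<bar>a * b\<bar> \<le> 8 * e * (1 / 15)" if "\<bar>a\<bar> \<le> 8 * e" "\<bar>b\<bar> \<le> 8 * e" for a b :: real
      unfolding abs_mult using that e by (intro mult_mono) auto
    have P: "\<bar>P\<bar> \<le> 50 * e"
      unfolding P_def using b1 b[OF xy(1) xy(1)] b[OF xy(1) xy(2)] b[OF xy(2) xy(2)] e by linarith
    have "G f j - G g j = (f j - g j) * (D j - ((f j)\<^sup>2 + f j * g j + (g j)\<^sup>2 - 1)) / D j - e * lap N (\<lambda>j. f j - g j) j / D j"
      using D1(2)[of j] by (simp add: G_def lap_diff field_simps power2_eq_square)
    also have "D j - ((f j)\<^sup>2 + f j * g j + (g j)\<^sup>2 - 1) = - P"
      by (simp add: D_def P_def x_def y_def algebra_simps power2_eq_square)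
    also have "(f j - g j) * (- P) / D j - e * lap N (\<lambda>j. f j - g j) j / D j
        = - ((f j - g j) * P + e * lap N (\<lambda>j. f j - g j) j) / D j"
      by (simp add: diff_divide_distrib)
    finally have "\<bar>G f j - G g j\<bar> = \<bar>- ((f j - g j) * P + e * lap N (\<lambda>j. f j - g j) j)\<bar> / \<bar>D j\<bar>"
      by (simp only: abs_divide)
    also have "\<dots> \<le> \<bar>- ((f j - g j) * P + e * lap N (\<lambda>j. f j - g j) j)\<bar> / 1"
      using D1[of j] by (intro divide_left_mono) auto
    also have "\<dots> \<le> \<bar>(f j - g j) * P\<bar> + \<bar>e * lap N (\<lambda>j. f j - g j) j\<bar>" using abs_triangle_ineq[of "(f j - g j) * P" "e * lap N (\<lambda>j. f j - g j) j"] by (simp only: div_by_1 abs_minus_cancel)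
    also have "\<dots> \<le> m * (50 * e) + e * (4 * m)"
      unfolding abs_mult using fg j P m e abs_lap_le[OF fg j] by (intro add_mono mult_mono) auto
    also have "\<dots> = m * (54 * e)" by (simp add: algebra_simps)
    also have "\<dots> \<le> m * (1 / 2)" using e m by (intro mult_left_mono) auto
    finally show "\<bar>G f j - G g j\<bar> \<le> m / 2" by simp
  qed (use e in auto)
  then obtain u where u: "\<forall>j\<in>sites N. \<bar>u j - \<sigma> j\<bar> \<le> 8 * e \<and> G u j = u j" by blast
  then have "real_wave N e u" using D1 by (auto simp: real_wave_def G_def)
  then show ?thesis using u by blast
qed

text \<open>The value at the site -1 normalizes the global phase.\<close>

definition sign_pattern :: "(int \<Rightarrow> real) \<Rightarrow> bool" where
  "sign_pattern \<sigma> \<longleftrightarrow> (\<forall>j\<in>excited. \<bar>\<sigma> j\<bar> = 1) \<and> (\<forall>j. j \<notin> excited \<longrightarrow> \<sigma> j = 0) \<and> \<sigma> (-1) = 1"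

text \<open>Both the real and the imaginary part of \<open>f\<close> lie in the kernel of the real operator \<open>|f|^2 - 1 + e L\<close>. Its diagonal entry at the site
  -2 is of order \<open>e\<close>, because \<open>f\<close> itself solves the equation there; a kernel element vanishing at -1 is then
  controlled at -2 through the quiet sites -3 and -4, at 0 by the equation at -1, and at 1 by the equation at 0.
  Each bound on the kernel element can be halved, so it is zero.\<close>

lemma wave_imaginary_part_vanishes:
  fixes f :: "int \<Rightarrow> complex"
  assumes N: "6 \<le> N" and e: "0 < e" "e \<le> d" and d: "d \<le> 1 / 10000"
    and w: "standing_wave N 1 e f" and \<sigma>: "sign_pattern \<sigma>"
    and near: "\<And>j. j \<in> sites N \<Longrightarrow> cmod (f j - complex_of_real (\<sigma> j)) \<le> d"
    and gauge: "Im (f (-1)) = 0" and j: "j \<in> sites N"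
  shows "Im (f j) = 0"
proof -
  define v where "v j = Im (f j)" for j
  define K where "K j = (cmod (f j))\<^sup>2 - 1 + 2 * e" for j
  have rowf: "complex_of_real (K j) * f j = complex_of_real e * (f (nx N j) + f (pv N j))" if "j \<in> sites N" for j
    using w that by (simp add: standing_wave_def lap_def K_def algebra_simps)
  have row: "K j * v j = e * (v (nx N j) + v (pv N j))" if "j \<in> sites N" for j
    using arg_cong[OF rowf[OF that], of Im] by (simp add: v_def)
  have in_sites: "i \<in> sites N" if "-5 \<le> i" "i \<le> 5" for i using that N by (simp add: sites_def)
  have nx: "nx N i = i + 1" and pv: "pv N i = i - 1" if "-5 \<le> i" "i \<le> 5" for i
    using that N by (simp_all add: nx_interior pv_interior)
  have quiet: "-1 \<le> K i" "K i \<le> - (9 / 10)" if "i \<in> sites N" "i \<notin> excited" for i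
  proof -
    have "cmod (f i) \<le> d" using near[OF that(1)] \<sigma> that(2) by (simp add: sign_pattern_def)
    then have "(cmod (f i))\<^sup>2 \<le> d\<^sup>2" by (rule power_mono) simp
    also have "d\<^sup>2 \<le> (1 / 10000)\<^sup>2" using e d by (intro power_mono) auto
    finally show "K i \<le> - (9 / 10)" using e d by (simp add: K_def power2_eq_square)
    show "-1 \<le> K i" using e by (simp add: K_def)
  qed
  have quiet_bound: "\<bar>v i\<bar> \<le> (10 / 9) * e * (\<bar>v (nx N i)\<bar> + \<bar>v (pv N i)\<bar>)" if i: "i \<in> sites N" "i \<notin> excited" for i
  proof -
    have "(9 / 10) * \<bar>v i\<bar> \<le> \<bar>K i\<bar> * \<bar>v i\<bar>" using quiet[OF i] by (intro mult_right_mono) auto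
    also have "\<dots> = e * \<bar>v (nx N i) + v (pv N i)\<bar>" using row[OF i(1)] e by (simp flip: abs_mult) (simp add: abs_mult)
    also have "\<dots> \<le> e * (\<bar>v (nx N i)\<bar> + \<bar>v (pv N i)\<bar>)" using e by (intro mult_left_mono) auto
    finally show ?thesis by simp
  qed
  have exc: "-2 \<in> excited" "-1 \<in> excited" "1 \<in> excited" "-3 \<notin> excited" "-4 \<notin> excited" "0 \<notin> excited" "2 \<notin> excited"
    by (auto simp: excited_def)
  \<comment> \<open>the wave equation at -2 determines this entry up to its sign, which depends on the phases\<close>
  have K2: "(9 / 10) * e \<le> \<bar>K (-2)\<bar>"
  proof -
    have "cmod (f (-1)) \<ge> 1 - d" "cmod (f (-3)) \<le> d" "cmod (f (-2)) \<le> 1 + d"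
      using near[OF in_sites, of "-1"] near[OF in_sites, of "-2"] near[OF in_sites, of "-3"] \<sigma> exc
        norm_triangle_ineq2[of "complex_of_real (\<sigma> (-1))" "f (-1)"] norm_triangle_ineq2[of "f (-2)" "complex_of_real (\<sigma> (-2))"]
      by (auto simp: sign_pattern_def norm_minus_commute)
    then have "9999 / 10000 - 1 / 10000 \<le> cmod (f (-1) + f (-3))" "cmod (f (-2)) \<le> 10001 / 10000"
      using norm_diff_ineq[of "f (-1)" "f (-3)"] d by linarith+
    then have "e * (9998 / 10000) \<le> e * cmod (f (-1) + f (-3))" using e by simp
    also have "\<dots> = \<bar>K (-2)\<bar> * cmod (f (-2))"
      using arg_cong[OF rowf[OF in_sites, of "-2"], of cmod] e nx[of "-2"] pv[of "-2"] by (simp add: norm_mult)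
    also have "\<dots> \<le> \<bar>K (-2)\<bar> * (10001 / 10000)" using \<open>cmod (f (-2)) \<le> 10001 / 10000\<close> by (intro mult_left_mono) auto
    finally show ?thesis using e by linarith
  qed
  have v1: "v (-1) = 0" using gauge by (simp add: v_def)
  have step: "\<forall>j\<in>sites N. \<bar>v j\<bar> \<le> m / 2" if m: "\<forall>j\<in>sites N. \<bar>v j\<bar> \<le> m" for m
  proof -
    have m0: "0 \<le> m" using m in_sites[of 0] by force
    have em: "0 \<le> e * m" "e * m \<le> m / 10000" using e d m0 mult_right_mono[of e "1/10000" m] by auto
    have eem: "0 \<le> e * (e * m)" "e * (e * m) \<le> (e * m) / 10000"
      using e d em mult_right_mono[of e "1/10000" "e * m"] by auto
    have off: "\<bar>v i\<bar> \<le> 3 * (e * m)" if i: "i \<in> sites N" "i \<notin> excited" for i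
    proof -
      have "(10 / 9) * e * (\<bar>v (nx N i)\<bar> + \<bar>v (pv N i)\<bar>) \<le> (10 / 9) * e * (m + m)"
        using m e by (intro mult_left_mono add_mono) auto
      with quiet_bound[OF i] have "\<bar>v i\<bar> \<le> (10 / 9) * e * (m + m)" by linarith
      also have "\<dots> = 20 / 9 * (e * m)" by simp
      finally show ?thesis using em by linarith
    qed
    have "(9 / 10) * e * \<bar>v (-2)\<bar> \<le> \<bar>K (-2)\<bar> * \<bar>v (-2)\<bar>" using K2 by (intro mult_right_mono) auto
    also have "\<dots> = e * \<bar>v (-3)\<bar>"
      using row[OF in_sites, of "-2"] e nx[of "-2"] pv[of "-2"] v1 by (simp flip: abs_mult) (simp add: abs_mult)
    finally have a2: "\<bar>v (-2)\<bar> \<le> (10 / 9) * \<bar>v (-3)\<bar>" using e by (simp add: mult.assoc mult.left_commute[of _ e])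
    have "\<bar>v (-3)\<bar> \<le> (10 / 9) * e * (\<bar>v (-2)\<bar> + \<bar>v (-4)\<bar>)"
      using quiet_bound[OF in_sites exc(4)] nx[of "-3"] pv[of "-3"] by simp
    also have "\<dots> \<le> (10 / 9) * e * ((10 / 9) * \<bar>v (-3)\<bar> + 3 * (e * m))"
      using a2 off[OF in_sites exc(5)] e by (intro mult_left_mono add_mono) auto
    also have "\<dots> = (100 / 81) * (e * \<bar>v (-3)\<bar>) + (10 / 3) * (e * (e * m))" by (simp add: algebra_simps)
    also have "e * \<bar>v (-3)\<bar> \<le> (1 / 10000) * \<bar>v (-3)\<bar>" using e d by (intro mult_right_mono) auto
    finally have a3: "\<bar>v (-3)\<bar> \<le> 4 * (e * (e * m))" using eem by linarith
    have a0: "\<bar>v 0\<bar> = \<bar>v (-2)\<bar>"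
      using row[OF in_sites, of "-1"] e nx[of "-1"] pv[of "-1"] v1 by simp
    have "e * \<bar>v 1\<bar> = \<bar>K 0\<bar> * \<bar>v 0\<bar>"
      using row[OF in_sites, of 0] e nx[of 0] pv[of 0] v1 by (simp flip: abs_mult) (simp add: abs_mult)
    also have "\<dots> \<le> 1 * \<bar>v 0\<bar>" using quiet[OF in_sites exc(6)] by (intro mult_right_mono) auto
    also have "\<dots> \<le> e * (5 * (e * m))" using a0 a2 a3 eem by linarith
    finally have a1: "\<bar>v 1\<bar> \<le> 5 * (e * m)" using e by simp
    show ?thesis
    proof
      fix i assume i: "i \<in> sites N"
      consider "i \<notin> excited" | "i = -2" | "i = -1" | "i = 1" by (auto simp: excited_def)
      then show "\<bar>v i\<bar> \<le> m / 2"
      proof cases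
        case 1
        then show ?thesis using off[OF i] em m0 by linarith
      next
        case 2
        then have "\<bar>v i\<bar> = \<bar>v (-2)\<bar>" by simp
        then show ?thesis using a2 a3 eem em m0 by linarith
      next
        case 3
        then show ?thesis using v1 m0 by simp
      next
        case 4
        then have "\<bar>v i\<bar> = \<bar>v 1\<bar>" by simp
        then show ?thesis using a1 em m0 by linarith
      qed
    qed
  qed
  have base: "\<bar>v i\<bar> \<le> 2" if "i \<in> sites N" for i
  proof -
    have "\<bar>\<sigma> i\<bar> \<le> 1" using \<sigma> by (cases "i \<in> excited") (auto simp: sign_pattern_def)
    then have "cmod (f i) \<le> 2"
      using near[OF that] norm_triangle_ineq2[of "f i" "complex_of_real (\<sigma> i)"] d by simp
    then show ?thesis using abs_Im_le_cmod[of "f i"] by (simp add: v_def)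
  qed
  have "\<forall>j\<in>sites N. \<bar>v j\<bar> \<le> 2 / 2 ^ n" for n
  proof (induction n)
    case (Suc n)
    then show ?case using step[OF Suc] by (simp add: field_simps)
  qed (use base in simp)
  then have "\<bar>v j\<bar> \<le> 2 / 2 ^ n" for n using j by blast
  moreover have "(\<lambda>n. 2 / 2 ^ n :: real) \<longlonglongrightarrow> 0" by (rule LIMSEQ_divide_realpow_zero) simp
  ultimately have "\<bar>v j\<bar> \<le> 0" using LIMSEQ_le_const by blast
  then show ?thesis by (simp add: v_def)
qed

text \<open>Dividing by the phase of the amplitude at -1 makes that amplitude real and moves the wave by at most three times its distance to the
  unperturbed state.\<close>

lemma standing_wave_real_form:
  assumes N: "6 \<le> N" and A: "A > 0" and e: "0 < \<epsilon>" "\<epsilon> / A \<le> d" and d: "d \<le> 1 / 10000"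
    and w: "standing_wave N A \<epsilon> \<phi>" and \<sigma>: "sign_pattern \<sigma>" and z: "cmod z = 1"
    and near: "\<And>j. j \<in> sites N \<Longrightarrow> cmod (\<phi> j - complex_of_real (sqrt A * \<sigma> j) * z) \<le> sqrt A * (d / 3)"
  shows "\<exists>c u. cmod c = 1 \<and> real_wave N (\<epsilon> / A) u \<and> (\<forall>j\<in>sites N. \<bar>u j - \<sigma> j\<bar> \<le> d) \<and>
     (\<forall>j\<in>sites N. \<phi> j = complex_of_real (sqrt A * u j) * c)"
proof -
  have sA: "sqrt A > 0" "sqrt A * sqrt A = A" "complex_of_real (sqrt A) * complex_of_real (sqrt A) = A"
    using A by (simp_all flip: of_real_mult)
  have d0: "0 \<le> d" using e A by (meson divide_nonneg_pos less_imp_le order_trans)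
  have m1: "-1 \<in> sites N" using N by (simp add: sites_def)
  define g where "g j = \<phi> j / sqrt A" for j
  have g: "cmod (g j - complex_of_real (\<sigma> j) * z) \<le> d / 3" if "j \<in> sites N" for j
  proof -
    have "g j - complex_of_real (\<sigma> j) * z = (\<phi> j - complex_of_real (sqrt A * \<sigma> j) * z) / sqrt A"
      using sA(1) by (simp add: g_def field_simps)
    then have "cmod (g j - complex_of_real (\<sigma> j) * z) = cmod (\<phi> j - complex_of_real (sqrt A * \<sigma> j) * z) / sqrt A"
      using sA(1) by (simp add: norm_divide)
    also have "\<dots> \<le> sqrt A * (d / 3) / sqrt A" using near[OF that] sA(1) by (intro divide_right_mono) auto
    finally show ?thesis using sA(1) by simp
  qed
  have gz: "cmod (g (-1) - z) \<le> d / 3" using g[OF m1] \<sigma> by (simp add: sign_pattern_def)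
  have g1: "\<bar>cmod (g (-1)) - 1\<bar> \<le> d / 3"
    using norm_triangle_ineq3[of "g (-1)" z] gz z by simp
  then have gpos: "cmod (g (-1)) > 0" using d by linarith
  define c where "c = g (-1) / cmod (g (-1))"
  have c: "cmod c = 1" using gpos by (simp add: c_def norm_divide)
  have cc: "cnj c * c = 1" using complex_norm_square[of c] c by (simp add: mult.commute)
  define f where "f j = cnj c * g j" for j
  have f1: "f (-1) = cmod (g (-1))"
  proof -
    have "g (-1) = cmod (g (-1)) * c" using gpos by (simp add: c_def)
    then have "f (-1) = cmod (g (-1)) * (cnj c * c)" unfolding f_def by (metis mult.left_commute)
    then show ?thesis using cc by simp
  qed
  have cz: "cmod (cnj c * z - 1) \<le> 2 * d / 3"
  proof -
    have "cnj c * z - 1 = (f (-1) - 1) - cnj c * (g (-1) - z)" by (simp add: f_def algebra_simps)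
    then have "cmod (cnj c * z - 1) \<le> cmod (f (-1) - 1) + cmod (cnj c * (g (-1) - z))"
      by (metis norm_triangle_ineq4)
    also have "cmod (f (-1) - 1) = \<bar>cmod (g (-1)) - 1\<bar>"
      unfolding f1 by (metis norm_of_real of_real_1 of_real_diff)
    finally show ?thesis using g1 gz c by (simp add: norm_mult)
  qed
  have nearf: "cmod (f j - complex_of_real (\<sigma> j)) \<le> d" if j: "j \<in> sites N" for j
  proof -
    have s: "\<bar>\<sigma> j\<bar> \<le> 1" using \<sigma> by (cases "j \<in> excited") (auto simp: sign_pattern_def)
    have "f j - complex_of_real (\<sigma> j) = cnj c * (g j - complex_of_real (\<sigma> j) * z) + complex_of_real (\<sigma> j) * (cnj c * z - 1)"
      by (simp add: f_def algebra_simps)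
    then have "cmod (f j - complex_of_real (\<sigma> j)) \<le> cmod (cnj c * (g j - complex_of_real (\<sigma> j) * z)) + cmod (complex_of_real (\<sigma> j) * (cnj c * z - 1))"
      by (metis norm_triangle_ineq)
    also have "\<dots> \<le> d / 3 + 1 * (2 * d / 3)"
      unfolding norm_mult complex_mod_cnj norm_of_real c using g[OF j] s cz by (intro add_mono mult_mono) auto
    finally show ?thesis by simp
  qed
  have \<phi>f: "\<phi> j = complex_of_real (sqrt A) * c * f j" for j
    using cc sA(1) by (simp add: f_def g_def mult.assoc[symmetric] mult.commute[of c])
  have wf: "standing_wave N 1 (\<epsilon> / A) f"
    unfolding standing_wave_def
  proof
    fix j assume j: "j \<in> sites N"
    have m: "(cmod (\<phi> j))\<^sup>2 = A * (cmod (f j))\<^sup>2" using A c by (simp add: \<phi>f norm_mult power_mult_distrib)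
    have l: "lap N \<phi> j = complex_of_real (sqrt A) * c * lap N f j" by (simp add: \<phi>f lap_def algebra_simps)
    have "complex_of_real ((cmod (\<phi> j))\<^sup>2 - A) * \<phi> j + complex_of_real \<epsilon> * lap N \<phi> j = 0"
      using w j by (simp add: standing_wave_def)
    then have "(complex_of_real (sqrt A) * c * complex_of_real A) *
       (complex_of_real ((cmod (f j))\<^sup>2 - 1) * f j + complex_of_real (\<epsilon> / A) * lap N f j) = 0"
      unfolding m l using A by (simp add: \<phi>f[of j] algebra_simps)
    moreover have "complex_of_real (sqrt A) * c * complex_of_real A \<noteq> 0" using A c by auto
    ultimately show "complex_of_real ((cmod (f j))\<^sup>2 - 1) * f j + complex_of_real (\<epsilon> / A) * lap N f j = 0"
      by simp
  qed
  define u where "u j = Re (f j)" for j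
  have fu: "f j = complex_of_real (u j)" if "j \<in> sites N" for j
    using wave_imaginary_part_vanishes[OF N _ e(2) d wf \<sigma> nearf _ that] e(1) A f1
    by (simp add: u_def complex_eq_iff)
  have "real_wave N (\<epsilon> / A) u"
    unfolding real_wave_def
  proof
    fix j assume j: "j \<in> sites N"
    have "complex_of_real (((u j)\<^sup>2 - 1) * u j + \<epsilon> / A * lap N u j) = 0"
      using wf j by (simp add: standing_wave_def fu lap_def)
    then show "((u j)\<^sup>2 - 1) * u j + \<epsilon> / A * lap N u j = 0" by (simp only: of_real_eq_0_iff)
  qed
  moreover have "\<bar>u j - \<sigma> j\<bar> \<le> d" if "j \<in> sites N" for j
    using nearf[OF that] fu[OF that] by (simp flip: of_real_diff)
  moreover have "\<phi> j = complex_of_real (sqrt A * u j) * c" if "j \<in> sites N" for j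
    by (simp add: \<phi>f[of j] fu[OF that])
  ultimately show ?thesis using c by blast
qed

section \<open>The linearized operators and the energy forms\<close>

definition ip :: "nat \<Rightarrow> (int \<Rightarrow> real) \<Rightarrow> (int \<Rightarrow> real) \<Rightarrow> real" where
  "ip N f g = (\<Sum>j\<in>sites N. f j * g j)"

text \<open>At a standing wave \<open>u\<close> the operators \<open>Lminus\<close> and \<open>Lplus\<close> act on perturbations of the phase and of the amplitude. At \<open>e = 0\<close> they are diagonal,
  with entries 0 and 2 at the excited sites and \<open>- 1\<close> at all others.\<close>

definition Lminus :: "nat \<Rightarrow> real \<Rightarrow> (int \<Rightarrow> real) \<Rightarrow> (int \<Rightarrow> real) \<Rightarrow> int \<Rightarrow> real" where
  "Lminus N e u f j = ((u j)\<^sup>2 - 1) * f j + e * lap N f j"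

definition Lplus :: "nat \<Rightarrow> real \<Rightarrow> (int \<Rightarrow> real) \<Rightarrow> (int \<Rightarrow> real) \<Rightarrow> int \<Rightarrow> real" where
  "Lplus N e u f j = (3 * (u j)\<^sup>2 - 1) * f j + e * lap N f j"

lemma ip_commute: "ip N f g = ip N g f"
  by (simp add: ip_def mult.commute)

lemma ip_add: "ip N (\<lambda>j. f j + g j) h = ip N f h + ip N g h" "ip N h (\<lambda>j. f j + g j) = ip N h f + ip N h g"
  and ip_scale: "ip N (\<lambda>j. c * f j) h = c * ip N f h" "ip N h (\<lambda>j. c * f j) = c * ip N h f"
  by (simp_all add: ip_def algebra_simps sum.distrib sum_distrib_left)

lemma ip_cong:
  "(\<And>j. j \<in> sites N \<Longrightarrow> f j = f' j) \<Longrightarrow> (\<And>j. j \<in> sites N \<Longrightarrow> g j = g' j) \<Longrightarrow> ip N f g = ip N f' g'"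
  by (simp add: ip_def cong: sum.cong)

lemma ip_self_nonneg: "0 \<le> ip N f f"
  by (simp add: ip_def sum_nonneg)

lemma ip_self_zero: "ip N f f = 0 \<Longrightarrow> j \<in> sites N \<Longrightarrow> f j = 0"
  by (simp add: ip_def sum_nonneg_eq_0_iff)

lemma ip_lap_eq: "ip N f (lap N g) = (\<Sum>j\<in>sites N. (f (nx N j) - f j) * (g (nx N j) - g j))"
  by (simp add: ip_def sum_lap)

lemma ip_lap_commute: "ip N f (lap N g) = ip N (lap N f) g"
  by (subst (2) ip_commute) (simp add: ip_lap_eq mult.commute)

lemma ip_lap_nonneg: "0 \<le> ip N f (lap N f)"
  by (simp add: ip_lap_eq sum_nonneg)

lemma ip_lap_le: "ip N f (lap N f) \<le> 4 * ip N f f"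
proof -
  have "ip N f (lap N f) \<le> (\<Sum>j\<in>sites N. 2 * (f (nx N j) * f (nx N j)) + 2 * (f j * f j))"
    unfolding ip_lap_eq
  proof (rule sum_mono)
    fix j
    have "0 \<le> (f (nx N j) + f j)\<^sup>2" by simp
    then show "(f (nx N j) - f j) * (f (nx N j) - f j) \<le> 2 * (f (nx N j) * f (nx N j)) + 2 * (f j * f j)"
      by (simp add: power2_eq_square algebra_simps)
  qed
  also have "\<dots> = 4 * ip N f f"
    unfolding sum.distrib sum_distrib_left[symmetric] ip_def
    using sum_nx[of "\<lambda>j. f j * f j" N] by simp
  finally show ?thesis .
qed

lemma ip_lap_lap_le: "ip N (lap N f) (lap N f) \<le> 18 * ip N f f"
proof -
  have "ip N (lap N f) (lap N f) \<le> (\<Sum>j\<in>sites N. 12 * (f j * f j) + 3 * (f (nx N j) * f (nx N j)) + 3 * (f (pv N j) * f (pv N j)))"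
    unfolding ip_def
  proof (rule sum_mono)
    fix j
    have "(2 * a - b - c) * (2 * a - b - c) \<le> 12 * (a * a) + 3 * (b * b) + 3 * (c * c)" for a b c :: real
    proof -
      have "0 \<le> (2 * a + b)\<^sup>2 + (2 * a + c)\<^sup>2 + (b - c)\<^sup>2" by simp
      then show ?thesis by (simp add: power2_eq_square algebra_simps)
    qed
    then show "lap N f j * lap N f j \<le> 12 * (f j * f j) + 3 * (f (nx N j) * f (nx N j)) + 3 * (f (pv N j) * f (pv N j))"
      unfolding lap_def .
  qed
  also have "\<dots> = 18 * ip N f f"
    unfolding sum.distrib sum_distrib_left[symmetric] ip_def
    using sum_nx[of "\<lambda>j. f j * f j" N] sum_pv[of "\<lambda>j. f j * f j" N] by simp
  finally show ?thesis .
qed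

lemma Lminus_eq: "Lminus N e u f = (\<lambda>j. ((u j)\<^sup>2 - 1) * f j + e * lap N f j)"
  and Lplus_eq: "Lplus N e u f = (\<lambda>j. (3 * (u j)\<^sup>2 - 1) * f j + e * lap N f j)"
  by (simp_all add: fun_eq_iff Lminus_def Lplus_def)

lemma ip_diag_commute: "ip N f (\<lambda>j. c j * g j) = ip N (\<lambda>j. c j * f j) (g :: int \<Rightarrow> real)"
  by (simp add: ip_def mult_ac)

lemma Lminus_self_adjoint: "ip N f (Lminus N e u g) = ip N (Lminus N e u f) g"
  unfolding Lminus_eq ip_add ip_scale
  using ip_lap_commute ip_diag_commute[of N f "\<lambda>j. (u j)\<^sup>2 - 1" g] by simp

lemma Lplus_self_adjoint: "ip N f (Lplus N e u g) = ip N (Lplus N e u f) g"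
  unfolding Lplus_eq ip_add ip_scale
  using ip_lap_commute ip_diag_commute[of N f "\<lambda>j. 3 * (u j)\<^sup>2 - 1" g] by simp

lemma ip_Lminus: "ip N f (Lminus N e u f) = (\<Sum>j\<in>sites N. ((u j)\<^sup>2 - 1) * (f j)\<^sup>2) + e * ip N f (lap N f)"
  unfolding Lminus_eq ip_add ip_scale by (simp add: ip_def power2_eq_square mult_ac)

lemma ip_Lplus: "ip N f (Lplus N e u f) = (\<Sum>j\<in>sites N. (3 * (u j)\<^sup>2 - 1) * (f j)\<^sup>2) + e * ip N f (lap N f)"
  unfolding Lplus_eq ip_add ip_scale by (simp add: ip_def power2_eq_square mult_ac)

lemma Lminus_add: "Lminus N e u (\<lambda>j. f j + c * g j) = (\<lambda>j. Lminus N e u f j + c * Lminus N e u g j)"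
  and Lplus_add: "Lplus N e u (\<lambda>j. f j + c * g j) = (\<lambda>j. Lplus N e u f j + c * Lplus N e u g j)"
  by (simp_all add: fun_eq_iff Lminus_def Lplus_def lap_def algebra_simps)

lemma lap_cong: "(\<And>j. j \<in> sites N \<Longrightarrow> f j = g j) \<Longrightarrow> j \<in> sites N \<Longrightarrow> lap N f j = lap N g j"
  by (simp add: lap_def)

lemma Lminus_cong: "(\<And>j. j \<in> sites N \<Longrightarrow> f j = g j) \<Longrightarrow> j \<in> sites N \<Longrightarrow> Lminus N e u f j = Lminus N e u g j"
  and Lplus_cong: "(\<And>j. j \<in> sites N \<Longrightarrow> f j = g j) \<Longrightarrow> j \<in> sites N \<Longrightarrow> Lplus N e u f j = Lplus N e u g j"
  using lap_cong[of N f g j] by (simp_all add: Lminus_def Lplus_def)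

text \<open>With \<open>w = Lplus a\<close> the form \<open>kin\<close> is the pairing of \<open>w\<close> with \<open>3/4 * inverse Lplus - Lminus\<close>. At \<open>e = 0\<close> this operator is
  \<open>3/8\<close> at the excited sites and \<open>1/4\<close> elsewhere. Any weight between 0 and 1 in place of \<open>3/4\<close> gives a positive form;
  the negativity of \<open>pot\<close> for excited sites in phase at distance two needs a weight above \<open>2/3\<close>.\<close>

definition kin :: "nat \<Rightarrow> real \<Rightarrow> (int \<Rightarrow> real) \<Rightarrow> (int \<Rightarrow> real) \<Rightarrow> (int \<Rightarrow> real) \<Rightarrow> real" where
  "kin N e u a c = 3/4 * ip N a (Lplus N e u c) - ip N (Lplus N e u a) (Lminus N e u (Lplus N e u c))"

definition pot :: "nat \<Rightarrow> real \<Rightarrow> (int \<Rightarrow> real) \<Rightarrow> (int \<Rightarrow> real) \<Rightarrow> (int \<Rightarrow> real) \<Rightarrow> real" where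
  "pot N e u b c = 3/4 * ip N b (Lminus N e u c) - ip N (Lminus N e u b) (Lplus N e u (Lminus N e u c))"

lemma kin_commute: "kin N e u a c = kin N e u c a"
  unfolding kin_def by (metis Lplus_self_adjoint Lminus_self_adjoint ip_commute)

lemma pot_commute: "pot N e u a c = pot N e u c a"
  unfolding pot_def by (metis Lplus_self_adjoint Lminus_self_adjoint ip_commute)

text \<open>The identity behind both the conservation of energy and the symmetry of \<open>Lminus Lplus\<close> with respect to \<open>kin\<close>.\<close>

lemma kin_Lminus: "kin N e u (Lminus N e u b) a = pot N e u b (Lplus N e u a)"
  unfolding kin_def pot_def by (simp add: Lplus_self_adjoint Lminus_self_adjoint)

lemma kin_add: "kin N e u (\<lambda>j. f j + c * g j) h = kin N e u f h + c * kin N e u g h"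
  and pot_add: "pot N e u (\<lambda>j. f j + c * g j) h = pot N e u f h + c * pot N e u g h"
  unfolding kin_def pot_def Lminus_add Lplus_add ip_add ip_scale by (simp_all add: algebra_simps)

lemma kin_cong: "(\<And>j. j \<in> sites N \<Longrightarrow> f j = f' j) \<Longrightarrow> (\<And>j. j \<in> sites N \<Longrightarrow> g j = g' j) \<Longrightarrow> kin N e u f g = kin N e u f' g'"
  unfolding kin_def by (intro arg_cong2[where f = "(-)"] arg_cong[where f = "(*) (3/4)"] ip_cong Lplus_cong Lminus_cong)

lemma pot_cong: "(\<And>j. j \<in> sites N \<Longrightarrow> f j = f' j) \<Longrightarrow> (\<And>j. j \<in> sites N \<Longrightarrow> g j = g' j) \<Longrightarrow> pot N e u f g = pot N e u f' g'"
  unfolding pot_def by (intro arg_cong2[where f = "(-)"] arg_cong[where f = "(*) (3/4)"] ip_cong Lplus_cong Lminus_cong)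

lemma square_perturbation: "(x - g)\<^sup>2 \<ge> 99 / 100 * x\<^sup>2 - 99 * (g :: real)\<^sup>2"
proof -
  have "0 \<le> (x / 10 - 10 * g)\<^sup>2" by simp
  then show ?thesis by (simp add: power2_eq_square algebra_simps)
qed

text \<open>The distance \<open>1/10000\<close> is a convenient smallness for all numerical estimates below.\<close>

locale wave =
  fixes N :: nat and e :: real and u \<sigma> :: "int \<Rightarrow> real"
  assumes N6: "6 \<le> N" and e: "0 < e" "e \<le> 1 / 10000" and sp: "sign_pattern \<sigma>"
    and near: "\<And>j. j \<in> sites N \<Longrightarrow> \<bar>u j - \<sigma> j\<bar> \<le> 1 / 10000" and rw: "real_wave N e u"
begin

abbreviation "Lm \<equiv> Lminus N e u"
abbreviation "Lp \<equiv> Lplus N e u"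

lemma off_square:
  assumes "j \<in> sites N" "j \<notin> excited" shows "0 \<le> (u j)\<^sup>2" "(u j)\<^sup>2 \<le> 1 / 100000000"
proof -
  have "\<bar>u j\<bar> \<le> 1 / 10000" using near[OF assms(1)] sp assms(2) by (simp add: sign_pattern_def)
  then have "\<bar>u j\<bar>\<^sup>2 \<le> (1 / 10000)\<^sup>2" by (intro power_mono) auto
  then show "(u j)\<^sup>2 \<le> 1 / 100000000" by (simp add: power2_eq_square)
qed simp

lemma on_square:
  assumes "j \<in> sites N" "j \<in> excited" shows "(u j)\<^sup>2 \<ge> 9997 / 10000" "(u j)\<^sup>2 \<le> 10003 / 10000"
proof -
  have "\<bar>\<sigma> j\<bar> = 1" using sp assms(2) by (simp add: sign_pattern_def)
  then have b: "9999 / 10000 \<le> \<bar>u j\<bar>" "\<bar>u j\<bar> \<le> 10001 / 10000" using near[OF assms(1)] by linarith+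
  have "(9999 / 10000)\<^sup>2 \<le> \<bar>u j\<bar>\<^sup>2" using b by (intro power_mono) auto
  then show "(u j)\<^sup>2 \<ge> 9997 / 10000" by (simp add: power2_eq_square)
  have "\<bar>u j\<bar>\<^sup>2 \<le> (10001 / 10000)\<^sup>2" using b by (intro power_mono) auto
  then show "(u j)\<^sup>2 \<le> 10003 / 10000" by (simp add: power2_eq_square)
qed

lemma e_square: "0 < e\<^sup>2" "e\<^sup>2 \<le> e / 10000" "e\<^sup>2 \<le> 1 / 100000000"
proof -
  show "0 < e\<^sup>2" using e by simp
  show 1: "e\<^sup>2 \<le> e / 10000" using e mult_left_mono[of e "1/10000" e] by (simp add: power2_eq_square)
  then show "e\<^sup>2 \<le> 1 / 100000000" using e by linarith
qed

lemma kin_positive: "kin N e u a a \<ge> 1 / 10 * ip N a a"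
proof -
  define w where "w = Lp a"
  have "ip N w (Lm w) \<le> (\<Sum>j\<in>sites N. ((u j)\<^sup>2 - 1) * (w j)\<^sup>2) + e * (4 * ip N w w)"
    unfolding ip_Lminus using e ip_lap_le by simp
  also have "\<dots> = (\<Sum>j\<in>sites N. ((u j)\<^sup>2 - 1 + 4 * e) * (w j)\<^sup>2)"
    by (simp add: ip_def sum_distrib_left sum.distrib[symmetric]) (simp add: algebra_simps power2_eq_square)
  finally have 1: "ip N w (Lm w) \<le> (\<Sum>j\<in>sites N. ((u j)\<^sup>2 - 1 + 4 * e) * (w j)\<^sup>2)" .
  have 2: "ip N a (Lp a) \<ge> (\<Sum>j\<in>sites N. (3 * (u j)\<^sup>2 - 1) * (a j)\<^sup>2)"
    unfolding ip_Lplus using e ip_lap_nonneg[of N a] by simp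
  have pointwise: "(1 - (u j)\<^sup>2 - 4 * e) * (w j)\<^sup>2 + 3/4 * ((3 * (u j)\<^sup>2 - 1) * (a j)\<^sup>2)
      \<ge> 1/5 * (a j)\<^sup>2 - 1/1000000 * (lap N a j)\<^sup>2" if j: "j \<in> sites N" for j
  proof -
    define g where "g = e * lap N a j"
    have w: "w j = (3 * (u j)\<^sup>2 - 1) * a j + g" by (simp add: w_def Lplus_def g_def)
    have g: "0 \<le> g\<^sup>2" "g\<^sup>2 \<le> 1 / 100000000 * (lap N a j)\<^sup>2"
      unfolding g_def power_mult_distrib using e_square by (simp, intro mult_right_mono) auto
    show ?thesis
    proof (cases "j \<in> excited")
      case False
      note U = off_square[OF j False]
      define h where "h = 1 - 3 * (u j)\<^sup>2"
      have h: "99/100 \<le> h" using U by (simp add: h_def)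
      then have h2: "98/100 \<le> h\<^sup>2" using power_mono[OF h, of 2] by (simp add: power2_eq_square)
      have k: "99/100 \<le> 1 - (u j)\<^sup>2 - 4 * e" using U e by linarith
      have "w j = - (h * a j - g)" by (simp add: w h_def algebra_simps)
      then have "(w j)\<^sup>2 = (h * a j - g)\<^sup>2" by (simp only: power2_minus)
      also have "\<dots> \<ge> 99/100 * (h * a j)\<^sup>2 - 99 * g\<^sup>2" by (rule square_perturbation)
      finally have "(w j)\<^sup>2 \<ge> 99/100 * (h\<^sup>2 * (a j)\<^sup>2) - 99 * g\<^sup>2" by (simp add: power_mult_distrib)
      moreover have "h\<^sup>2 * (a j)\<^sup>2 \<ge> 98/100 * (a j)\<^sup>2" using h2 by (intro mult_right_mono) auto
      ultimately have w2: "(w j)\<^sup>2 \<ge> 97/100 * (a j)\<^sup>2 - 99 * g\<^sup>2" using zero_le_power2[of "a j"] by linarith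
      have "(1 - (u j)\<^sup>2 - 4 * e) * (w j)\<^sup>2 \<ge> 99/100 * (w j)\<^sup>2" using k by (intro mult_right_mono) auto
      moreover have "(3 * (u j)\<^sup>2 - 1) * (a j)\<^sup>2 \<ge> (- 1) * (a j)\<^sup>2" by (intro mult_right_mono) auto
      ultimately show ?thesis using w2 g zero_le_power2[of "a j"] by linarith
    next
      case True
      note U = on_square[OF j True]
      have "(w j)\<^sup>2 \<le> 2 * ((3 * (u j)\<^sup>2 - 1) * a j)\<^sup>2 + 2 * g\<^sup>2"
      proof -
        have "0 \<le> ((3 * (u j)\<^sup>2 - 1) * a j - g)\<^sup>2" by simp
        then show ?thesis unfolding w by (simp add: power2_sum power2_diff)
      qed
      moreover have "((3 * (u j)\<^sup>2 - 1) * a j)\<^sup>2 \<le> 5 * (a j)\<^sup>2"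
      proof -
        have "(3 * (u j)\<^sup>2 - 1)\<^sup>2 \<le> (22/10)\<^sup>2" using U by (intro power_mono) auto
        then show ?thesis unfolding power_mult_distrib by (intro mult_right_mono) (auto simp: power2_eq_square)
      qed
      ultimately have w2: "(w j)\<^sup>2 \<le> 10 * (a j)\<^sup>2 + 2 * g\<^sup>2" by linarith
      have "(1 - (u j)\<^sup>2 - 4 * e) * (w j)\<^sup>2 \<ge> (- 1/1000) * (w j)\<^sup>2" using U e by (intro mult_right_mono) auto
      moreover have "(3 * (u j)\<^sup>2 - 1) * (a j)\<^sup>2 \<ge> 1 * (a j)\<^sup>2" using U by (intro mult_right_mono) auto
      ultimately show ?thesis using w2 g zero_le_power2[of "a j"] by linarith
    qed
  qed
  have "1/5 * ip N a a - 1/1000000 * (18 * ip N a a) \<le> 1/5 * ip N a a - 1/1000000 * ip N (lap N a) (lap N a)"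
    using ip_lap_lap_le[of N a] by linarith
  also have "\<dots> = (\<Sum>j\<in>sites N. 1/5 * (a j)\<^sup>2 - 1/1000000 * (lap N a j)\<^sup>2)"
    by (simp add: ip_def sum_subtractf sum_distrib_left power2_eq_square)
  also have "\<dots> \<le> (\<Sum>j\<in>sites N. (1 - (u j)\<^sup>2 - 4 * e) * (w j)\<^sup>2 + 3/4 * ((3 * (u j)\<^sup>2 - 1) * (a j)\<^sup>2))"
    by (rule sum_mono) (rule pointwise)
  also have "\<dots> = 3/4 * (\<Sum>j\<in>sites N. (3 * (u j)\<^sup>2 - 1) * (a j)\<^sup>2) - (\<Sum>j\<in>sites N. ((u j)\<^sup>2 - 1 + 4 * e) * (w j)\<^sup>2)"
    unfolding sum.distrib sum_distrib_left[symmetric] by (simp add: algebra_simps sum.distrib sum_subtractf sum_negf)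
  also have "\<dots> \<le> kin N e u a a" unfolding kin_def w_def[symmetric] using 1 2[folded w_def] by linarith
  finally show ?thesis using ip_self_nonneg[of N a] by linarith
qed

lemma row: "j \<in> sites N \<Longrightarrow> ((u j)\<^sup>2 - 1 + 2 * e) * u j = e * (u (nx N j) + u (pv N j))"
  using rw by (simp add: real_wave_def lap_def algebra_simps)

lemma in_sites: "-5 \<le> i \<Longrightarrow> i \<le> 5 \<Longrightarrow> i \<in> sites N"
  using N6 by (simp add: sites_def)

lemma nx_near: "-5 \<le> i \<Longrightarrow> i \<le> 5 \<Longrightarrow> nx N i = i + 1" and pv_near: "-5 \<le> i \<Longrightarrow> i \<le> 5 \<Longrightarrow> pv N i = i - 1"
  using N6 by (simp_all add: nx_interior pv_interior)

lemma quiet_diag: "j \<in> sites N \<Longrightarrow> j \<notin> excited \<Longrightarrow> -1 \<le> (u j)\<^sup>2 - 1 + 2 * e \<and> (u j)\<^sup>2 - 1 + 2 * e \<le> - (9997 / 10000)"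
  using off_square[of j] e by auto

lemma u_bounds: "j \<in> sites N \<Longrightarrow> \<sigma> j - 1/10000 \<le> u j" "j \<in> sites N \<Longrightarrow> u j \<le> \<sigma> j + 1/10000"
  by (drule near, simp only: abs_diff_le_iff)+

lemma u_values:
  "\<sigma> (-2) - 1/10000 \<le> u (-2)" "u (-2) \<le> \<sigma> (-2) + 1/10000" "9999/10000 \<le> u (-1)" "u (-1) \<le> 10001/10000"
  "\<sigma> 1 - 1/10000 \<le> u 1" "u 1 \<le> \<sigma> 1 + 1/10000"
  "- (1/10000) \<le> u (-3)" "u (-3) \<le> 1/10000" "- (1/10000) \<le> u 3" "u 3 \<le> 1/10000"
  using u_bounds[OF in_sites, of "-2"] u_bounds[OF in_sites, of "-1"] u_bounds[OF in_sites, of 1]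
    u_bounds[OF in_sites, of "-3"] u_bounds[OF in_sites, of 3] sp
  by (auto simp: sign_pattern_def excited_def)

text \<open>A quiet site carries minus \<open>e\<close> times the sum of its neighbours, up to a small relative error.\<close>

lemma quiet_value:
  assumes j: "-5 \<le> j" "j \<le> 5" "j \<notin> excited"
  shows "\<bar>u j + e * (u (j + 1) + u (j - 1))\<bar> \<le> 4 / 10000 * (e * \<bar>u (j + 1) + u (j - 1)\<bar>)"
proof -
  define D where "D = (u j)\<^sup>2 - 1 + 2 * e"
  have D: "-1 \<le> D" "D \<le> - (9997 / 10000)" using quiet_diag[OF in_sites] j by (auto simp: D_def)
  define t where "t = e * (u (j + 1) + u (j - 1))"
  have r: "D * u j = t"
    using row[OF in_sites, of j] j nx_near[of j] pv_near[of j] by (simp add: D_def t_def)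
  have "u j = t / D" using r D by (simp add: field_simps)
  then have "u j + t = t * ((1 + D) / D)" using D by (simp add: field_simps)
  then have "\<bar>u j + t\<bar> = \<bar>t\<bar> * (\<bar>1 + D\<bar> / \<bar>D\<bar>)" by (simp add: abs_mult)
  also have "\<dots> \<le> \<bar>t\<bar> * ((3 / 10000) / (9997 / 10000))" using D by (intro mult_left_mono frac_le) auto
  also have "\<dots> \<le> \<bar>t\<bar> * (4 / 10000)" by (intro mult_left_mono) auto
  finally show ?thesis using e by (simp add: t_def abs_mult)
qed

lemma site_diag: "-5 \<le> j \<Longrightarrow> j \<le> 5 \<Longrightarrow> ((u j)\<^sup>2 - 1 + 2 * e) * u j = e * (u (j + 1) + u (j - 1))"
  using row[OF in_sites, of j] nx_near[of j] pv_near[of j] by simp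

end

section \<open>The sign of the potential form\<close>

lemma sum_split_excited:
  assumes "6 \<le> N"
  shows "(\<Sum>j\<in>sites N. f j) = f (-2) + f (-1) + f 1 + (\<Sum>j\<in>sites N - excited. f j :: real)"
proof -
  have sub: "excited \<subseteq> sites N" using assms by (auto simp: excited_def sites_def)
  have "(\<Sum>j\<in>sites N. f j) = (\<Sum>j\<in>sites N - excited. f j) + (\<Sum>j\<in>excited. f j)"
    by (rule sum.subset_diff[OF sub]) simp
  then show ?thesis by (simp add: excited_def)
qed

context wave begin

lemma pot_lower_bound:
  "pot N e u b b \<ge> 3/4 * ip N b (Lm b) - 3 * ((Lm b (-2))\<^sup>2 + (Lm b (-1))\<^sup>2 + (Lm b 1)\<^sup>2)
     + 999/1000 * (\<Sum>j\<in>sites N - excited. (Lm b j)\<^sup>2)"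
proof -
  define r where "r = Lm b"
  have "ip N r (Lp r) \<le> (\<Sum>j\<in>sites N. (3 * (u j)\<^sup>2 - 1) * (r j)\<^sup>2) + e * (4 * ip N r r)"
    unfolding ip_Lplus using e ip_lap_le by simp
  also have "\<dots> = (\<Sum>j\<in>sites N. (3 * (u j)\<^sup>2 - 1 + 4 * e) * (r j)\<^sup>2)"
    by (simp add: ip_def sum_distrib_left sum.distrib[symmetric]) (simp add: algebra_simps power2_eq_square)
  also have "\<dots> \<le> (\<Sum>j\<in>sites N. (if j \<in> excited then 3 else - (999/1000)) * (r j)\<^sup>2)"
  proof (intro sum_mono mult_right_mono)
    fix j assume j: "j \<in> sites N"
    show "3 * (u j)\<^sup>2 - 1 + 4 * e \<le> (if j \<in> excited then 3 else - (999/1000))"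
      using on_square[OF j] off_square[OF j] e by auto
  qed simp
  also have "\<dots> = 3 * ((r (-2))\<^sup>2 + (r (-1))\<^sup>2 + (r 1)\<^sup>2) - 999/1000 * (\<Sum>j\<in>sites N - excited. (r j)\<^sup>2)"
    by (subst sum_split_excited[OF N6]) (simp add: excited_def sum_distrib_left sum_negf)
  finally show ?thesis unfolding pot_def r_def[symmetric] by linarith
qed

text \<open>The wave itself spans the kernel of \<open>Lminus\<close> that comes from the phase invariance.\<close>

lemma pot_shift: "pot N e u (\<lambda>j. b j + c * u j) (\<lambda>j. b j + c * u j) = pot N e u b b"
proof -
  have Lu: "Lm u j = 0" if "j \<in> sites N" for j
    using rw that by (simp add: real_wave_def Lminus_def)
  have 0: "pot N e u u h = 0" for h
  proof -
    have "ip N u (Lm h) = ip N (Lm u) h" by (rule Lminus_self_adjoint)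
    also have "\<dots> = 0" using Lu by (simp add: ip_def)
    finally have 1: "ip N u (Lm h) = 0" .
    have "ip N (Lm u) (Lp (Lm h)) = 0" using Lu by (simp add: ip_def)
    then show ?thesis using 1 by (simp add: pot_def)
  qed
  have "pot N e u (\<lambda>j. b j + c * u j) h = pot N e u b h" for h by (simp add: pot_add 0)
  then show ?thesis by (metis pot_commute)
qed

text \<open>The image of an indicator under \<open>Lminus\<close> is \<open>- e\<close> at the two neighbours. If those are quiet, \<open>Lplus\<close> is about \<open>- 1\<close> there and contributes
  \<open>2 e^2\<close>, which is the largest possible contribution.\<close>

lemma pot_indicator_bound:
  assumes k: "k \<in> excited"
  shows "pot N e u (\<lambda>j. if j = k then 1 else 0) (\<lambda>j. if j = k then 1 else 0)
     \<le> 3/4 * ((u k)\<^sup>2 - 1 + 2 * e) + 2 * e\<^sup>2"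
proof -
  have k5: "-2 \<le> k" "k \<le> 1" and kN: "k \<in> sites N" "k - 1 \<in> sites N" "k + 1 \<in> sites N"
    using k in_sites by (auto simp: excited_def)
  define b where "b j = (if j = k then 1 else 0 :: real)" for j
  define r where "r = Lm b"
  have nxk: "nx N j = k \<longleftrightarrow> j = k - 1" if "j \<in> sites N" for j
    using that pv_nx[OF that] nx_near[of "k - 1"] pv_near[of k] k5 by auto
  have pvk: "pv N j = k \<longleftrightarrow> j = k + 1" if "j \<in> sites N" for j
    using that nx_pv[OF that] nx_near[of k] pv_near[of "k + 1"] k5 by auto
  have r: "r j = (if j = k then (u k)\<^sup>2 - 1 + 2 * e else if j = k - 1 \<or> j = k + 1 then - e else 0)" if "j \<in> sites N" for j
    using nxk[OF that] pvk[OF that] by (auto simp: r_def Lminus_def lap_def b_def)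
  have "ip N b r = (\<Sum>j\<in>sites N. if j = k then r j else 0)"
    unfolding ip_def by (rule sum.cong) (auto simp: b_def)
  also have "\<dots> = (u k)\<^sup>2 - 1 + 2 * e" using kN r by simp
  finally have 1: "ip N b r = (u k)\<^sup>2 - 1 + 2 * e" .
  have "(\<Sum>j\<in>sites N. if j \<in> {k - 1, k + 1} then - e\<^sup>2 else 0) \<le> (\<Sum>j\<in>sites N. (3 * (u j)\<^sup>2 - 1) * (r j)\<^sup>2)"
  proof (rule sum_mono)
    fix j assume j: "j \<in> sites N"
    show "(if j \<in> {k - 1, k + 1} then - e\<^sup>2 else 0) \<le> (3 * (u j)\<^sup>2 - 1) * (r j)\<^sup>2"
    proof (cases "j = k")
      case True
      have "0 \<le> (3 * (u j)\<^sup>2 - 1) * (r j)\<^sup>2"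
        using on_square[OF j] k True by (intro mult_nonneg_nonneg) auto
      then show ?thesis using True by simp
    next
      case False
      have "(- 1) * (r j)\<^sup>2 \<le> (3 * (u j)\<^sup>2 - 1) * (r j)\<^sup>2" by (intro mult_right_mono) auto
      then show ?thesis using False r[OF j] by (auto split: if_splits)
    qed
  qed
  also have "(\<Sum>j\<in>sites N. if j \<in> {k - 1, k + 1} then - e\<^sup>2 else 0) = (\<Sum>j\<in>{k - 1, k + 1}. - e\<^sup>2)"
    by (rule sum.mono_neutral_cong_right) (use kN in auto)
  also have "\<dots> = - (2 * e\<^sup>2)" by simp
  finally have "- (2 * e\<^sup>2) \<le> ip N r (Lp r)" unfolding ip_Lplus using e mult_nonneg_nonneg[OF less_imp_le[OF e(1)] ip_lap_nonneg[of N r]] by linarith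
  then show ?thesis unfolding pot_def b_def[symmetric, abs_def] r_def[symmetric] 1 by linarith
qed

text \<open>Opposite neighbours -2 and -1: the wave equation makes the diagonal entry of \<open>Lminus\<close> at -2 about \<open>- e\<close>.\<close>

lemma pot_indefinite_nearest:
  assumes "\<sigma> (-2) = -1" shows "\<exists>b. pot N e u b b < 0"
proof -
  define D where "D = (u (-2))\<^sup>2 - 1 + 2 * e"
  have r: "D * u (-2) = e * (u (-1) + u (-3))" using site_diag[of "-2"] by (simp add: D_def)
  have u2: "-(10001/10000) \<le> u (-2)" "u (-2) \<le> -(9999/10000)" using u_values(1,2) assms by linarith+
  have "u (-1) + u (-3) \<ge> 9998/10000" using u_values(3,4,7,8) by linarith
  then have "e * (9998/10000) \<le> D * u (-2)" unfolding r using e by simp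
  then have 1: "e * (9998/10000) \<le> (- D) * (- u (-2))" by simp
  then have "0 < (- D) * (- u (-2))" using e by linarith
  then have "0 < - D" using u2 by (simp add: zero_less_mult_iff)
  then have "(- D) * (- u (-2)) \<le> (- D) * (10001/10000)" using u2 by (intro mult_left_mono) auto
  with 1 have "D \<le> - (99/100) * e" using e by linarith
  then have "3/4 * D + 2 * e\<^sup>2 < 0" using e_square e by linarith
  moreover have "pot N e u (\<lambda>j. if j = -2 then 1 else 0) (\<lambda>j. if j = -2 then 1 else 0) \<le> 3/4 * D + 2 * e\<^sup>2"
    using pot_indicator_bound[of "-2"] by (simp add: excited_def D_def)
  ultimately show ?thesis by (intro exI) (rule le_less_trans)
qed

text \<open>Equal phases at -1 and 1: the site 0 carries \<open>- 2 e\<close> and the site 2 carries \<open>- e\<close>, so the diagonal entry of \<open>Lminus\<close> at 1 is about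
  \<open>- 3 e^2\<close>, and \<open>3/4 * 3 > 2\<close>.\<close>

lemma pot_indefinite_next_nearest:
  assumes "\<sigma> 1 = 1" shows "\<exists>b. pot N e u b b < 0"
proof -
  define D where "D = (u 1)\<^sup>2 - 1 + 2 * e"
  have r: "D * u 1 = e * (u 2 + u 0)" using site_diag[of 1] by (simp add: D_def)
  have u1: "9999/10000 \<le> u 1" "u 1 \<le> 10001/10000" using u_values(5,6) assms by linarith+
  have sums: "19998/10000 \<le> u 1 + u (-1)" "u 1 + u (-1) \<le> 20002/10000"
    "9998/10000 \<le> u 3 + u 1" "u 3 + u 1 \<le> 10002/10000" using u1 u_values(3,4,9,10) by linarith+
  have es: "e * (19998/10000) \<le> e * (u 1 + u (-1))" "e * (u 1 + u (-1)) \<le> e * (20002/10000)"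
    "e * (9998/10000) \<le> e * (u 3 + u 1)" "e * (u 3 + u 1) \<le> e * (10002/10000)"
    using sums e by (auto intro!: mult_left_mono)
  have q0: "\<bar>u 0 + e * (u 1 + u (-1))\<bar> \<le> 4/10000 * (e * (u 1 + u (-1)))"
    using quiet_value[of 0] sums by (simp add: excited_def)
  have q2: "\<bar>u 2 + e * (u 3 + u 1)\<bar> \<le> 4/10000 * (e * (u 3 + u 1))"
    using quiet_value[of 2] sums by (simp add: excited_def)
  have "u 2 + u 0 \<le> - (298/100) * e" using q0 q2 es e by linarith
  then have "e * (u 2 + u 0) \<le> e * (- (298/100) * e)" using e by (intro mult_left_mono) auto
  then have 1: "(298/100) * e\<^sup>2 \<le> (- D) * u 1" unfolding r[symmetric] by (simp add: power2_eq_square)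
  then have "0 < (- D) * u 1" using e_square(1) by linarith
  then have "0 < - D" by (rule zero_less_mult_pos2) (use u1 in linarith)
  then have "(- D) * u 1 \<le> (- D) * (10001/10000)" using u1 by (intro mult_left_mono) auto
  with 1 have "3/4 * D + 2 * e\<^sup>2 < 0" using e_square(1) by linarith
  moreover have "pot N e u (\<lambda>j. if j = 1 then 1 else 0) (\<lambda>j. if j = 1 then 1 else 0) \<le> 3/4 * D + 2 * e\<^sup>2"
    using pot_indicator_bound[of 1] by (simp add: excited_def D_def)
  ultimately show ?thesis by (intro exI) (rule le_less_trans)
qed

text \<open>After subtraction of a multiple of \<open>u\<close> the function \<open>z\<close> vanishes at -1. On the quiet sites complete the square with \<open>h = y + e \<tau>\<close>, where \<open>\<tau>\<close> is the
  sum of the excited neighbours. To leading order the pairing of \<open>z\<close> with \<open>Lminus z\<close> becomes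
  \<open>e p^2 + e^2 q^2\<close> minus the sum of the \<open>h^2\<close>: the coefficient of \<open>q^2\<close> is the diagonal entry \<open>- e^2\<close> plus \<open>2 e^2\<close> gained from the
  squares at the sites 0 and 2. The negative sum of squares, taken with weight \<open>3/4\<close>, is outweighed by the same
  sum that the second part of \<open>pot\<close> contributes with weight about one.\<close>

lemma pot_positive:
  assumes s2: "\<sigma> (-2) = 1" and s1: "\<sigma> 1 = -1" and z1: "z (-1) = 0"
  shows "0 \<le> pot N e u z z" "pot N e u z z = 0 \<Longrightarrow> j \<in> sites N \<Longrightarrow> z j = 0"
proof -
  let ?O = "sites N - excited"
  define p q where "p = z (-2)" and "q = z 1"
  define x y where "x j = (if j \<in> excited then z j else 0)" and "y j = (if j \<in> excited then 0 else z j)" for j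
  define \<tau> where "\<tau> j = x (nx N j) + x (pv N j)" for j
  define t where "t j = y (nx N j) + y (pv N j)" for j
  define h where "h j = y j + e * \<tau> j" for j
  define D where "D j = (u j)\<^sup>2 - 1 + 2 * e" for j
  define g where "g j = (D j + 1) * y j - e * t j" for j
  define r where "r = Lm z"
  define Y H where "Y = (\<Sum>j\<in>?O. (y j)\<^sup>2)" and "H = (\<Sum>j\<in>?O. (h j)\<^sup>2)"
  have two: "(a - b)\<^sup>2 \<le> 2 * a\<^sup>2 + 2 * b\<^sup>2" "(a + b)\<^sup>2 \<le> 2 * a\<^sup>2 + 2 * b\<^sup>2" for a b :: real
  proof -
    have "0 \<le> (a + b)\<^sup>2" "0 \<le> (a - b)\<^sup>2" by simp_all
    then show "(a - b)\<^sup>2 \<le> 2 * a\<^sup>2 + 2 * b\<^sup>2" "(a + b)\<^sup>2 \<le> 2 * a\<^sup>2 + 2 * b\<^sup>2"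
      by (simp_all add: power2_sum power2_diff)
  qed
  have z: "z j = x j + y j" for j by (simp add: x_def y_def)
  have r: "r j = D j * z j - e * (z (nx N j) + z (pv N j))" for j
    by (simp add: r_def D_def Lminus_def lap_def algebra_simps)
  have rO: "r j = - h j + g j" if "j \<in> ?O" for j
    using that unfolding r z by (simp add: h_def g_def \<tau>_def t_def x_def y_def algebra_simps)
  have Y0: "0 \<le> Y" "0 \<le> H" by (simp_all add: Y_def H_def sum_nonneg)
  have sum_x: "(\<Sum>j\<in>sites N. f j * x j) = f (-2) * p + f 1 * q" for f
    by (subst sum_split_excited[OF N6]) (simp add: x_def excited_def p_def q_def z1)
  have sum_x2: "(\<Sum>j\<in>sites N. (x j)\<^sup>2) = p\<^sup>2 + q\<^sup>2"
    by (subst sum_split_excited[OF N6]) (simp add: x_def excited_def p_def q_def z1)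
  have sum_y2: "(\<Sum>j\<in>sites N. (y j)\<^sup>2) = Y"
    by (subst sum_split_excited[OF N6]) (simp add: y_def Y_def excited_def)
  have y_le: "(z k)\<^sup>2 \<le> Y" if "k \<in> ?O" for k
  proof -
    have "(y k)\<^sup>2 \<le> Y" unfolding Y_def by (rule member_le_sum) (use that in auto)
    then show ?thesis using that by (simp add: y_def)
  qed
  \<comment> \<open>these terms occur at the excited and at the quiet sites, and are absorbed by the squares\<close>
  have cross: "(\<Sum>j\<in>?O. \<tau> j * y j) = p * (z (-3)) + q * (z 0 + z 2)"
  proof -
    have "(\<Sum>j\<in>?O. \<tau> j * y j) = (\<Sum>j\<in>sites N. \<tau> j * y j)"
      by (subst sum_split_excited[OF N6]) (simp add: y_def excited_def)
    also have "\<dots> = (\<Sum>j\<in>sites N. x (nx N j) * y j) + (\<Sum>j\<in>sites N. y j * x (pv N j))"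
      by (simp add: \<tau>_def algebra_simps sum.distrib)
    also have "(\<Sum>j\<in>sites N. x (nx N j) * y j) = (\<Sum>j\<in>sites N. x j * y (pv N j))" by (rule sum_pv_nx)
    also have "(\<Sum>j\<in>sites N. y j * x (pv N j)) = (\<Sum>j\<in>sites N. y (nx N j) * x j)" by (rule sum_pv_nx[symmetric])
    also have "(\<Sum>j\<in>sites N. x j * y (pv N j)) + (\<Sum>j\<in>sites N. y (nx N j) * x j) = (\<Sum>j\<in>sites N. t j * x j)"
      by (simp add: t_def algebra_simps sum.distrib)
    also have "\<dots> = t (-2) * p + t 1 * q" by (rule sum_x)
    finally show ?thesis
      by (simp add: t_def y_def nx_near pv_near excited_def algebra_simps)
  qed
  have \<tau>2_lower: "p\<^sup>2 + 2 * q\<^sup>2 \<le> (\<Sum>j\<in>?O. (\<tau> j)\<^sup>2)"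
  proof -
    have "(\<Sum>j\<in>{-3, 0, 2}. (\<tau> j)\<^sup>2) \<le> (\<Sum>j\<in>?O. (\<tau> j)\<^sup>2)"
      by (rule sum_mono2) (use in_sites in \<open>auto simp: excited_def\<close>)
    moreover have "(\<Sum>j\<in>{-3, 0, 2}. (\<tau> j)\<^sup>2) = p\<^sup>2 + 2 * q\<^sup>2"
      by (simp add: \<tau>_def x_def excited_def nx_near pv_near p_def q_def z1)
    ultimately show ?thesis by simp
  qed
  have shift2: "(\<Sum>j\<in>?O. (f (nx N j) + f (pv N j))\<^sup>2) \<le> 4 * (\<Sum>j\<in>sites N. (f j)\<^sup>2)" for f :: "int \<Rightarrow> real"
  proof -
    have "(\<Sum>j\<in>?O. (f (nx N j) + f (pv N j))\<^sup>2) \<le> (\<Sum>j\<in>sites N. (f (nx N j) + f (pv N j))\<^sup>2)"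
      by (rule sum_mono2) auto
    also have "\<dots> \<le> (\<Sum>j\<in>sites N. 2 * (f (nx N j))\<^sup>2 + 2 * (f (pv N j))\<^sup>2)"
    proof (rule sum_mono)
      fix j
      have "0 \<le> (f (nx N j) - f (pv N j))\<^sup>2" by simp
      then show "(f (nx N j) + f (pv N j))\<^sup>2 \<le> 2 * (f (nx N j))\<^sup>2 + 2 * (f (pv N j))\<^sup>2"
        by (simp add: power2_sum power2_diff)
    qed
    also have "\<dots> = 4 * (\<Sum>j\<in>sites N. (f j)\<^sup>2)"
      unfolding sum.distrib sum_distrib_left[symmetric]
      using sum_nx[of "\<lambda>j. (f j)\<^sup>2" N] sum_pv[of "\<lambda>j. (f j)\<^sup>2" N] by simp
    finally show ?thesis .
  qed
  have \<tau>2_upper: "(\<Sum>j\<in>?O. (\<tau> j)\<^sup>2) \<le> 4 * (p\<^sup>2 + q\<^sup>2)"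
    using shift2[of x] by (simp add: \<tau>_def sum_x2)
  have t2: "(\<Sum>j\<in>?O. (t j)\<^sup>2) \<le> 4 * Y" using shift2[of y] by (simp add: t_def sum_y2)
  have g2: "(\<Sum>j\<in>?O. (g j)\<^sup>2) \<le> 1/1000000 * Y"
  proof -
    have "(\<Sum>j\<in>?O. (g j)\<^sup>2) \<le> (\<Sum>j\<in>?O. 1/2000000 * (y j)\<^sup>2 + 2/100000000 * (t j)\<^sup>2)"
    proof (rule sum_mono)
      fix j assume j: "j \<in> ?O"
      have "(g j)\<^sup>2 \<le> 2 * ((D j + 1)\<^sup>2 * (y j)\<^sup>2) + 2 * (e\<^sup>2 * (t j)\<^sup>2)"
        using two(1)[of "(D j + 1) * y j" "e * t j"] unfolding g_def power_mult_distrib .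
      moreover have "(D j + 1)\<^sup>2 * (y j)\<^sup>2 \<le> 9/100000000 * (y j)\<^sup>2"
      proof (rule mult_right_mono)
        have "(D j + 1)\<^sup>2 \<le> (3/10000)\<^sup>2" using quiet_diag[of j] j by (intro power_mono) (auto simp: D_def)
        then show "(D j + 1)\<^sup>2 \<le> 9/100000000" by (simp add: power2_eq_square)
      qed simp
      moreover have "e\<^sup>2 * (t j)\<^sup>2 \<le> 1/100000000 * (t j)\<^sup>2" using e_square by (intro mult_right_mono) auto
      ultimately show "(g j)\<^sup>2 \<le> 1/2000000 * (y j)\<^sup>2 + 2/100000000 * (t j)\<^sup>2"
        using zero_le_power2[of "y j"] by linarith
    qed
    also have "\<dots> = 1/2000000 * Y + 2/100000000 * (\<Sum>j\<in>?O. (t j)\<^sup>2)"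
      by (simp add: sum.distrib sum_distrib_left Y_def)
    finally show ?thesis using t2 Y0 by linarith
  qed
  have Y_le: "Y \<le> 2 * H + 8 * (e\<^sup>2 * (p\<^sup>2 + q\<^sup>2))"
  proof -
    have "Y \<le> (\<Sum>j\<in>?O. 2 * (h j)\<^sup>2 + 2 * e\<^sup>2 * (\<tau> j)\<^sup>2)"
      unfolding Y_def
    proof (rule sum_mono)
      fix j
      have "y j = h j - e * \<tau> j" by (simp add: h_def)
      then show "(y j)\<^sup>2 \<le> 2 * (h j)\<^sup>2 + 2 * e\<^sup>2 * (\<tau> j)\<^sup>2"
        using two(1)[of "h j" "e * \<tau> j"] by (simp add: power_mult_distrib)
    qed
    also have "\<dots> = 2 * H + 2 * e\<^sup>2 * (\<Sum>j\<in>?O. (\<tau> j)\<^sup>2)"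
      by (simp add: sum.distrib sum_distrib_left H_def)
    also have "\<dots> \<le> 2 * H + 2 * e\<^sup>2 * (4 * (p\<^sup>2 + q\<^sup>2))" using \<tau>2_upper by (intro add_left_mono mult_left_mono) auto
    finally show ?thesis by (simp add: algebra_simps)
  qed
  \<comment> \<open>the wave equation at -2 and 1 yields the diagonal of \<open>Lminus\<close> there; \<open>u 0\<close> is negligible as the phases at -1 and 1 cancel\<close>
  have D2: "99/100 * e \<le> D (-2)" "D (-2) \<le> 101/100 * e"
  proof -
    have r: "D (-2) * u (-2) = e * (u (-1) + u (-3))" using site_diag[of "-2"] by (simp add: D_def)
    have u2: "9999/10000 \<le> u (-2)" "u (-2) \<le> 10001/10000" using u_values(1,2) s2 by linarith+
    have "9998/10000 \<le> u (-1) + u (-3)" "u (-1) + u (-3) \<le> 10002/10000" using u_values(3,4,7,8) by linarith+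
    then have b: "e * (9998/10000) \<le> D (-2) * u (-2)" "D (-2) * u (-2) \<le> e * (10002/10000)"
      unfolding r using e by (auto intro!: mult_left_mono)
    then have "0 < D (-2) * u (-2)" using e by linarith
    then have "0 < D (-2)" using u2 by (simp add: zero_less_mult_iff)
    then have "D (-2) * u (-2) \<le> D (-2) * (10001/10000)" "D (-2) * (9999/10000) \<le> D (-2) * u (-2)"
      using u2 by (auto intro!: mult_left_mono)
    then show "99/100 * e \<le> D (-2)" "D (-2) \<le> 101/100 * e" using b e by linarith+
  qed
  have D1: "D 1 \<le> 0" "- (101/100) * e\<^sup>2 \<le> D 1"
  proof -
    have r: "D 1 * u 1 = e * (u 2 + u 0)" using site_diag[of 1] by (simp add: D_def)
    have u1: "-(10001/10000) \<le> u 1" "u 1 \<le> -(9999/10000)" using u_values(5,6) s1 by linarith+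
    have sums: "\<bar>u 1 + u (-1)\<bar> \<le> 2/10000"
      "- (10002/10000) \<le> u 3 + u 1" "u 3 + u 1 \<le> - (9998/10000)" using u1 u_values(3,4,9,10) by linarith+
    have es: "e * \<bar>u 1 + u (-1)\<bar> \<le> e * (2/10000)"
      "e * - (10002/10000) \<le> e * (u 3 + u 1)" "e * (u 3 + u 1) \<le> e * - (9998/10000)"
      by (rule mult_left_mono; use sums e in linarith)+
    have ab: "\<bar>e * (u 1 + u (-1))\<bar> = e * \<bar>u 1 + u (-1)\<bar>" using e by (simp add: abs_mult)
    have q0: "\<bar>u 0 + e * (u 1 + u (-1))\<bar> \<le> 4/10000 * (e * \<bar>u 1 + u (-1)\<bar>)"
      using quiet_value[of 0] by (simp add: excited_def)
    have "\<bar>u 2 + e * (u 3 + u 1)\<bar> \<le> 4/10000 * (e * \<bar>u 3 + u 1\<bar>)"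
      using quiet_value[of 2] by (simp add: excited_def)
    also have "\<bar>u 3 + u 1\<bar> = - (u 3 + u 1)" using sums by simp
    finally have q2: "\<bar>u 2 + e * (u 3 + u 1)\<bar> \<le> 4/10000 * (- (e * (u 3 + u 1)))" by (simp add: algebra_simps)
    have "0 \<le> u 2 + u 0" "u 2 + u 0 \<le> (1005/1000) * e" using q0 q2 es ab e by linarith+
    then have "0 \<le> e * (u 2 + u 0)" "e * (u 2 + u 0) \<le> e * ((1005/1000) * e)"
      using e by (auto intro!: mult_left_mono)
    then have b: "0 \<le> (- D 1) * (- u 1)" "(- D 1) * (- u 1) \<le> (1005/1000) * e\<^sup>2"
      unfolding r[symmetric] by (simp_all add: power2_eq_square)
    then show "D 1 \<le> 0" using u1 by (simp add: zero_le_mult_iff)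
    then have "(- D 1) * (9999/10000) \<le> (- D 1) * (- u 1)" using u1 by (intro mult_left_mono) auto
    then show "- (101/100) * e\<^sup>2 \<le> D 1" using b e_square by linarith
  qed
  have pair: "ip N z r = D (-2) * p\<^sup>2 + D 1 * q\<^sup>2 - H + e\<^sup>2 * (\<Sum>j\<in>?O. (\<tau> j)\<^sup>2) + (\<Sum>j\<in>?O. y j * g j)"
  proof -
    have "ip N z r = p * r (-2) + q * r 1 + (\<Sum>j\<in>?O. z j * r j)"
      unfolding ip_def by (subst sum_split_excited[OF N6]) (simp add: p_def q_def z1)
    also have "p * r (-2) = D (-2) * p\<^sup>2 - e * (p * z (-3))"
      by (simp add: r nx_near pv_near z1 p_def power2_eq_square algebra_simps)
    also have "q * r 1 = D 1 * q\<^sup>2 - e * (q * (z 0 + z 2))"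
      by (simp add: r nx_near pv_near q_def power2_eq_square algebra_simps)
    also have "(\<Sum>j\<in>?O. z j * r j) = (\<Sum>j\<in>?O. y j * g j - (h j)\<^sup>2 + e\<^sup>2 * (\<tau> j)\<^sup>2 + e * (\<tau> j * y j))"
    proof (rule sum.cong)
      fix j assume j: "j \<in> ?O"
      then have "z j = y j" by (simp add: y_def)
      then show "z j * r j = y j * g j - (h j)\<^sup>2 + e\<^sup>2 * (\<tau> j)\<^sup>2 + e * (\<tau> j * y j)"
        unfolding rO[OF j] by (simp add: h_def power2_eq_square algebra_simps)
    qed simp
    also have "\<dots> = (\<Sum>j\<in>?O. y j * g j) - H + e\<^sup>2 * (\<Sum>j\<in>?O. (\<tau> j)\<^sup>2) + e * (p * (z (-3)) + q * (z 0 + z 2))"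
      by (simp add: sum.distrib sum_subtractf sum_distrib_left[symmetric] cross H_def)
    finally show ?thesis by (simp add: algebra_simps)
  qed
  have yg: "(\<Sum>j\<in>?O. y j * g j) \<ge> - (1/1000) * Y - 250 * (\<Sum>j\<in>?O. (g j)\<^sup>2)"
  proof -
    have "(\<Sum>j\<in>?O. - (1/1000) * (y j)\<^sup>2 - 250 * (g j)\<^sup>2) \<le> (\<Sum>j\<in>?O. y j * g j)"
    proof (rule sum_mono)
      fix j
      have "0 \<le> 1/1000 * (y j + 500 * g j)\<^sup>2" by simp
      then show "- (1/1000) * (y j)\<^sup>2 - 250 * (g j)\<^sup>2 \<le> y j * g j"
        by (simp add: power2_eq_square algebra_simps)
    qed
    then show ?thesis unfolding Y_def sum_subtractf sum_distrib_left .
  qed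
  have rO2: "(\<Sum>j\<in>?O. (r j)\<^sup>2) \<ge> 99/100 * H - 99 * (\<Sum>j\<in>?O. (g j)\<^sup>2)"
  proof -
    have "(\<Sum>j\<in>?O. 99/100 * (h j)\<^sup>2 - 99 * (g j)\<^sup>2) \<le> (\<Sum>j\<in>?O. (r j)\<^sup>2)"
    proof (rule sum_mono)
      fix j assume j: "j \<in> ?O"
      have "(r j)\<^sup>2 = (h j - g j)\<^sup>2" unfolding rO[OF j] by (simp add: power2_eq_square algebra_simps)
      then show "99/100 * (h j)\<^sup>2 - 99 * (g j)\<^sup>2 \<le> (r j)\<^sup>2" using square_perturbation[of "h j" "g j"] by simp
    qed
    then show ?thesis unfolding H_def sum_subtractf sum_distrib_left .
  qed
  have notin: "-3 \<in> ?O" "0 \<in> ?O" "2 \<in> ?O" using in_sites by (auto simp: excited_def)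
  have eY: "e\<^sup>2 * (z k)\<^sup>2 \<le> e\<^sup>2 * Y" if "k \<in> ?O" for k using y_le[OF that] by (intro mult_left_mono) auto
  have ra: "(r (-2))\<^sup>2 \<le> 3 * (e\<^sup>2 * p\<^sup>2) + 2 * (e\<^sup>2 * Y)"
  proof -
    have "r (-2) = D (-2) * p - e * z (-3)" by (simp add: r nx_near pv_near z1 p_def)
    then have "(r (-2))\<^sup>2 \<le> 2 * ((D (-2))\<^sup>2 * p\<^sup>2) + 2 * (e\<^sup>2 * (z (-3))\<^sup>2)"
      using two(1)[of "D (-2) * p" "e * z (-3)"] by (simp add: power_mult_distrib)
    moreover have "(D (-2))\<^sup>2 * p\<^sup>2 \<le> (101/100 * e)\<^sup>2 * p\<^sup>2" using D2 e by (intro mult_right_mono power_mono) auto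
    moreover have "(101/100 * e)\<^sup>2 * p\<^sup>2 = 10201/10000 * (e\<^sup>2 * p\<^sup>2)"
      by (simp add: power2_eq_square)
    moreover have "0 \<le> e\<^sup>2 * p\<^sup>2" by simp
    ultimately show ?thesis using eY[OF notin(1)] by linarith
  qed
  have rb: "(r (-1))\<^sup>2 \<le> 2 * (e\<^sup>2 * p\<^sup>2) + 2 * (e\<^sup>2 * Y)"
  proof -
    have "r (-1) = - (e * (z 0 + p))" by (simp add: r nx_near pv_near z1 p_def)
    then have "(r (-1))\<^sup>2 = e\<^sup>2 * (z 0 + p)\<^sup>2" by (simp add: power_mult_distrib)
    also have "\<dots> \<le> e\<^sup>2 * (2 * (z 0)\<^sup>2 + 2 * p\<^sup>2)" using two(2) by (intro mult_left_mono) auto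
    finally show ?thesis using eY[OF notin(2)] by (simp add: algebra_simps)
  qed
  have rc: "(r 1)\<^sup>2 \<le> 1/1000000 * (e\<^sup>2 * q\<^sup>2) + 8 * (e\<^sup>2 * Y)"
  proof -
    have "r 1 = D 1 * q - e * (z 0 + z 2)" by (simp add: r nx_near pv_near q_def algebra_simps)
    then have "(r 1)\<^sup>2 \<le> 2 * ((D 1)\<^sup>2 * q\<^sup>2) + 2 * (e\<^sup>2 * (z 0 + z 2)\<^sup>2)"
      using two(1)[of "D 1 * q" "e * (z 0 + z 2)"] by (simp add: power_mult_distrib)
    moreover have "(D 1)\<^sup>2 * q\<^sup>2 \<le> 1/2000000 * (e\<^sup>2 * q\<^sup>2)"
    proof -
      have "\<bar>D 1\<bar> \<le> 1/2000 * e" using D1 e_square e by linarith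
      then have "\<bar>D 1\<bar>\<^sup>2 \<le> (1/2000 * e)\<^sup>2" by (intro power_mono) auto
      then have "(D 1)\<^sup>2 * q\<^sup>2 \<le> (1/2000 * e)\<^sup>2 * q\<^sup>2" by (intro mult_right_mono) auto
      also have "\<dots> = 1/4000000 * (e\<^sup>2 * q\<^sup>2)" by (simp add: power_mult_distrib power2_eq_square)
      finally have "(D 1)\<^sup>2 * q\<^sup>2 \<le> 1/4000000 * (e\<^sup>2 * q\<^sup>2)" .
      moreover have "0 \<le> e\<^sup>2 * q\<^sup>2" by simp
      ultimately show ?thesis by linarith
    qed
    moreover have "e\<^sup>2 * (z 0 + z 2)\<^sup>2 \<le> e\<^sup>2 * (2 * (z 0)\<^sup>2 + 2 * (z 2)\<^sup>2)" using two(2) by (intro mult_left_mono) auto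
    moreover have "\<dots> = 2 * (e\<^sup>2 * (z 0)\<^sup>2) + 2 * (e\<^sup>2 * (z 2)\<^sup>2)" by (simp add: algebra_simps)
    ultimately show ?thesis using eY[OF notin(2)] eY[OF notin(3)] by linarith
  qed
  define P P2 Q where "P = e * p\<^sup>2" and "P2 = e\<^sup>2 * p\<^sup>2" and "Q = e\<^sup>2 * q\<^sup>2"
  have PQ: "0 \<le> P2" "0 \<le> Q" "P2 \<le> 1/10000 * P" "e\<^sup>2 * Y \<le> 1/100000000 * Y"
  proof -
    show "P2 \<le> 1/10000 * P"
      using mult_right_mono[OF e_square(2), of "p\<^sup>2"] by (simp add: P_def P2_def)
    show "e\<^sup>2 * Y \<le> 1/100000000 * Y" using e_square(3) Y0 by (intro mult_right_mono) auto
  qed (simp_all add: P2_def Q_def)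
  have d: "D (-2) * p\<^sup>2 \<ge> 99/100 * P" "D 1 * q\<^sup>2 \<ge> - (101/100) * Q"
    using mult_right_mono[OF D2(1), of "p\<^sup>2"] mult_right_mono[OF D1(2), of "q\<^sup>2"] by (simp_all add: P_def Q_def mult_ac)
  have tt: "e\<^sup>2 * (\<Sum>j\<in>?O. (\<tau> j)\<^sup>2) \<ge> P2 + 2 * Q"
    using mult_left_mono[OF \<tau>2_lower, of "e\<^sup>2"] by (simp add: P2_def Q_def algebra_simps)
  have Yb: "Y \<le> 2 * H + 8 * P2 + 8 * Q" using Y_le by (simp add: P2_def Q_def algebra_simps)
  have main: "pot N e u z z \<ge> 1/2 * P + 1/2 * Q + 1/10 * H"
  proof -
    have 1: "ip N z r \<ge> 99/100 * P + 99/100 * Q - H + P2 - 2/1000 * Y"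
      unfolding pair using d tt yg g2 Y0 by linarith
    have 2: "(r (-2))\<^sup>2 + (r (-1))\<^sup>2 + (r 1)\<^sup>2 \<le> 5 * P2 + 1/1000 * Q + 1/1000 * Y"
      using ra rb rc PQ Y0 unfolding P2_def[symmetric] Q_def[symmetric] by linarith
    have 3: "(\<Sum>j\<in>?O. (r j)\<^sup>2) \<ge> 99/100 * H - 1/1000 * Y" using rO2 g2 Y0 by linarith
    have 4: "p0 \<ge> 1/2 * P + 1/2 * Q + 1/10 * H"
      if "p0 \<ge> 3/4 * i0 - 3 * r0 + 999/1000 * s0" "i0 \<ge> 99/100 * P + 99/100 * Q - H + P2 - 2/1000 * Y"
        "r0 \<le> 5 * P2 + 1/1000 * Q + 1/1000 * Y" "s0 \<ge> 99/100 * H - 1/1000 * Y" for p0 i0 r0 s0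
      using that Yb Y0 PQ(1-3) by linarith
    show ?thesis by (rule 4[OF pot_lower_bound[of z, folded r_def] 1 2 3])
  qed
  have P0: "0 \<le> P" using e by (simp add: P_def)
  show "0 \<le> pot N e u z z" using main P0 PQ Y0 by linarith
  assume zero: "pot N e u z z = 0" and j: "j \<in> sites N"
  have "P = 0" "Q = 0" "H = 0" using main P0 PQ Y0 zero by linarith+
  then have pq: "p = 0" "q = 0" using e by (auto simp: P_def Q_def)
  then have "Y = 0" using Yb Y0 \<open>H = 0\<close> by (simp add: P2_def Q_def)
  show "z j = 0"
  proof (cases "j \<in> excited")
    case True
    then show ?thesis using pq z1 by (auto simp: excited_def p_def q_def)
  next
    case False
    then show ?thesis using y_le[of j] j \<open>Y = 0\<close> by simp
  qed
qed

lemma pot_stable: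
  assumes "\<sigma> (-2) = 1" "\<sigma> 1 = -1"
  shows "0 \<le> pot N e u b b" "pot N e u b b = 0 \<Longrightarrow> \<exists>c. \<forall>j\<in>sites N. b j = c * u j"
proof -
  define c where "c = b (-1) / u (-1)"
  define z where "z j = b j + (- c) * u j" for j
  have "u (-1) \<noteq> 0" using u_values(3) by linarith
  then have z1: "z (-1) = 0" by (simp add: z_def c_def)
  have pz: "pot N e u z z = pot N e u b b" unfolding z_def by (rule pot_shift)
  show "0 \<le> pot N e u b b" using pot_positive(1)[where z = z, OF assms z1] pz by simp
  assume "pot N e u b b = 0"
  then have "z j = 0" if "j \<in> sites N" for j using pot_positive(2)[where z = z, OF assms z1 _ that] pz by simp
  then have "\<forall>j\<in>sites N. b j = c * u j" by (simp add: z_def)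
  then show "\<exists>c. \<forall>j\<in>sites N. b j = c * u j" by blast
qed

end

section \<open>A negative direction yields a growing mode\<close>

text \<open>Functions on a finite index set are kept as functions on \<open>int\<close> vanishing elsewhere; in the product topology they form a compact set by Tychonoff.\<close>

lemma compact_unit_sphere_functions:
  fixes J :: "int set"
  assumes J: "finite J"
  shows "compact {f :: int \<Rightarrow> real. (\<forall>j. j \<notin> J \<longrightarrow> f j = 0) \<and> (\<Sum>j\<in>J. (f j)\<^sup>2) = 1}" (is "compact ?K")
proof -
  define B where "B = PiE UNIV (\<lambda>j. if j \<in> J then {-1..1} else {0 :: real})"
  have "compactin (product_topology (\<lambda>_. euclidean) UNIV) B"
    unfolding B_def compactin_PiE by (auto simp: compactin_euclidean_iff)
  then have "compact B" by (simp add: euclidean_product_topology[symmetric] flip: compactin_euclidean_iff)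
  moreover have "closed {f :: int \<Rightarrow> real. (\<Sum>j\<in>J. (f j)\<^sup>2) = 1}"
    by (intro closed_Collect_eq continuous_intros continuous_on_product_coordinates)
  moreover have "?K = B \<inter> {f. (\<Sum>j\<in>J. (f j)\<^sup>2) = 1}"
  proof -
    have "\<bar>f j\<bar> \<le> 1" if "(\<Sum>j\<in>J. (f j)\<^sup>2) = 1" "j \<in> J" for f :: "int \<Rightarrow> real" and j
    proof -
      have "(f j)\<^sup>2 \<le> (\<Sum>j\<in>J. (f j)\<^sup>2)" by (rule member_le_sum) (use J that in auto)
      then show ?thesis using that by (simp add: abs_square_le_1)
    qed
    then show ?thesis by (force simp: B_def PiE_def Pi_def split: if_splits)
  qed
  ultimately show ?thesis by (simp add: compact_Int_closed)
qed

lemma rayleigh_minimum: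
  fixes Q P :: "(int \<Rightarrow> real) \<Rightarrow> real"
  assumes J: "finite J" and cont: "continuous_on UNIV Q" "continuous_on UNIV P"
    and homog: "\<And>c f. Q (\<lambda>j. c * f j) = c\<^sup>2 * Q f" "\<And>c f. P (\<lambda>j. c * f j) = c\<^sup>2 * P f"
    and loc: "\<And>f g. (\<And>j. j \<in> J \<Longrightarrow> f j = g j) \<Longrightarrow> Q f = Q g" "\<And>f g. (\<And>j. j \<in> J \<Longrightarrow> f j = g j) \<Longrightarrow> P f = P g"
    and pos: "\<And>f. \<exists>j\<in>J. f j \<noteq> 0 \<Longrightarrow> P f > 0" and neg: "Q b < 0"
  shows "\<exists>a. (\<exists>j\<in>J. a j \<noteq> 0) \<and> Q a < 0 \<and> (\<forall>f. Q a / P a * P f \<le> Q f)"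
proof -
  define K where "K = {f :: int \<Rightarrow> real. (\<forall>j. j \<notin> J \<longrightarrow> f j = 0) \<and> (\<Sum>j\<in>J. (f j)\<^sup>2) = 1}"
  have zero: "Q f = 0" "P f = 0" if "\<forall>j\<in>J. f j = 0" for f
    using loc(1)[of f "\<lambda>j. 0 * f j"] loc(2)[of f "\<lambda>j. 0 * f j"] homog(1)[of 0 f] homog(2)[of 0 f] that by simp_all
  have normalise: "\<exists>g\<in>K. \<exists>c>0. Q g = c * Q f \<and> P g = c * P f" if f: "\<exists>j\<in>J. f j \<noteq> 0" for f
  proof -
    define n where "n = (\<Sum>j\<in>J. (f j)\<^sup>2)"
    obtain i where i: "i \<in> J" "f i \<noteq> 0" using f by blast
    have "0 < (f i)\<^sup>2" using i by simp
    also have "\<dots> \<le> n" unfolding n_def by (rule member_le_sum) (use i J in auto)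
    finally have n: "n > 0" .
    define c where "c = 1 / sqrt n"
    have c: "c\<^sup>2 = 1 / n" "c > 0" using n by (simp_all add: c_def power_divide)
    define g where "g j = (if j \<in> J then c * f j else 0)" for j
    have "(\<Sum>j\<in>J. (g j)\<^sup>2) = c\<^sup>2 * n"
      by (simp add: g_def n_def power_mult_distrib sum_distrib_left)
    then have "g \<in> K" using c n by (simp add: K_def g_def)
    moreover have "Q g = c\<^sup>2 * Q f" "P g = c\<^sup>2 * P f"
      using loc(1)[of g "\<lambda>j. c * f j"] loc(2)[of g "\<lambda>j. c * f j"] homog by (simp_all add: g_def)
    ultimately show ?thesis using c n by (intro bexI[of _ g] exI[of _ "c\<^sup>2"]) auto
  qed
  have Kpos: "P f > 0" "\<exists>j\<in>J. f j \<noteq> 0" if "f \<in> K" for f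
  proof -
    show "\<exists>j\<in>J. f j \<noteq> 0"
    proof (rule ccontr)
      assume "\<not> ?thesis"
      then have "(\<Sum>j\<in>J. (f j)\<^sup>2) = 0" by simp
      then show False using that by (simp add: K_def)
    qed
    then show "P f > 0" by (rule pos)
  qed
  have b: "\<exists>j\<in>J. b j \<noteq> 0" using zero(1)[of b] neg by auto
  then obtain g where g: "g \<in> K" "Q g < 0"
    using normalise[OF b] neg by (metis mult_pos_neg)
  have "compact K" unfolding K_def by (rule compact_unit_sphere_functions[OF J])
  moreover have "K \<noteq> {}" using g by auto
  moreover have "continuous_on K (\<lambda>f. Q f / P f)"
    using Kpos by (intro continuous_on_divide continuous_on_subset[OF cont(1)] continuous_on_subset[OF cont(2)]) force+
  ultimately obtain a where a: "a \<in> K" "\<forall>f\<in>K. Q a / P a \<le> Q f / P f"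
    using continuous_attains_inf by blast
  have "Q a / P a \<le> Q g / P g" using a g by blast
  also have "\<dots> < 0" using g Kpos(1)[of g] by (simp add: divide_neg_pos)
  finally have "Q a < 0" using Kpos(1)[OF a(1)] by (simp add: divide_less_0_iff)
  moreover have "Q a / P a * P f \<le> Q f" for f
  proof (cases "\<exists>j\<in>J. f j \<noteq> 0")
    case True
    then obtain h c where h: "h \<in> K" "c > 0" "Q h = c * Q f" "P h = c * P f" using normalise by blast
    then have "Q a / P a \<le> Q f / P f" using a(2) by fastforce
    then show ?thesis using pos[OF True] by (simp add: pos_le_divide_eq)
  next
    case False
    then show ?thesis using zero[of f] by simp
  qed
  ultimately show ?thesis using Kpos(2)[OF a(1)] by blast
qed

lemma continuous_on_Lplus:
  assumes "\<And>j. continuous_on UNIV (\<lambda>f. F f j)"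
  shows "continuous_on UNIV (\<lambda>f. Lplus N e u (F f) j)"
  unfolding Lplus_def lap_def by (intro continuous_intros assms)

lemma continuous_on_Lminus:
  assumes "\<And>j. continuous_on UNIV (\<lambda>f. F f j)"
  shows "continuous_on UNIV (\<lambda>f. Lminus N e u (F f) j)"
  unfolding Lminus_def lap_def by (intro continuous_intros assms)

lemma continuous_on_ip:
  assumes "\<And>j. continuous_on UNIV (\<lambda>f. F f j)" "\<And>j. continuous_on UNIV (\<lambda>f. G f j)"
  shows "continuous_on UNIV (\<lambda>f. ip N (F f) (G f))"
  unfolding ip_def by (intro continuous_intros assms)

context wave begin

text \<open>\<open>Lplus\<close> is close to an invertible diagonal operator. Surjectivity transports a negative direction \<open>b\<close> of \<open>pot\<close> to some \<open>a\<close> with \<open>Lplus a = b\<close>.\<close>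

lemma Lp_surjective: "\<exists>a. \<forall>j\<in>sites N. Lp a j = b j"
proof -
  define D where "D j = 3 * (u j)\<^sup>2 - 1" for j
  have D: "9/10 \<le> \<bar>D j\<bar>" if "j \<in> sites N" for j
    using on_square[OF that] off_square[OF that] by (cases "j \<in> excited") (auto simp: D_def)
  define G where "G a j = (b j - e * lap N a j) / D j" for a j
  define S where "S = (\<Sum>j\<in>sites N. \<bar>b j\<bar>)"
  define r where "r = 4 * S"
  have "\<exists>a. \<forall>j\<in>sites N. \<bar>a j - 0\<bar> \<le> r \<and> G a j = a j"
  proof (rule contraction_fixpoint)
    show "0 \<le> r" by (simp add: r_def S_def sum_nonneg)
  next
    fix j assume j: "j \<in> sites N"
    have "\<bar>b j\<bar> \<le> S" unfolding S_def by (rule member_le_sum) (use j in auto)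
    moreover have "\<bar>b j / D j\<bar> \<le> 2 * \<bar>b j\<bar>"
    proof -
      have "\<bar>b j\<bar> / \<bar>D j\<bar> \<le> \<bar>b j\<bar> / (1/2)" using D[OF j] by (intro divide_left_mono) auto
      then show ?thesis by (simp add: abs_divide)
    qed
    ultimately have "\<bar>b j / D j\<bar> \<le> 2 * S" by (meson mult_left_mono order_trans zero_le_numeral)
    then show "\<bar>G (\<lambda>j. 0) j - 0\<bar> \<le> r / 2" by (simp add: G_def lap_def r_def)
  next
    fix f g :: "int \<Rightarrow> real" and m j
    assume fg: "\<forall>k\<in>sites N. \<bar>f k - g k\<bar> \<le> m" and j: "j \<in> sites N"
    have m: "0 \<le> m" using fg j by force
    have "G f j - G g j = - (e * lap N (\<lambda>j. f j - g j) j) / D j"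
      by (simp add: G_def lap_diff diff_divide_distrib[symmetric] algebra_simps)
    then have "\<bar>G f j - G g j\<bar> = e * \<bar>lap N (\<lambda>j. f j - g j) j\<bar> / \<bar>D j\<bar>" using e by (simp add: abs_mult)
    also have "\<dots> \<le> (1/10000) * (4 * m) / (9/10)"
      using D[OF j] e m abs_lap_le[OF fg j] by (intro frac_le mult_mono) auto
    also have "\<dots> \<le> m / 2" using m by simp
    finally show "\<bar>G f j - G g j\<bar> \<le> m / 2" .
  qed
  then obtain a where a: "\<forall>j\<in>sites N. G a j = a j" by blast
  have "Lp a j = b j" if j: "j \<in> sites N" for j
  proof -
    have "D j \<noteq> 0" using D[OF j] by auto
    moreover have "(b j - e * lap N a j) / D j = a j" using a j by (simp add: G_def)
    ultimately have "b j - e * lap N a j = D j * a j" by (simp add: field_simps)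
    then show ?thesis by (simp add: Lplus_def D_def)
  qed
  then show ?thesis by blast
qed

lemma kin_positive_strict: "\<exists>j\<in>sites N. a j \<noteq> 0 \<Longrightarrow> 0 < kin N e u a a"
  using kin_positive[of a] ip_self_zero[of N a] ip_self_nonneg[of N a] by fastforce

text \<open>\<open>Lm Lp\<close> is symmetric with respect to the positive form \<open>kin\<close>, and \<open>pot (Lp a) (Lp a)\<close> is its quadratic form. A minimizer of the Rayleigh quotient is
  an eigenvector, with negative eigenvalue \<open>- m\<close> once \<open>pot\<close> is negative somewhere.\<close>

lemma negative_direction_gives_eigenvector:
  assumes "pot N e u b b < 0"
  shows "\<exists>m>0. \<exists>a. (\<exists>j\<in>sites N. a j \<noteq> 0) \<and> (\<forall>j\<in>sites N. Lm (Lp a) j = - m * a j)"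
proof -
  define Q where "Q a = pot N e u (Lp a) (Lp a)" for a
  define P where "P a = kin N e u a a" for a
  obtain a0 where a0: "\<forall>j\<in>sites N. Lp a0 j = b j" using Lp_surjective by blast
  have Q0: "Q a0 < 0" using assms pot_cong[of N "Lp a0" b "Lp a0" b] a0 by (simp add: Q_def)
  have Lscale: "Lp (\<lambda>j. c * f j) = (\<lambda>j. c * Lp f j)" for c f
    by (simp add: fun_eq_iff Lplus_def lap_def algebra_simps)
  have zeroL: "Lp (\<lambda>j. 0) = (\<lambda>j. 0)" "Lm (\<lambda>j. 0) = (\<lambda>j. 0)" by (simp_all add: fun_eq_iff Lplus_def Lminus_def lap_def)
  have zip: "ip N (\<lambda>j. 0) f = 0" for f by (simp add: ip_def)
  have kin0: "kin N e u (\<lambda>j. c * f j) h = c * kin N e u f h"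
    and pot0: "pot N e u (\<lambda>j. c * f j) h = c * pot N e u f h" for c f h
    using kin_add[of N e u "\<lambda>j. 0" c f h] pot_add[of N e u "\<lambda>j. 0" c f h] zeroL zip by (simp_all add: kin_def pot_def)
  have "\<exists>a. (\<exists>j\<in>sites N. a j \<noteq> 0) \<and> Q a < 0 \<and> (\<forall>f. Q a / P a * P f \<le> Q f)"
  proof (rule rayleigh_minimum[OF finite_sites])
    show "continuous_on UNIV Q" "continuous_on UNIV P"
      unfolding Q_def[abs_def] P_def[abs_def] kin_def pot_def
      by (intro continuous_intros continuous_on_ip continuous_on_Lplus continuous_on_Lminus continuous_on_product_coordinates)+
    show "P (\<lambda>j. c * f j) = c\<^sup>2 * P f" for c f
    proof -
      have "P (\<lambda>j. c * f j) = c * kin N e u f (\<lambda>j. c * f j)" unfolding P_def by (rule kin0)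
      also have "kin N e u f (\<lambda>j. c * f j) = kin N e u (\<lambda>j. c * f j) f" by (rule kin_commute)
      also have "\<dots> = c * kin N e u f f" by (rule kin0)
      finally show ?thesis by (simp add: P_def power2_eq_square)
    qed
    show "Q (\<lambda>j. c * f j) = c\<^sup>2 * Q f" for c f
    proof -
      have "Q (\<lambda>j. c * f j) = c * pot N e u (Lp f) (\<lambda>j. c * Lp f j)" unfolding Q_def Lscale by (rule pot0)
      also have "pot N e u (Lp f) (\<lambda>j. c * Lp f j) = pot N e u (\<lambda>j. c * Lp f j) (Lp f)" by (rule pot_commute)
      also have "\<dots> = c * pot N e u (Lp f) (Lp f)" by (rule pot0)
      finally show ?thesis by (simp add: Q_def power2_eq_square)
    qed
    show "Q f = Q g" if "\<And>j. j \<in> sites N \<Longrightarrow> f j = g j" for f g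
      unfolding Q_def by (rule pot_cong; rule Lplus_cong[OF that])
    show "P f = P g" if "\<And>j. j \<in> sites N \<Longrightarrow> f j = g j" for f g
      unfolding P_def by (rule kin_cong[OF that that])
    show "0 < P f" if "\<exists>j\<in>sites N. f j \<noteq> 0" for f
      unfolding P_def by (rule kin_positive_strict[OF that])
  qed (rule Q0)
  then obtain a where a: "\<exists>j\<in>sites N. a j \<noteq> 0" "Q a < 0" and min: "\<And>f. Q a / P a * P f \<le> Q f" by blast
  define \<kappa> where "\<kappa> = Q a / P a"
  have Pa: "P a > 0" unfolding P_def by (rule kin_positive_strict[OF a(1)])
  have \<kappa>: "\<kappa> < 0" "Q a = \<kappa> * P a" using a(2) Pa by (simp_all add: \<kappa>_def divide_neg_pos)
  define B where "B f g = pot N e u (Lp f) (Lp g) - \<kappa> * kin N e u f g" for f g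
  have B_add: "B (\<lambda>j. f j + c * g j) h = B f h + c * B g h" for f c g h
    unfolding B_def Lplus_add kin_add pot_add by (simp add: algebra_simps)
  have B_commute: "B f g = B g f" for f g unfolding B_def using kin_commute pot_commute by metis
  have B_nonneg: "0 \<le> B f f" for f using min[of f] by (simp add: B_def \<kappa>_def Q_def P_def)
  have Baa: "B a a = 0" using \<kappa>(2) by (simp add: B_def Q_def P_def)
  \<comment> \<open>A semidefinite form vanishes against its null vectors.\<close>
  have Ba: "B a c = 0" for c
  proof (rule ccontr)
    assume nz: "B a c \<noteq> 0"
    define t where "t = - B a c / (B c c + 1)"
    have pos: "B c c + 1 > 0" using B_nonneg[of c] by linarith
    have "B (\<lambda>j. a j + t * c j) (\<lambda>j. a j + t * c j) = B a (\<lambda>j. a j + t * c j) + t * B c (\<lambda>j. a j + t * c j)"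
      by (rule B_add)
    also have "B a (\<lambda>j. a j + t * c j) = B a a + t * B c a" using B_add B_commute by metis
    also have "B c (\<lambda>j. a j + t * c j) = B a c + t * B c c" using B_add B_commute by metis
    finally have "0 \<le> 2 * t * B a c + t\<^sup>2 * B c c"
      using B_nonneg[of "\<lambda>j. a j + t * c j"] Baa B_commute[of c a] by (simp add: power2_eq_square algebra_simps)
    moreover have tB: "B a c = - (t * (B c c + 1))" using pos by (simp add: t_def)
    ultimately have "t\<^sup>2 * (B c c + 2) \<le> 0" by (simp add: power2_eq_square algebra_simps)
    moreover have "t \<noteq> 0" using nz pos by (simp add: t_def)
    ultimately show False using B_nonneg[of c] by (simp add: mult_le_0_iff)
  qed
  define d where "d j = Lm (Lp a) j + (- \<kappa>) * a j" for j
  have "kin N e u d c = B a c" for c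
    unfolding d_def kin_add B_def kin_Lminus by simp
  then have "kin N e u d d = 0" using Ba by simp
  then have "\<forall>j\<in>sites N. d j = 0" using kin_positive_strict[of d] by force
  then have "\<forall>j\<in>sites N. Lm (Lp a) j = - (- \<kappa>) * a j" by (simp add: d_def)
  then show ?thesis using \<kappa>(1) a(1) by (intro exI[of _ "- \<kappa>"]) auto
qed

end

section \<open>The linear flow and the monodromy matrix\<close>

lemma lin_field_combo:
  "lin_field N A \<epsilon> \<phi> (\<lambda>j. complex_of_real c * \<eta> j) j = complex_of_real c * lin_field N A \<epsilon> \<phi> \<eta> j"
  "lin_field N A \<epsilon> \<phi> (\<lambda>j. \<eta> j + \<zeta> j) j = lin_field N A \<epsilon> \<phi> \<eta> j + lin_field N A \<epsilon> \<phi> \<zeta> j"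
  by (simp_all add: lin_field_def lap_def algebra_simps)

lemma lin_field_zero: "lin_field N A \<epsilon> \<phi> (\<lambda>j. 0) j = 0"
  by (simp add: lin_field_def lap_def)

lemma lin_field_sum:
  "finite I \<Longrightarrow> lin_field N A \<epsilon> \<phi> (\<lambda>j. \<Sum>b\<in>I. complex_of_real (c b) * \<eta> b j) j
     = (\<Sum>b\<in>I. complex_of_real (c b) * lin_field N A \<epsilon> \<phi> (\<eta> b) j)"
proof (induction I rule: finite_induct)
  case empty
  then show ?case by (simp add: lin_field_zero)
next
  case (insert x F)
  then show ?case by (simp add: lin_field_combo)
qed

lemma lin_field_cong:
  assumes "\<And>k. k \<in> sites N \<Longrightarrow> \<eta> k = \<zeta> k" "j \<in> sites N"
  shows "lin_field N A \<epsilon> \<phi> \<eta> j = lin_field N A \<epsilon> \<phi> \<zeta> j"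
  using assms by (simp add: lin_field_def lap_def)

lemma lin_field_bounded:
  obtains C where "C \<ge> 0"
    "\<forall>\<eta> m. (\<forall>j\<in>sites N. cmod (\<eta> j) \<le> m) \<longrightarrow> (\<forall>j\<in>sites N. cmod (lin_field N A \<epsilon> \<phi> \<eta> j) \<le> C * m)"
proof -
  define R where "R = (\<Sum>j\<in>sites N. (cmod (\<phi> j))\<^sup>2)"
  define C where "C = (2 * R + \<bar>A\<bar>) + R + \<bar>\<epsilon>\<bar> * 4"
  have R0: "0 \<le> R" by (simp add: R_def sum_nonneg)
  have "cmod (lin_field N A \<epsilon> \<phi> \<eta> j) \<le> C * m"
    if \<eta>: "\<forall>j\<in>sites N. cmod (\<eta> j) \<le> m" and j: "j \<in> sites N" for \<eta> m j
  proof -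
    have m0: "0 \<le> m" using \<eta> j norm_ge_zero order_trans by blast
    have R: "(cmod (\<phi> j))\<^sup>2 \<le> R" unfolding R_def by (rule member_le_sum) (use j in auto)
    have "cmod (lin_field N A \<epsilon> \<phi> \<eta> j) = cmod (complex_of_real (2 * (cmod (\<phi> j))\<^sup>2 - A) * \<eta> j
        + (\<phi> j)\<^sup>2 * cnj (\<eta> j) + complex_of_real \<epsilon> * lap N \<eta> j)"
      by (simp only: lin_field_def norm_mult norm_minus_cancel norm_ii mult_1)
    also have "\<dots> \<le> cmod (complex_of_real (2 * (cmod (\<phi> j))\<^sup>2 - A) * \<eta> j)
       + cmod ((\<phi> j)\<^sup>2 * cnj (\<eta> j)) + cmod (complex_of_real \<epsilon> * lap N \<eta> j)"
      by (meson add_mono norm_triangle_ineq order_refl order_trans)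
    also have "\<dots> \<le> (2 * R + \<bar>A\<bar>) * m + R * m + \<bar>\<epsilon>\<bar> * (4 * m)"
      unfolding norm_mult norm_of_real norm_power complex_mod_cnj
    proof (intro add_mono mult_mono)
      show "\<bar>2 * (cmod (\<phi> j))\<^sup>2 - A\<bar> \<le> 2 * R + \<bar>A\<bar>" using R zero_le_power2[of "cmod (\<phi> j)"] by linarith
      show "cmod (lap N \<eta> j) \<le> 4 * m" by (rule norm_lap_le) (use \<eta> j in auto)
    qed (use \<eta> j R R0 m0 in auto)
    finally show ?thesis by (simp add: C_def algebra_simps)
  qed
  moreover have "C \<ge> 0" using R0 by (simp add: C_def)
  ultimately show thesis using that by blast
qed

text \<open>The exponential series of the time independent real-linear operator \<open>lin_field N A \<epsilon> \<phi>\<close>.\<close>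

definition lin_flow :: "nat \<Rightarrow> real \<Rightarrow> real \<Rightarrow> (int \<Rightarrow> complex) \<Rightarrow> real \<Rightarrow> (int \<Rightarrow> complex) \<Rightarrow> int \<Rightarrow> complex" where
  "lin_flow N A \<epsilon> \<phi> t \<eta> j = (\<Sum>k. ((lin_field N A \<epsilon> \<phi> ^^ k) \<eta> j / fact k) * complex_of_real t ^ k)"

lemma lin_flow_coeff_summable:
  assumes j: "j \<in> sites N"
  shows "summable (\<lambda>k. ((lin_field N A \<epsilon> \<phi> ^^ k) \<eta> j / fact k) * z ^ k)"
proof -
  obtain C where C: "C \<ge> 0"
    "\<forall>\<eta> m. (\<forall>j\<in>sites N. cmod (\<eta> j) \<le> m) \<longrightarrow> (\<forall>j\<in>sites N. cmod (lin_field N A \<epsilon> \<phi> \<eta> j) \<le> C * m)"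
    by (rule lin_field_bounded)
  define m where "m = (\<Sum>j\<in>sites N. cmod (\<eta> j))"
  have bd: "\<forall>j\<in>sites N. cmod ((lin_field N A \<epsilon> \<phi> ^^ k) \<eta> j) \<le> C ^ k * m" for k
  proof (induction k)
    case 0
    have "cmod (\<eta> j) \<le> m" if "j \<in> sites N" for j unfolding m_def by (rule member_le_sum) (use that in auto)
    then show ?case by simp
  next
    case (Suc k)
    have "(lin_field N A \<epsilon> \<phi> ^^ Suc k) \<eta> = lin_field N A \<epsilon> \<phi> ((lin_field N A \<epsilon> \<phi> ^^ k) \<eta>)" by simp
    moreover have "\<forall>j\<in>sites N. cmod (lin_field N A \<epsilon> \<phi> ((lin_field N A \<epsilon> \<phi> ^^ k) \<eta>) j) \<le> C * (C ^ k * m)"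
      by (rule C(2)[THEN spec, THEN spec, THEN mp, OF Suc])
    ultimately show ?case by (simp only: power_Suc mult.assoc)
  qed
  show ?thesis
  proof (rule summable_comparison_test')
    show "summable (\<lambda>k. m * (inverse (fact k) * (C * cmod z) ^ k))"
      using summable_exp[of "C * cmod z"] by (intro summable_mult) simp
    show "norm (((lin_field N A \<epsilon> \<phi> ^^ k) \<eta> j / fact k) * z ^ k) \<le> m * (inverse (fact k) * (C * cmod z) ^ k)" if "0 \<le> k" for k
    proof -
      have "norm (((lin_field N A \<epsilon> \<phi> ^^ k) \<eta> j / fact k) * z ^ k) = cmod ((lin_field N A \<epsilon> \<phi> ^^ k) \<eta> j) * (inverse (fact k) * cmod z ^ k)"
        by (simp add: norm_mult norm_divide norm_power field_simps)
      also have "\<dots> \<le> (C ^ k * m) * (inverse (fact k) * cmod z ^ k)"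
        using bd j by (intro mult_right_mono) auto
      finally show ?thesis by (simp add: power_mult_distrib mult_ac)
    qed
  qed
qed

lemma lin_flow_sums:
  assumes "j \<in> sites N"
  shows "(\<lambda>k. complex_of_real (t ^ k / fact k) * (lin_field N A \<epsilon> \<phi> ^^ k) \<eta> j) sums lin_flow N A \<epsilon> \<phi> t \<eta> j"
proof -
  have "(\<lambda>k. ((lin_field N A \<epsilon> \<phi> ^^ k) \<eta> j / fact k) * complex_of_real t ^ k) sums lin_flow N A \<epsilon> \<phi> t \<eta> j"
    unfolding lin_flow_def by (rule summable_sums[OF lin_flow_coeff_summable[OF assms]])
  then show ?thesis by (simp add: mult_ac)
qed

lemma lin_flow_0: "j \<in> sites N \<Longrightarrow> lin_flow N A \<epsilon> \<phi> 0 \<eta> j = \<eta> j"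
  unfolding lin_flow_def of_real_0 by (subst powser_zero) simp

lemma lin_flow_derivative:
  assumes j: "j \<in> sites N"
  shows "((\<lambda>t. lin_flow N A \<epsilon> \<phi> t \<eta> j) has_vector_derivative lin_field N A \<epsilon> \<phi> (lin_flow N A \<epsilon> \<phi> t \<eta>) j) (at t)"
proof -
  let ?B = "lin_field N A \<epsilon> \<phi>" and ?E = "lin_flow N A \<epsilon> \<phi>"
  define c where "c k = (?B ^^ k) \<eta> j / fact k" for k
  have "((\<lambda>z. \<Sum>k. c k * z ^ k) has_field_derivative (\<Sum>k. diffs c k * (complex_of_real t) ^ k)) (at (complex_of_real t))"
    unfolding c_def by (rule termdiffs_strong_converges_everywhere) (rule lin_flow_coeff_summable[OF j])
  then have D: "((\<lambda>t. ?E t \<eta> j) has_vector_derivative (\<Sum>k. diffs c k * (complex_of_real t) ^ k)) (at t)"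
    unfolding lin_flow_def c_def by (rule has_vector_derivative_real_field)
  have coeff: "diffs c k * (complex_of_real t) ^ k = ?B (\<lambda>i. complex_of_real (t ^ k / fact k) * (?B ^^ k) \<eta> i) j" for k
  proof -
    have "diffs c k = ?B ((?B ^^ k) \<eta>) j / fact k"
      unfolding diffs_def c_def by (simp add: field_simps del: of_nat_Suc)
    then show ?thesis unfolding lin_field_combo by (simp add: mult_ac)
  qed
  have S: "(\<lambda>k. complex_of_real (t ^ k / fact k) * (?B ^^ k) \<eta> i) sums ?E t \<eta> i" if "i \<in> sites N" for i
    by (rule lin_flow_sums[OF that])
  have "(\<lambda>k. ?B (\<lambda>i. complex_of_real (t ^ k / fact k) * (?B ^^ k) \<eta> i) j) sums ?B (?E t \<eta>) j"
    unfolding lin_field_def[of _ _ _ _ _ j] lap_def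
    by (intro sums_mult sums_add sums_diff sums_cnj[THEN iffD2] S j) simp_all
  then have "(\<Sum>k. diffs c k * (complex_of_real t) ^ k) = ?B (?E t \<eta>) j"
    unfolding coeff by (rule sums_unique[symmetric])
  with D show ?thesis by simp
qed

lemma lin_field_pow_combo:
  "(lin_field N A \<epsilon> \<phi> ^^ k) (\<lambda>j. \<eta> j + complex_of_real c * \<zeta> j)
     = (\<lambda>j. (lin_field N A \<epsilon> \<phi> ^^ k) \<eta> j + complex_of_real c * (lin_field N A \<epsilon> \<phi> ^^ k) \<zeta> j)"
proof (induction k)
  case (Suc k)
  show ?case by (simp only: funpow.simps o_apply Suc) (simp add: fun_eq_iff lin_field_combo)
qed simp

lemma lin_flow_combo:
  assumes j: "j \<in> sites N"
  shows "lin_flow N A \<epsilon> \<phi> t (\<lambda>j. \<eta> j + complex_of_real c * \<zeta> j) j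
     = lin_flow N A \<epsilon> \<phi> t \<eta> j + complex_of_real c * lin_flow N A \<epsilon> \<phi> t \<zeta> j"
proof (rule sums_unique2[OF lin_flow_sums[OF j]])
  have "(\<lambda>k. complex_of_real (t ^ k / fact k) * (lin_field N A \<epsilon> \<phi> ^^ k) \<eta> j
      + complex_of_real c * (complex_of_real (t ^ k / fact k) * (lin_field N A \<epsilon> \<phi> ^^ k) \<zeta> j))
     sums (lin_flow N A \<epsilon> \<phi> t \<eta> j + complex_of_real c * lin_flow N A \<epsilon> \<phi> t \<zeta> j)"
    by (intro sums_add sums_mult lin_flow_sums j)
  then show "(\<lambda>k. complex_of_real (t ^ k / fact k) * (lin_field N A \<epsilon> \<phi> ^^ k) (\<lambda>j. \<eta> j + complex_of_real c * \<zeta> j) j)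
     sums (lin_flow N A \<epsilon> \<phi> t \<eta> j + complex_of_real c * lin_flow N A \<epsilon> \<phi> t \<zeta> j)"
    unfolding lin_field_pow_combo by (simp add: distrib_left mult.left_commute)
qed

lemma lin_flow_eigenvector:
  assumes eig: "\<And>k. k \<in> sites N \<Longrightarrow> lin_field N A \<epsilon> \<phi> \<eta> k = complex_of_real l * \<eta> k" and j: "j \<in> sites N"
  shows "lin_flow N A \<epsilon> \<phi> t \<eta> j = complex_of_real (exp (l * t)) * \<eta> j"
proof -
  have pow: "\<forall>i\<in>sites N. (lin_field N A \<epsilon> \<phi> ^^ k) \<eta> i = complex_of_real (l ^ k) * \<eta> i" for k
  proof (induction k)
    case (Suc k)
    show ?case
    proof
      fix i assume i: "i \<in> sites N"
      have "(lin_field N A \<epsilon> \<phi> ^^ Suc k) \<eta> i = lin_field N A \<epsilon> \<phi> (\<lambda>i. complex_of_real (l ^ k) * \<eta> i) i"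
        using lin_field_cong[of N "(lin_field N A \<epsilon> \<phi> ^^ k) \<eta>" "\<lambda>i. complex_of_real (l ^ k) * \<eta> i" i] Suc i by simp
      also have "\<dots> = complex_of_real (l ^ Suc k) * \<eta> i"
        unfolding lin_field_combo eig[OF i] by simp
      finally show "(lin_field N A \<epsilon> \<phi> ^^ Suc k) \<eta> i = complex_of_real (l ^ Suc k) * \<eta> i" .
    qed
  qed simp
  have "(\<lambda>k. complex_of_real ((l * t) ^ k /\<^sub>R fact k) * \<eta> j) sums (complex_of_real (exp (l * t)) * \<eta> j)"
    by (intro sums_mult2 sums_of_real exp_converges)
  then have "(\<lambda>k. complex_of_real (t ^ k / fact k) * (lin_field N A \<epsilon> \<phi> ^^ k) \<eta> j) sums (complex_of_real (exp (l * t)) * \<eta> j)"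
    using pow j by (simp add: power_mult_distrib field_simps)
  then show ?thesis using sums_unique2[OF lin_flow_sums[OF j]] by blast
qed

lemma lin_flow_cong:
  assumes "\<And>k. k \<in> sites N \<Longrightarrow> \<eta> k = \<zeta> k" and j: "j \<in> sites N"
  shows "lin_flow N A \<epsilon> \<phi> t \<eta> j = lin_flow N A \<epsilon> \<phi> t \<zeta> j"
proof -
  have "\<forall>i\<in>sites N. (lin_field N A \<epsilon> \<phi> ^^ k) \<eta> i = (lin_field N A \<epsilon> \<phi> ^^ k) \<zeta> i" for k
  proof (induction k)
    case (Suc k)
    then show ?case using lin_field_cong[of N "(lin_field N A \<epsilon> \<phi> ^^ k) \<eta>" "(lin_field N A \<epsilon> \<phi> ^^ k) \<zeta>"] by simp
  qed (use assms in simp)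
  then show ?thesis using j by (simp add: lin_flow_def)
qed

lemma lin_flow_zero: "j \<in> sites N \<Longrightarrow> lin_flow N A \<epsilon> \<phi> t (\<lambda>j. 0) j = 0"
  using lin_flow_eigenvector[of N A \<epsilon> \<phi> "\<lambda>j. 0" 0 j t] by (simp add: lin_field_zero)

lemma lin_flow_sum:
  assumes j: "j \<in> sites N"
  shows "finite I \<Longrightarrow> lin_flow N A \<epsilon> \<phi> t (\<lambda>j. \<Sum>b\<in>I. complex_of_real (c b) * \<eta> b j) j
     = (\<Sum>b\<in>I. complex_of_real (c b) * lin_flow N A \<epsilon> \<phi> t (\<eta> b) j)"
proof (induction I rule: finite_induct)
  case empty
  then show ?case by (simp add: lin_flow_zero[OF j])
next
  case (insert x F)
  have "lin_flow N A \<epsilon> \<phi> t (\<lambda>j. \<Sum>b\<in>insert x F. complex_of_real (c b) * \<eta> b j) j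
     = lin_flow N A \<epsilon> \<phi> t (\<lambda>j. (\<Sum>b\<in>F. complex_of_real (c b) * \<eta> b j) + complex_of_real (c x) * \<eta> x j) j"
    using insert.hyps by (simp add: add.commute)
  also have "\<dots> = (\<Sum>b\<in>insert x F. complex_of_real (c b) * lin_flow N A \<epsilon> \<phi> t (\<eta> b) j)"
    unfolding lin_flow_combo[OF j] insert.IH using insert.hyps by (simp add: add.commute)
  finally show ?case .
qed


definition basis :: "nat \<Rightarrow> nat \<Rightarrow> int \<Rightarrow> complex" where
  "basis N b k = (if k = coord_site N b then (if b < 2 * N + 1 then 1 else \<i>) else 0)"

lemma coord_site_in_sites: "coord_site N b \<in> sites N"
proof -
  define r where "r = b mod (2 * N + 1)"
  have "r < 2 * N + 1" unfolding r_def by (rule mod_less_divisor) simp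
  then show ?thesis unfolding coord_site_def r_def[symmetric] sites_def by auto
qed

lemma coord_basis:
  assumes "a < real_dim N" "b < real_dim N"
  shows "coord N a (basis N b) = (if a = b then 1 else 0)"
proof -
  have mod: "c mod (2 * N + 1) = (if c < 2 * N + 1 then c else c - (2 * N + 1))" if "c < real_dim N" for c
    using that by (auto simp: real_dim_def mod_if)
  show ?thesis
    using assms unfolding coord_def basis_def coord_site_def mod[OF assms(1)] mod[OF assms(2)]
    by (auto simp: real_dim_def split: if_splits)
qed

lemma basis_expansion:
  assumes k: "k \<in> sites N"
  shows "(\<Sum>b<real_dim N. complex_of_real (coord N b f) * basis N b k) = f k"
proof -
  let ?n = "2 * N + 1"
  define i where "i = nat (k + int N)"
  have i: "i < ?n" "int i - int N = k" using k by (auto simp: i_def sites_def)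
  have cs: "coord_site N b = k \<longleftrightarrow> b = i \<or> b = i + ?n" if "b < real_dim N" for b
  proof -
    have "b mod ?n = (if b < ?n then b else b - ?n)" using that by (auto simp: real_dim_def mod_if)
    then show ?thesis using i that unfolding coord_site_def real_dim_def by (auto split: if_splits)
  qed
  have "(\<Sum>b<real_dim N. complex_of_real (coord N b f) * basis N b k)
     = (\<Sum>b\<in>{i, i + ?n}. complex_of_real (coord N b f) * basis N b k)"
  proof (rule sum.mono_neutral_right)
    show "\<forall>b\<in>{..<real_dim N} - {i, i + ?n}. complex_of_real (coord N b f) * basis N b k = 0"
    proof
      fix b assume "b \<in> {..<real_dim N} - {i, i + ?n}"
      then have "coord_site N b \<noteq> k" using cs[of b] by simp
      then have "basis N b k = 0" by (auto simp: basis_def)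
      then show "complex_of_real (coord N b f) * basis N b k = 0" by simp
    qed
  qed (use i in \<open>auto simp: real_dim_def\<close>)
  also have "\<dots> = f k"
    using cs[of i] cs[of "i + ?n"] i by (simp add: basis_def coord_def real_dim_def complex_eq_iff)
  finally show ?thesis .
qed

lemma coord_sum: "coord N a (\<lambda>k. \<Sum>b\<in>I. complex_of_real (c b) * f b k) = (\<Sum>b\<in>I. c b * coord N a (f b))"
  by (simp add: coord_def)

lemma coord_cong: "(\<And>k. k \<in> sites N \<Longrightarrow> f k = g k) \<Longrightarrow> coord N a f = coord N a g"
  using coord_site_in_sites by (simp add: coord_def)

lemma coord_derivative:
  assumes "\<And>k. k \<in> sites N \<Longrightarrow> ((\<lambda>t. f t k) has_vector_derivative f' k) (at t)"
  shows "((\<lambda>t. coord N a (f t)) has_real_derivative coord N a f') (at t)"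
  using assms[OF coord_site_in_sites, of a]
  by (auto simp: coord_def has_real_derivative_iff_has_vector_derivative
      intro: bounded_linear.has_vector_derivative bounded_linear_Re bounded_linear_Im)

text \<open>The Jacobian of the original field is the linearization with \<open>A = - 1\<close>, since \<open>|\<psi>|^2 + 1\<close> is its local factor.\<close>

lemma field_jacobian_entry:
  assumes "a < real_dim N" "b < real_dim N"
  shows "field_jacobian N \<epsilon> \<psi> $$ (a, b) = coord N a (lin_field N (-1) \<epsilon> \<psi> (basis N b))"
proof -
  have shift: "coord_shift N b s \<psi> k = \<psi> k + complex_of_real s * basis N b k" for s k
    by (simp add: coord_shift_def basis_def)
  have rot: "coord N a (dnls_field N \<epsilon> x) = coord N a (rot_field N (-1) \<epsilon> x)" for x :: "int \<Rightarrow> complex"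
    by (rule coord_cong) (simp add: dnls_field_eq rot_field_def algebra_simps)
  have "((\<lambda>s. coord_shift N b s \<psi> k) has_vector_derivative basis N b k) (at 0)" for k
    unfolding shift by (auto intro!: derivative_eq_intros has_vector_derivative_real_field)
  then have "((\<lambda>s. coord N a (rot_field N (-1) \<epsilon> (coord_shift N b s \<psi>))) has_real_derivative
      coord N a (lin_field N (-1) \<epsilon> (coord_shift N b 0 \<psi>) (basis N b))) (at 0)"
    by (intro coord_derivative lin_field_is_derivative)
  moreover have "coord_shift N b 0 \<psi> = \<psi>" by (simp add: fun_eq_iff shift)
  ultimately have "deriv (\<lambda>s. coord N a (dnls_field N \<epsilon> (coord_shift N b s \<psi>))) 0
      = coord N a (lin_field N (-1) \<epsilon> \<psi> (basis N b))"
    unfolding rot by (simp add: DERIV_imp_deriv)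
  then show ?thesis using assms by (simp add: field_jacobian_def)
qed

text \<open>The columns are the linearized solutions in the rotating frame, rotated back.\<close>

definition fund_mat :: "nat \<Rightarrow> real \<Rightarrow> real \<Rightarrow> (int \<Rightarrow> complex) \<Rightarrow> real \<Rightarrow> real mat" where
  "fund_mat N A \<epsilon> \<phi> t = mat (real_dim N) (real_dim N)
     (\<lambda>(a, b). coord N a (\<lambda>k. exp (- \<i> * complex_of_real ((1 + A) * t)) * lin_flow N A \<epsilon> \<phi> t (basis N b) k))"

text \<open>Gauge invariance: the linearization at a rotated state is the rotated linearization, and passing to the rotating frame subtracts the
  generator of the rotation.\<close>

lemma lin_field_rotate:
  assumes "cmod z = 1"
  shows "lin_field N (-1) \<epsilon> (\<lambda>k. z * \<phi> k) (\<lambda>k. z * \<eta> k) j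
     = z * (lin_field N A \<epsilon> \<phi> \<eta> j - \<i> * complex_of_real (1 + A) * \<eta> j)"
proof -
  have zz: "z\<^sup>2 * cnj z = z" using complex_norm_square[of z] assms by (simp add: power2_eq_square)
  have "(z * \<phi> j)\<^sup>2 * cnj (z * \<eta> j) = (z\<^sup>2 * cnj z) * ((\<phi> j)\<^sup>2 * cnj (\<eta> j))" by (simp add: power_mult_distrib)
  then have sq: "(z * \<phi> j)\<^sup>2 * cnj (z * \<eta> j) = z * ((\<phi> j)\<^sup>2 * cnj (\<eta> j))" unfolding zz .
  have m: "cmod (z * \<phi> j) = cmod (\<phi> j)" using assms by (simp add: norm_mult)
  have l: "lap N (\<lambda>k. z * \<eta> k) j = z * lap N \<eta> j" by (simp add: lap_def algebra_simps)
  show ?thesis unfolding lin_field_def sq m l by (simp add: algebra_simps)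
qed

lemma fundamental_matrix_fund:
  assumes \<psi>: "\<And>t k. k \<in> sites N \<Longrightarrow> \<psi> t k = exp (- \<i> * complex_of_real ((1 + A) * t)) * \<phi> k"
  shows "fundamental_matrix N \<epsilon> \<psi> (fund_mat N A \<epsilon> \<phi>)"
  unfolding fundamental_matrix_def
proof (intro conjI allI impI)
  define E where "E t = exp (- \<i> * complex_of_real ((1 + A) * t))" for t
  have E1: "cmod (E t) = 1" for t by (simp add: E_def)
  show "fund_mat N A \<epsilon> \<phi> 0 = 1\<^sub>m (real_dim N)"
  proof (rule eq_matI)
    fix a b assume ab: "a < dim_row (1\<^sub>m (real_dim N))" "b < dim_col (1\<^sub>m (real_dim N))"
    have "coord N a (\<lambda>k. exp (- \<i> * complex_of_real ((1 + A) * 0)) * lin_flow N A \<epsilon> \<phi> 0 (basis N b) k) = coord N a (basis N b)"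
      by (rule coord_cong) (simp add: lin_flow_0)
    then show "fund_mat N A \<epsilon> \<phi> 0 $$ (a, b) = 1\<^sub>m (real_dim N) $$ (a, b)"
      using ab coord_basis by (simp add: fund_mat_def)
  qed (simp_all add: fund_mat_def)
  show "fund_mat N A \<epsilon> \<phi> t \<in> carrier_mat (real_dim N) (real_dim N)" for t by (simp add: fund_mat_def)
  fix t a b assume a: "a < real_dim N" and b: "b < real_dim N"
  define y where "y s k = E s * lin_flow N A \<epsilon> \<phi> s (basis N b) k" for s k
  have DE: "(E has_vector_derivative - \<i> * complex_of_real (1 + A) * E t) (at t)"
    unfolding E_def[abs_def]
    by (auto intro!: derivative_eq_intros has_vector_derivative_real_field simp: algebra_simps)
  have Dy: "((\<lambda>s. y s k) has_vector_derivative lin_field N (-1) \<epsilon> (\<lambda>k. E t * \<phi> k) (y t) k) (at t)" if k: "k \<in> sites N" for k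
  proof -
    have "((\<lambda>s. y s k) has_vector_derivative
      (E t * lin_field N A \<epsilon> \<phi> (lin_flow N A \<epsilon> \<phi> t (basis N b)) k + - \<i> * complex_of_real (1 + A) * E t * lin_flow N A \<epsilon> \<phi> t (basis N b) k)) (at t)"
      unfolding y_def by (rule has_vector_derivative_mult[OF DE lin_flow_derivative[OF k]])
    moreover have "lin_field N (-1) \<epsilon> (\<lambda>k. E t * \<phi> k) (y t) k
       = E t * lin_field N A \<epsilon> \<phi> (lin_flow N A \<epsilon> \<phi> t (basis N b)) k + - \<i> * complex_of_real (1 + A) * E t * lin_flow N A \<epsilon> \<phi> t (basis N b) k"
      unfolding y_def[abs_def] lin_field_rotate[OF E1[of t], where A = A] by (simp add: algebra_simps)
    ultimately show ?thesis by simp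
  qed
  have jac: "(field_jacobian N \<epsilon> (\<psi> t) * fund_mat N A \<epsilon> \<phi> t) $$ (a, b) = coord N a (lin_field N (-1) \<epsilon> (\<lambda>k. E t * \<phi> k) (y t))"
  proof -
    have fe: "fund_mat N A \<epsilon> \<phi> t $$ (c, b) = coord N c (y t)" if "c < real_dim N" for c
      using that b by (simp add: fund_mat_def y_def[abs_def] E_def)
    have "(field_jacobian N \<epsilon> (\<psi> t) * fund_mat N A \<epsilon> \<phi> t) $$ (a, b)
       = (\<Sum>c<real_dim N. field_jacobian N \<epsilon> (\<psi> t) $$ (a, c) * fund_mat N A \<epsilon> \<phi> t $$ (c, b))"
      using a b by (simp add: times_mat_def scalar_prod_def field_jacobian_def fund_mat_def atLeast0LessThan)
    also have "\<dots> = (\<Sum>c<real_dim N. coord N c (y t) * coord N a (lin_field N (-1) \<epsilon> (\<psi> t) (basis N c)))"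
      by (rule sum.cong) (simp_all add: field_jacobian_entry[OF a] fe mult.commute)
    also have "\<dots> = coord N a (\<lambda>k. \<Sum>c<real_dim N. complex_of_real (coord N c (y t)) * lin_field N (-1) \<epsilon> (\<psi> t) (basis N c) k)"
      by (rule coord_sum[symmetric])
    also have "\<dots> = coord N a (lin_field N (-1) \<epsilon> (\<psi> t) (\<lambda>k. \<Sum>c<real_dim N. complex_of_real (coord N c (y t)) * basis N c k))"
      by (rule coord_cong) (subst lin_field_sum, simp_all)
    also have "\<dots> = coord N a (lin_field N (-1) \<epsilon> (\<psi> t) (y t))"
      by (rule coord_cong, rule lin_field_cong, rule basis_expansion)
    also have "\<dots> = coord N a (lin_field N (-1) \<epsilon> (\<lambda>k. E t * \<phi> k) (y t))"
      by (rule coord_cong) (simp add: lin_field_def \<psi> E_def)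
    finally show ?thesis .
  qed
  have "((\<lambda>s. coord N a (y s)) has_real_derivative coord N a (lin_field N (-1) \<epsilon> (\<lambda>k. E t * \<phi> k) (y t))) (at t)"
    by (rule coord_derivative[OF Dy])
  then show "((\<lambda>s. fund_mat N A \<epsilon> \<phi> s $$ (a, b)) has_real_derivative (field_jacobian N \<epsilon> (\<psi> t) * fund_mat N A \<epsilon> \<phi> t) $$ (a, b)) (at t)"
    unfolding jac using a b by (simp add: fund_mat_def y_def[abs_def] E_def)
qed

lemma fund_mult_vec:
  assumes a: "a < real_dim N" and T: "exp (- \<i> * complex_of_real ((1 + A) * T)) = 1"
  shows "(\<Sum>b<real_dim N. fund_mat N A \<epsilon> \<phi> T $$ (a, b) * v b)
     = coord N a (lin_flow N A \<epsilon> \<phi> T (\<lambda>k. \<Sum>b<real_dim N. complex_of_real (v b) * basis N b k))"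
proof -
  have "(\<Sum>b<real_dim N. fund_mat N A \<epsilon> \<phi> T $$ (a, b) * v b) = (\<Sum>b<real_dim N. v b * coord N a (lin_flow N A \<epsilon> \<phi> T (basis N b)))"
  proof (rule sum.cong)
    fix b assume "b \<in> {..<real_dim N}"
    then have "fund_mat N A \<epsilon> \<phi> T $$ (a, b) = coord N a (\<lambda>k. exp (- \<i> * complex_of_real ((1 + A) * T)) * lin_flow N A \<epsilon> \<phi> T (basis N b) k)"
      using a by (simp add: fund_mat_def)
    then show "fund_mat N A \<epsilon> \<phi> T $$ (a, b) * v b = v b * coord N a (lin_flow N A \<epsilon> \<phi> T (basis N b))"
      unfolding T by (simp add: mult.commute)
  qed simp
  also have "\<dots> = coord N a (\<lambda>k. \<Sum>b<real_dim N. complex_of_real (v b) * lin_flow N A \<epsilon> \<phi> T (basis N b) k)"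
    by (rule coord_sum[symmetric])
  also have "\<dots> = coord N a (lin_flow N A \<epsilon> \<phi> T (\<lambda>k. \<Sum>b<real_dim N. complex_of_real (v b) * basis N b k))"
    by (rule coord_cong) (simp add: lin_flow_sum)
  finally show ?thesis .
qed

section \<open>Floquet multipliers of a standing wave\<close>

lemma DERIV_lap:
  assumes "\<And>k. k \<in> sites N \<Longrightarrow> ((\<lambda>t. f t k) has_real_derivative f' k) (at t)" "j \<in> sites N"
  shows "((\<lambda>t. lap N (f t) j) has_real_derivative lap N f' j) (at t)"
  unfolding lap_def using assms(2)
  by (auto intro!: derivative_eq_intros assms(1))

lemma DERIV_ip:
  assumes "\<And>k. k \<in> sites N \<Longrightarrow> ((\<lambda>t. f t k) has_real_derivative f' k) (at t)"
    "\<And>k. k \<in> sites N \<Longrightarrow> ((\<lambda>t. g t k) has_real_derivative g' k) (at t)"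
  shows "((\<lambda>t. ip N (f t) (g t)) has_real_derivative ip N f' (g t) + ip N (f t) g') (at t)"
  unfolding ip_def sum.distrib[symmetric]
  by (rule DERIV_sum) (auto intro!: derivative_eq_intros assms)

lemma DERIV_Lplus:
  assumes "\<And>k. k \<in> sites N \<Longrightarrow> ((\<lambda>t. f t k) has_real_derivative f' k) (at t)" "j \<in> sites N"
  shows "((\<lambda>t. Lplus N e u (f t) j) has_real_derivative Lplus N e u f' j) (at t)"
  unfolding Lplus_def using assms by (intro DERIV_add DERIV_cmult DERIV_lap)

lemma DERIV_Lminus:
  assumes "\<And>k. k \<in> sites N \<Longrightarrow> ((\<lambda>t. f t k) has_real_derivative f' k) (at t)" "j \<in> sites N"
  shows "((\<lambda>t. Lminus N e u (f t) j) has_real_derivative Lminus N e u f' j) (at t)"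
  unfolding Lminus_def using assms by (intro DERIV_add DERIV_cmult DERIV_lap)

lemma DERIV_kin:
  assumes D: "\<And>k. k \<in> sites N \<Longrightarrow> ((\<lambda>t. f t k) has_real_derivative f' k) (at t)"
  shows "((\<lambda>t. kin N e u (f t) (f t)) has_real_derivative 2 * kin N e u f' (f t)) (at t)"
proof -
  note Dp = DERIV_Lplus[OF D] and Dmp = DERIV_Lminus[OF DERIV_Lplus[OF D]]
  have "((\<lambda>t. kin N e u (f t) (f t)) has_real_derivative kin N e u f' (f t) + kin N e u (f t) f') (at t)"
    unfolding kin_def
    by (rule DERIV_cong[OF DERIV_diff[OF DERIV_cmult[OF DERIV_ip[OF D Dp]] DERIV_ip[OF Dp Dmp]]])
       (simp_all add: algebra_simps)
  then show ?thesis using kin_commute[of N e u "f t" f'] by simp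
qed

lemma DERIV_pot:
  assumes D: "\<And>k. k \<in> sites N \<Longrightarrow> ((\<lambda>t. f t k) has_real_derivative f' k) (at t)"
  shows "((\<lambda>t. pot N e u (f t) (f t)) has_real_derivative 2 * pot N e u f' (f t)) (at t)"
proof -
  note Dm = DERIV_Lminus[OF D] and Dpm = DERIV_Lplus[OF DERIV_Lminus[OF D]]
  have "((\<lambda>t. pot N e u (f t) (f t)) has_real_derivative pot N e u f' (f t) + pot N e u (f t) f') (at t)"
    unfolding pot_def
    by (rule DERIV_cong[OF DERIV_diff[OF DERIV_cmult[OF DERIV_ip[OF D Dm]] DERIV_ip[OF Dm Dpm]]])
       (simp_all add: algebra_simps)
  then show ?thesis using pot_commute[of N e u "f t" f'] by simp
qed

lemma coord_eqI:
  assumes "\<And>a. a < real_dim N \<Longrightarrow> coord N a f = coord N a g" "k \<in> sites N"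
  shows "f k = g k"
  using basis_expansion[OF assms(2), of f] basis_expansion[OF assms(2), of g] assms(1) by simp

text \<open>The standing wave \<open>\<phi>\<close> is the real wave \<open>u\<close> times the constant phase \<open>c\<close>. The functions \<open>re\<close> and \<open>im\<close> split a perturbation into its amplitude
  and its phase part relative to \<open>c\<close>.\<close>

locale linearization = wave N "\<epsilon> / A" u \<sigma> for N \<epsilon> A u \<sigma> +
  fixes \<phi> :: "int \<Rightarrow> complex" and c :: complex
  assumes A: "A > 0" and c: "cmod c = 1"
    and \<phi>: "\<And>k. k \<in> sites N \<Longrightarrow> \<phi> k = complex_of_real (sqrt A * u k) * c"
begin

abbreviation "B \<equiv> lin_field N A \<epsilon> \<phi>"
abbreviation "flow \<equiv> lin_flow N A \<epsilon> \<phi>"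

definition re :: "(int \<Rightarrow> complex) \<Rightarrow> int \<Rightarrow> real" where "re \<eta> k = Re (cnj c * \<eta> k)"
definition im :: "(int \<Rightarrow> complex) \<Rightarrow> int \<Rightarrow> real" where "im \<eta> k = Im (cnj c * \<eta> k)"

lemma cc: "cnj c * c = 1"
  using complex_norm_square[of c] c by (simp add: mult.commute)

lemma lin_field_split:
  assumes j: "j \<in> sites N"
  shows "cnj c * B \<eta> j = Complex (A * Lm (im \<eta>) j) (- A * Lp (re \<eta>) j)"
proof -
  define \<zeta> where "\<zeta> k = cnj c * \<eta> k" for k
  have \<eta>: "\<eta> = (\<lambda>k. c * \<zeta> k)"
    using cc by (simp add: \<zeta>_def fun_eq_iff mult.assoc[symmetric] mult.commute[of c])
  have sq: "(cmod (\<phi> j))\<^sup>2 = A * (u j)\<^sup>2" using A c \<phi>[OF j] by (simp add: norm_mult power_mult_distrib)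
  have "(\<phi> j)\<^sup>2 * cnj (c * \<zeta> j) = complex_of_real ((sqrt A * u j)\<^sup>2) * (cnj c * c) * c * cnj (\<zeta> j)"
    by (simp add: \<phi>[OF j] power_mult_distrib power2_eq_square)
  also have "(sqrt A * u j)\<^sup>2 = A * (u j)\<^sup>2" using A by (simp add: power_mult_distrib)
  finally have sq': "(\<phi> j)\<^sup>2 * cnj (c * \<zeta> j) = c * (complex_of_real (A * (u j)\<^sup>2) * cnj (\<zeta> j))"
    unfolding cc by (simp add: mult_ac)
  have "B \<eta> j = - \<i> * (complex_of_real (2 * (A * (u j)\<^sup>2) - A) * (c * \<zeta> j)
      + c * (complex_of_real (A * (u j)\<^sup>2) * cnj (\<zeta> j)) + complex_of_real \<epsilon> * (c * lap N \<zeta> j))"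
    unfolding lin_field_def \<eta> sq sq' by (simp add: lap_def algebra_simps)
  also have "\<dots> = c * (- \<i> * (complex_of_real (2 * (A * (u j)\<^sup>2) - A) * \<zeta> j
      + complex_of_real (A * (u j)\<^sup>2) * cnj (\<zeta> j) + complex_of_real \<epsilon> * lap N \<zeta> j))" (is "_ = c * ?r")
    by (simp add: algebra_simps)
  finally have "cnj c * B \<eta> j = ?r" using cc by (metis mult.assoc mult_1)
  also have "?r = Complex (A * Lm (im \<eta>) j) (- A * Lp (re \<eta>) j)"
    using A by (simp add: complex_eq_iff Lminus_def Lplus_def re_def im_def \<zeta>_def[symmetric] lap_def algebra_simps)
  finally show ?thesis .
qed

definition energy :: "(int \<Rightarrow> complex) \<Rightarrow> real" where
  "energy \<eta> = kin N (\<epsilon> / A) u (re \<eta>) (re \<eta>) + pot N (\<epsilon> / A) u (im \<eta>) (im \<eta>)"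

lemma energy_conserved: "energy (flow t \<eta>) = energy \<eta>"
proof -
  have D: "((\<lambda>s. re (flow s \<eta>) k) has_real_derivative A * Lm (im (flow t \<eta>)) k) (at t)"
    "((\<lambda>s. im (flow s \<eta>) k) has_real_derivative - A * Lp (re (flow t \<eta>)) k) (at t)" if k: "k \<in> sites N" for t k
  proof -
    have "((\<lambda>s. cnj c * flow s \<eta> k) has_vector_derivative Complex (A * Lm (im (flow t \<eta>)) k) (- A * Lp (re (flow t \<eta>)) k)) (at t)"
      using has_vector_derivative_mult_right[OF lin_flow_derivative[OF k, where A = A and \<epsilon> = \<epsilon> and \<phi> = \<phi> and \<eta> = \<eta> and t = t], of "cnj c"]
      unfolding lin_field_split[OF k] .
    then have "((\<lambda>s. Re (cnj c * flow s \<eta> k)) has_vector_derivative Re (Complex (A * Lm (im (flow t \<eta>)) k) (- A * Lp (re (flow t \<eta>)) k))) (at t)"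
      "((\<lambda>s. Im (cnj c * flow s \<eta> k)) has_vector_derivative Im (Complex (A * Lm (im (flow t \<eta>)) k) (- A * Lp (re (flow t \<eta>)) k))) (at t)"
      by (rule bounded_linear.has_vector_derivative[OF bounded_linear_Re] bounded_linear.has_vector_derivative[OF bounded_linear_Im])+
    then show "((\<lambda>s. re (flow s \<eta>) k) has_real_derivative A * Lm (im (flow t \<eta>)) k) (at t)"
      "((\<lambda>s. im (flow s \<eta>) k) has_real_derivative - A * Lp (re (flow t \<eta>)) k) (at t)"
      by (simp_all add: re_def im_def has_real_derivative_iff_has_vector_derivative)
  qed
  have scale: "kin N (\<epsilon> / A) u (\<lambda>k. x * f k) h = x * kin N (\<epsilon> / A) u f h"
    "pot N (\<epsilon> / A) u (\<lambda>k. x * f k) h = x * pot N (\<epsilon> / A) u f h" for x f h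
    using kin_add[of N "\<epsilon> / A" u "\<lambda>k. 0" x f h] kin_add[of N "\<epsilon> / A" u "\<lambda>k. 0" "-1" "\<lambda>k. 0" h]
      pot_add[of N "\<epsilon> / A" u "\<lambda>k. 0" x f h] pot_add[of N "\<epsilon> / A" u "\<lambda>k. 0" "-1" "\<lambda>k. 0" h] by simp_all
  have "((\<lambda>s. energy (flow s \<eta>)) has_real_derivative 0) (at t)" for t
  proof -
    let ?a = "re (flow t \<eta>)" and ?b = "im (flow t \<eta>)"
    have "((\<lambda>s. energy (flow s \<eta>)) has_real_derivative
       2 * kin N (\<epsilon> / A) u (\<lambda>k. A * Lm ?b k) ?a + 2 * pot N (\<epsilon> / A) u (\<lambda>k. - A * Lp ?a k) ?b) (at t)"
      unfolding energy_def by (intro DERIV_add DERIV_kin DERIV_pot D)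
    moreover have "kin N (\<epsilon> / A) u (\<lambda>k. A * Lm ?b k) ?a = A * pot N (\<epsilon> / A) u ?b (Lp ?a)"
      unfolding scale kin_Lminus ..
    moreover have "pot N (\<epsilon> / A) u (\<lambda>k. - A * Lp ?a k) ?b = - A * pot N (\<epsilon> / A) u ?b (Lp ?a)"
      unfolding scale(2) by (subst pot_commute) simp
    ultimately show ?thesis by simp
  qed
  then have "energy (flow t \<eta>) = energy (flow 0 \<eta>)"
    by (rule DERIV_isconst_all[rule_format, rotated -1, where x = t and y = 0])
  also have "\<dots> = energy \<eta>"
    unfolding energy_def
    by (intro arg_cong2[where f = "(+)"] kin_cong pot_cong) (simp_all add: re_def im_def lin_flow_0)
  finally show ?thesis .
qed

lemma energy_cong: "(\<And>k. k \<in> sites N \<Longrightarrow> \<eta> k = \<zeta> k) \<Longrightarrow> energy \<eta> = energy \<zeta>"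
  unfolding energy_def by (intro arg_cong2[where f = "(+)"] kin_cong pot_cong) (simp_all add: re_def im_def)

text \<open>For a complex eigenvector \<open>X + i Y\<close> with multiplier \<open>p + i q\<close> the monodromy acts on the pair \<open>(X, Y)\<close> in this way, so that energy
  conservation forces \<open>p^2 + q^2 = 1\<close> unless the energies of \<open>X\<close> and \<open>Y\<close> add up to zero.\<close>

lemma energy_rotate:
  "energy (\<lambda>k. complex_of_real p * \<eta> k - complex_of_real q * \<zeta> k)
     + energy (\<lambda>k. complex_of_real q * \<eta> k + complex_of_real p * \<zeta> k) = (p\<^sup>2 + q\<^sup>2) * (energy \<eta> + energy \<zeta>)"
proof -
  have combo: "F (\<lambda>k. p * f k + q * g k) (\<lambda>k. p * f k + q * g k) = p\<^sup>2 * F f f + 2 * p * q * F f g + q\<^sup>2 * F g g"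
    if add: "\<And>f c g h. F (\<lambda>k. f k + c * g k) h = F f h + c * F g h" and comm: "\<And>f g. F f g = F g f"
    for F :: "(int \<Rightarrow> real) \<Rightarrow> (int \<Rightarrow> real) \<Rightarrow> real" and f g p q
  proof -
    have 0: "F (\<lambda>k. 0) h = 0" for h using add[of "\<lambda>k. 0" "-1" "\<lambda>k. 0" h] by simp
    have scale: "F (\<lambda>k. x * f k) h = x * F f h" for x f h using add[of "\<lambda>k. 0" x f h] 0 by simp
    have l: "F (\<lambda>k. p * f k + q * g k) h = p * F f h + q * F g h" for h
      unfolding add scale ..
    show ?thesis unfolding l comm[of f "\<lambda>k. p * f k + q * g k"] comm[of g "\<lambda>k. p * f k + q * g k"]
      by (simp add: comm[of g f] power2_eq_square algebra_simps)
  qed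
  note K = combo[of "kin N (\<epsilon> / A) u", OF kin_add kin_commute] and V = combo[of "pot N (\<epsilon> / A) u", OF pot_add pot_commute]
  have re: "re (\<lambda>k. complex_of_real p * \<eta> k + complex_of_real q * \<zeta> k) = (\<lambda>k. p * re \<eta> k + q * re \<zeta> k)"
    and im: "im (\<lambda>k. complex_of_real p * \<eta> k + complex_of_real q * \<zeta> k) = (\<lambda>k. p * im \<eta> k + q * im \<zeta> k)" for p q
    by (simp_all add: fun_eq_iff re_def im_def algebra_simps)
  have minus: "(\<lambda>k. complex_of_real p * \<eta> k - complex_of_real q * \<zeta> k) = (\<lambda>k. complex_of_real p * \<eta> k + complex_of_real (- q) * \<zeta> k)"
    by simp
  show ?thesis unfolding minus energy_def re im K V by (simp add: algebra_simps power2_eq_square)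
qed

lemma monodromy:
  assumes \<psi>: "\<And>t k. k \<in> sites N \<Longrightarrow> \<psi> t k = exp (- \<i> * complex_of_real ((1 + A) * t)) * \<phi> k"
  shows "monodromy_matrix N \<epsilon> T \<psi> (fund_mat N A \<epsilon> \<phi> T)"
  unfolding monodromy_matrix_def using fundamental_matrix_fund[of N \<psi> A \<phi> \<epsilon>] \<psi> by blast

lemma map_fund_mult:
  assumes "v \<in> carrier_vec (real_dim N)" "a < real_dim N"
  shows "(map_mat complex_of_real (fund_mat N A \<epsilon> \<phi> T) *\<^sub>v v) $ a
     = (\<Sum>b<real_dim N. complex_of_real (fund_mat N A \<epsilon> \<phi> T $$ (a, b)) * v $ b)"
  using assms by (simp add: fund_mat_def scalar_prod_def atLeast0LessThan)

text \<open>An eigenvector with multiplier off the unit circle has zero energy. By positivity its real and imaginary parts are then phase directions, which the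
  flow fixes, so that the multiplier is 1.\<close>

lemma stable:
  assumes s: "\<sigma> (-2) = 1" "\<sigma> 1 = -1" and T: "exp (- \<i> * complex_of_real ((1 + A) * T)) = 1"
    and \<psi>: "\<And>t k. k \<in> sites N \<Longrightarrow> \<psi> t k = exp (- \<i> * complex_of_real ((1 + A) * t)) * \<phi> k"
  shows "linearly_stable N \<epsilon> T \<psi>"
  unfolding linearly_stable_def
proof (intro exI[of _ "fund_mat N A \<epsilon> \<phi> T"] conjI allI impI monodromy \<psi>)
  fix \<mu> assume "floquet_multiplier (fund_mat N A \<epsilon> \<phi> T) \<mu>"
  then obtain v where v: "v \<in> carrier_vec (real_dim N)" "v \<noteq> 0\<^sub>v (real_dim N)"
    "map_mat complex_of_real (fund_mat N A \<epsilon> \<phi> T) *\<^sub>v v = \<mu> \<cdot>\<^sub>v v"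
    by (auto simp: floquet_multiplier_def eigenvalue_def eigenvector_def fund_mat_def)
  define x y where "x b = Re (v $ b)" and "y b = Im (v $ b)" for b
  define X Y where "X = (\<lambda>k. \<Sum>b<real_dim N. complex_of_real (x b) * basis N b k)"
    and "Y = (\<lambda>k. \<Sum>b<real_dim N. complex_of_real (y b) * basis N b k)"
  have delta: "(\<Sum>b<real_dim N. w b * coord N a (basis N b)) = w a" if "a < real_dim N" for w and a
  proof -
    have "(\<Sum>b<real_dim N. w b * coord N a (basis N b)) = (\<Sum>b<real_dim N. if b = a then w b else 0)"
      by (rule sum.cong) (use that coord_basis in auto)
    then show ?thesis using that by simp
  qed
  have cX: "coord N a X = x a" "coord N a Y = y a" if "a < real_dim N" for a
    unfolding X_def Y_def coord_sum delta[OF that] by (rule refl)+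
  have eq: "(\<Sum>b<real_dim N. complex_of_real (fund_mat N A \<epsilon> \<phi> T $$ (a, b)) * v $ b) = \<mu> * v $ a" if "a < real_dim N" for a
    using map_fund_mult[OF v(1) that, of T] v that by simp
  have fX: "coord N a (flow T X) = Re \<mu> * x a - Im \<mu> * y a" if a: "a < real_dim N" for a
    using arg_cong[OF eq[OF a], of Re] fund_mult_vec[OF a T, of \<epsilon> \<phi> x] by (simp add: x_def y_def X_def)
  have fY: "coord N a (flow T Y) = Im \<mu> * x a + Re \<mu> * y a" if a: "a < real_dim N" for a
    using arg_cong[OF eq[OF a], of Im] fund_mult_vec[OF a T, of \<epsilon> \<phi> y] by (simp add: x_def y_def Y_def add.commute)
  have coord_lin: "coord N a (\<lambda>k. complex_of_real p * f k - complex_of_real q * g k) = p * coord N a f - q * coord N a g"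
    "coord N a (\<lambda>k. complex_of_real p * f k + complex_of_real q * g k) = p * coord N a f + q * coord N a g" for a p q f g
    by (simp_all add: coord_def)
  have FX: "flow T X k = complex_of_real (Re \<mu>) * X k - complex_of_real (Im \<mu>) * Y k" if "k \<in> sites N" for k
    by (rule coord_eqI[OF _ that]) (simp add: coord_lin fX cX)
  have FY: "flow T Y k = complex_of_real (Im \<mu>) * X k + complex_of_real (Re \<mu>) * Y k" if "k \<in> sites N" for k
    by (rule coord_eqI[OF _ that]) (simp add: coord_lin fY cX)
  have E: "((Re \<mu>)\<^sup>2 + (Im \<mu>)\<^sup>2) * (energy X + energy Y) = energy X + energy Y"
  proof -
    have "energy (flow T X) = energy (\<lambda>k. complex_of_real (Re \<mu>) * X k - complex_of_real (Im \<mu>) * Y k)"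
      by (rule energy_cong) (rule FX)
    moreover have "energy (flow T Y) = energy (\<lambda>k. complex_of_real (Im \<mu>) * X k + complex_of_real (Re \<mu>) * Y k)"
      by (rule energy_cong) (rule FY)
    ultimately show ?thesis
      using energy_rotate[of "Re \<mu>" X "Im \<mu>" Y] unfolding energy_conserved by linarith
  qed
  have nonneg: "0 \<le> kin N (\<epsilon> / A) u (re \<eta>) (re \<eta>)" "0 \<le> pot N (\<epsilon> / A) u (im \<eta>) (im \<eta>)" for \<eta>
    using kin_positive[of "re \<eta>"] ip_self_nonneg[of N "re \<eta>"] pot_stable(1)[OF s] by auto
  have null: "flow T \<eta> k = \<eta> k" if 0: "energy \<eta> = 0" and k: "k \<in> sites N" for \<eta> k
  proof -
    have z: "kin N (\<epsilon> / A) u (re \<eta>) (re \<eta>) = 0" "pot N (\<epsilon> / A) u (im \<eta>) (im \<eta>) = 0"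
      using 0 nonneg[of \<eta>] unfolding energy_def by linarith+
    have re0: "re \<eta> k = 0" if "k \<in> sites N" for k
      using kin_positive_strict[of "re \<eta>"] z that by force
    obtain \<beta> where \<beta>: "\<forall>j\<in>sites N. im \<eta> j = \<beta> * u j" using pot_stable(2)[OF s z(2)] by blast
    have "B \<eta> j = complex_of_real 0 * \<eta> j" if j: "j \<in> sites N" for j
    proof -
      have "Lp (re \<eta>) j = Lp (\<lambda>j. 0) j" by (rule Lplus_cong) (use re0 j in auto)
      moreover have "Lm (im \<eta>) j = Lm (\<lambda>j. \<beta> * u j) j" by (rule Lminus_cong) (use \<beta> j in auto)
      moreover have "Lm (\<lambda>j. \<beta> * u j) j = \<beta> * (((u j)\<^sup>2 - 1) * u j + \<epsilon> / A * lap N u j)"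
        by (simp add: Lminus_def lap_def algebra_simps)
      ultimately have "cnj c * B \<eta> j = 0"
        using rw j unfolding lin_field_split[OF j] by (simp add: real_wave_def Lplus_def lap_def complex_eq_iff)
      then show ?thesis using cc by auto
    qed
    then show ?thesis using lin_flow_eigenvector[of N A \<epsilon> \<phi> \<eta> 0 k T] k by simp
  qed
  show "cmod \<mu> = 1"
  proof (rule ccontr)
    assume ne: "cmod \<mu> \<noteq> 1"
    then have "(Re \<mu>)\<^sup>2 + (Im \<mu>)\<^sup>2 \<noteq> 1" by (simp add: cmod_def)
    then have "energy X + energy Y = 0" using E by simp
    moreover have "0 \<le> energy X" "0 \<le> energy Y" using nonneg by (simp_all add: energy_def)
    ultimately have "energy X = 0" "energy Y = 0" by linarith+
    then have "flow T X k = X k" "flow T Y k = Y k" if "k \<in> sites N" for k using null that by blast+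
    then have "coord N a (flow T X) = x a" "coord N a (flow T Y) = y a" if "a < real_dim N" for a
      using coord_cong[of N "flow T X" X a] coord_cong[of N "flow T Y" Y a] cX that by auto
    then have "\<mu> * v $ a = v $ a" if "a < real_dim N" for a
      using fX[OF that] fY[OF that] that by (simp add: complex_eq_iff x_def y_def algebra_simps)
    moreover obtain a where "a < real_dim N" "v $ a \<noteq> 0"
      using v(1,2) by (metis carrier_vecD eq_vecI index_zero_vec(1) index_zero_vec(2))
    ultimately have "\<mu> = 1" by auto
    then show False using ne by simp
  qed
qed

text \<open>With \<open>Lm Lp a = - m a\<close> and \<open>l = sqrt m\<close> the function with amplitude part \<open>a\<close> and phase part \<open>- Lp a / l\<close> grows at the rate \<open>A l\<close>.\<close>

lemma unstable:
  assumes neg: "\<exists>b. pot N (\<epsilon> / A) u b b < 0" and T: "exp (- \<i> * complex_of_real ((1 + A) * T)) = 1" "T > 0"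
    and \<psi>: "\<And>t k. k \<in> sites N \<Longrightarrow> \<psi> t k = exp (- \<i> * complex_of_real ((1 + A) * t)) * \<phi> k"
  shows "linearly_unstable N \<epsilon> T \<psi>"
proof -
  obtain m a where m: "m > 0" and a: "\<exists>j\<in>sites N. a j \<noteq> 0" "\<forall>j\<in>sites N. Lm (Lp a) j = - m * a j"
    using negative_direction_gives_eigenvector neg by blast
  define l where "l = sqrt m"
  have l: "l > 0" "l * l = m" using m by (simp_all add: l_def)
  define b where "b j = - Lp a j / l" for j
  have Lmb: "Lm b j = l * a j" if j: "j \<in> sites N" for j
  proof -
    have scale: "Lm (\<lambda>j. x * f j) j = x * Lm f j" for x f by (simp add: Lminus_def lap_def algebra_simps)
    have b: "b = (\<lambda>j. (- 1 / l) * Lp a j)" by (simp add: b_def fun_eq_iff)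
    have "Lm b j = (- 1 / l) * Lm (Lp a) j" unfolding b by (rule scale)
    then have "Lm b j = - Lm (Lp a) j / l" by simp
    also have "\<dots> = l * a j" using a(2) j l by (simp add: field_simps)
    finally show ?thesis .
  qed
  define \<eta> where "\<eta> k = c * Complex (a k) (b k)" for k
  have c\<eta>: "cnj c * \<eta> k = Complex (a k) (b k)" for k
    using cc by (simp add: \<eta>_def mult.assoc[symmetric])
  then have ab: "re \<eta> = a" "im \<eta> = b" by (simp_all add: fun_eq_iff re_def im_def)
  have eig: "B \<eta> j = complex_of_real (A * l) * \<eta> j" if j: "j \<in> sites N" for j
  proof -
    have "cnj c * B \<eta> j = complex_of_real (A * l) * (cnj c * \<eta> j)"
      unfolding lin_field_split[OF j] ab c\<eta> using Lmb[OF j] l by (simp add: complex_eq_iff b_def)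
    then have "cnj c * (B \<eta> j - complex_of_real (A * l) * \<eta> j) = 0" by (simp add: algebra_simps)
    then show ?thesis using cc by auto
  qed
  define g where "g = exp (A * l * T)"
  have g: "g > 1" using A l T by (simp add: g_def)
  have fl: "flow T \<eta> k = complex_of_real g * \<eta> k" if "k \<in> sites N" for k
    unfolding g_def by (rule lin_flow_eigenvector[OF eig that])
  define v where "v = vec (real_dim N) (\<lambda>a. complex_of_real (coord N a \<eta>))"
  have vc: "v \<in> carrier_vec (real_dim N)" by (simp add: v_def)
  have "map_mat complex_of_real (fund_mat N A \<epsilon> \<phi> T) *\<^sub>v v = complex_of_real g \<cdot>\<^sub>v v"
  proof (rule eq_vecI)
    fix i assume "i < dim_vec (complex_of_real g \<cdot>\<^sub>v v)"
    then have i: "i < real_dim N" by (simp add: v_def)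
    have "(map_mat complex_of_real (fund_mat N A \<epsilon> \<phi> T) *\<^sub>v v) $ i
       = complex_of_real (\<Sum>b<real_dim N. fund_mat N A \<epsilon> \<phi> T $$ (i, b) * coord N b \<eta>)"
      unfolding map_fund_mult[OF vc i] by (simp add: v_def)
    also have "\<dots> = complex_of_real (coord N i (flow T (\<lambda>k. \<Sum>b<real_dim N. complex_of_real (coord N b \<eta>) * basis N b k)))"
      unfolding fund_mult_vec[OF i T(1)] ..
    also have "coord N i (flow T (\<lambda>k. \<Sum>b<real_dim N. complex_of_real (coord N b \<eta>) * basis N b k)) = coord N i (flow T \<eta>)"
      by (rule coord_cong, rule lin_flow_cong, rule basis_expansion)
    also have "\<dots> = coord N i (\<lambda>k. complex_of_real g * \<eta> k)" by (rule coord_cong) (rule fl)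
    also have "\<dots> = g * coord N i \<eta>" by (simp add: coord_def)
    finally show "(map_mat complex_of_real (fund_mat N A \<epsilon> \<phi> T) *\<^sub>v v) $ i = (complex_of_real g \<cdot>\<^sub>v v) $ i"
      using i by (simp add: v_def)
  qed (simp add: v_def fund_mat_def)
  moreover have "v \<noteq> 0\<^sub>v (real_dim N)"
  proof
    assume v0: "v = 0\<^sub>v (real_dim N)"
    have "coord N i \<eta> = 0" if "i < real_dim N" for i
      using arg_cong[OF v0, of "\<lambda>w. w $ i"] that by (simp add: v_def)
    then have "\<eta> k = 0" if "k \<in> sites N" for k
      using coord_eqI[of N \<eta> "\<lambda>k. 0" k] that by (simp add: coord_def)
    moreover obtain j where "j \<in> sites N" "a j \<noteq> 0" using a(1) by blast
    ultimately show False using c\<eta>[of j] by (auto simp: complex_eq_iff)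
  qed
  ultimately have "eigenvalue (map_mat complex_of_real (fund_mat N A \<epsilon> \<phi> T)) (complex_of_real g)"
    unfolding eigenvalue_def eigenvector_def using vc by (intro exI[of _ v]) (simp add: fund_mat_def)
  moreover have "1 < cmod (complex_of_real g)" using g by simp
  ultimately show ?thesis
    unfolding linearly_unstable_def floquet_multiplier_def using monodromy[OF \<psi>] by blast
qed

end

section \<open>Continuations of the four orbits\<close>

definition pattern :: "real \<Rightarrow> real \<Rightarrow> int \<Rightarrow> real" where
  "pattern q\<^sub>2 q\<^sub>3 j = (if j = -2 then cos q\<^sub>2 else if j = -1 then 1 else if j = 1 then cos q\<^sub>3 else 0)"

lemma sign_pattern_pattern:
  assumes "q\<^sub>2 \<in> {0, pi}" "q\<^sub>3 \<in> {0, pi}"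
  shows "sign_pattern (pattern q\<^sub>2 q\<^sub>3)"
  using assms by (auto simp: sign_pattern_def pattern_def excited_def)

lemma cis_rcong:
  assumes "[d = q] (rmod (2 * pi))" "q \<in> {0, pi}"
  shows "exp (\<i> * complex_of_real d) = complex_of_real (cos q)"
proof -
  have "cos d = cos q" "sin d = sin q" using cos_rcong[OF assms(1)] sin_rcong[OF assms(1)] by auto
  moreover have "sin q = 0" using assms(2) by auto
  ultimately show ?thesis by (simp add: complex_eq_iff Re_exp Im_exp)
qed

lemma unperturbed_pattern:
  assumes pd: "phase_differences \<theta> q\<^sub>2 q\<^sub>3" and q: "q\<^sub>2 \<in> {0, pi}" "q\<^sub>3 \<in> {0, pi}"
  shows "unperturbed excited A \<omega> \<theta> t j
     = complex_of_real (sqrt A * pattern q\<^sub>2 q\<^sub>3 j) * exp (- \<i> * complex_of_real (\<theta> (-1))) * exp (- \<i> * complex_of_real (\<omega> * t))"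
proof -
  have e2: "exp (- \<i> * complex_of_real (\<theta> (-2))) = complex_of_real (cos q\<^sub>2) * exp (- \<i> * complex_of_real (\<theta> (-1)))"
  proof -
    have "exp (\<i> * complex_of_real (\<theta> (-1) - \<theta> (-2))) = complex_of_real (cos q\<^sub>2)"
      by (rule cis_rcong) (use pd q in \<open>auto simp: phase_differences_def\<close>)
    then have "exp (\<i> * complex_of_real (\<theta> (-1) - \<theta> (-2))) * exp (- \<i> * complex_of_real (\<theta> (-1)))
      = complex_of_real (cos q\<^sub>2) * exp (- \<i> * complex_of_real (\<theta> (-1)))" by simp
    then show ?thesis unfolding mult_exp_exp by (simp add: algebra_simps)
  qed
  have "exp (\<i> * complex_of_real (- (\<theta> 1 - \<theta> (-1)))) = complex_of_real (cos (- q\<^sub>3))"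
  proof -
    have "cos (- (\<theta> 1 - \<theta> (-1))) = cos (- q\<^sub>3)" "sin (- (\<theta> 1 - \<theta> (-1))) = 0"
      using pd q(2) cos_rcong[of "\<theta> 1 - \<theta> (-1)" q\<^sub>3] sin_rcong[of "\<theta> 1 - \<theta> (-1)" q\<^sub>3]
      unfolding cos_minus sin_minus phase_differences_def by auto
    then show ?thesis by (simp add: complex_eq_iff Re_exp Im_exp)
  qed
  then have "exp (\<i> * complex_of_real (- (\<theta> 1 - \<theta> (-1)))) * exp (- \<i> * complex_of_real (\<theta> (-1))) = complex_of_real (cos q\<^sub>3) * exp (- \<i> * complex_of_real (\<theta> (-1)))"
    by simp
  then have e1: "exp (- \<i> * complex_of_real (\<theta> 1)) = complex_of_real (cos q\<^sub>3) * exp (- \<i> * complex_of_real (\<theta> (-1)))"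
    unfolding mult_exp_exp by (simp add: algebra_simps)
  have split: "exp (- \<i> * complex_of_real (\<omega> * t + \<theta> j)) = exp (- \<i> * complex_of_real (\<theta> j)) * exp (- \<i> * complex_of_real (\<omega> * t))" for j
    unfolding mult_exp_exp by (simp add: algebra_simps)
  consider "j = -2" | "j = -1" | "j = 1" | "j \<notin> excited" by (auto simp: excited_def)
  then show ?thesis
  proof cases
    case 1
    then show ?thesis using e2 unfolding unperturbed_def split by (simp add: pattern_def excited_def)
  next
    case 2
    then show ?thesis unfolding unperturbed_def split by (simp add: pattern_def excited_def)
  next
    case 3
    then show ?thesis using e1 unfolding unperturbed_def split by (simp add: pattern_def excited_def)
  next
    case 4
    then show ?thesis by (auto simp: unperturbed_def pattern_def excited_def)
  qed
qed

lemma real_wave_is_periodic_solution: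
  assumes w: "real_wave N (\<epsilon> / A) u" and A: "A > 0" and \<omega>: "\<omega> = 1 + A" and T: "T = 2 * pi / \<omega>" and z: "cmod z = 1"
  shows "periodic_solution N \<epsilon> T (\<lambda>t j. complex_of_real (sqrt A * u j) * z * exp (- \<i> * complex_of_real (\<omega> * t)))"
proof -
  define \<psi> where "\<psi> t j = complex_of_real (sqrt A * u j) * z * exp (- \<i> * complex_of_real (\<omega> * t))" for t j
  have "((\<lambda>s. \<psi> s j) has_vector_derivative dnls_field N \<epsilon> (\<psi> t) j) (at t)" if j: "j \<in> sites N" for t j
  proof -
    have D: "((\<lambda>s. \<psi> s j) has_vector_derivative - \<i> * complex_of_real \<omega> * \<psi> t j) (at t)"
      unfolding \<psi>_def
      by (auto intro!: derivative_eq_intros has_vector_derivative_real_field simp: algebra_simps)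
    have m: "(cmod (\<psi> t j))\<^sup>2 = A * (u j)\<^sup>2" using A z by (simp add: \<psi>_def norm_mult power_mult_distrib)
    define f where "f = complex_of_real (sqrt A) * z * exp (- \<i> * complex_of_real (\<omega> * t))"
    have \<psi>f: "\<psi> t k = f * complex_of_real (u k)" for k by (simp add: \<psi>_def f_def)
    have l: "lap N (\<psi> t) j = f * complex_of_real (lap N u j)" by (simp add: \<psi>f lap_def algebra_simps)
    have "A * (((u j)\<^sup>2 - 1) * u j + \<epsilon> / A * lap N u j) = 0" using w j by (simp add: real_wave_def)
    then have "u j + A * (u j)\<^sup>2 * u j + \<epsilon> * lap N u j = \<omega> * u j" using A \<omega> by (simp add: algebra_simps)
    then have "f * complex_of_real (u j + A * (u j)\<^sup>2 * u j + \<epsilon> * lap N u j) = f * complex_of_real (\<omega> * u j)" by simp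
    then have "\<psi> t j + complex_of_real (A * (u j)\<^sup>2) * \<psi> t j + complex_of_real \<epsilon> * lap N (\<psi> t) j = complex_of_real \<omega> * \<psi> t j"
      unfolding l \<psi>f by (simp add: algebra_simps)
    then have "dnls_field N \<epsilon> (\<psi> t) j = - \<i> * complex_of_real \<omega> * \<psi> t j"
      unfolding dnls_field_eq[OF j] m by simp
    then show ?thesis using D by simp
  qed
  moreover have "\<psi> (t + T) j = \<psi> t j" for t j
  proof -
    have 1: "exp (- \<i> * complex_of_real (\<omega> * T)) = 1"
      using A \<omega> by (simp add: T exp_minus exp_eq_1)
    have "exp (- \<i> * complex_of_real (\<omega> * (t + T))) = exp (- \<i> * complex_of_real (\<omega> * t)) * exp (- \<i> * complex_of_real (\<omega> * T))"
      unfolding mult_exp_exp by (simp add: algebra_simps)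
    then show ?thesis unfolding \<psi>_def 1 by simp
  qed
  ultimately show ?thesis unfolding periodic_solution_def dnls_solution_def \<psi>_def by blast
qed

lemma pattern_continues:
  assumes A: "A > 0" and \<omega>: "\<omega> = 1 + A" and T: "T = 2 * pi / \<omega>"
    and pd: "phase_differences \<theta> q\<^sub>2 q\<^sub>3" and q: "q\<^sub>2 \<in> {0, pi}" "q\<^sub>3 \<in> {0, pi}"
  shows "can_be_continued N T (unperturbed excited A \<omega> \<theta>)"
proof -
  define \<sigma> where "\<sigma> = pattern q\<^sub>2 q\<^sub>3"
  define z where "z = exp (- \<i> * complex_of_real (\<theta> (-1)))"
  have z: "cmod z = 1" by (simp add: z_def)
  have \<sigma>: "\<sigma> j \<in> {-1, 0, 1}" for j using q by (auto simp: \<sigma>_def pattern_def)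
  have "\<exists>u. real_wave N (\<epsilon> / A) u \<and> (\<forall>j\<in>sites N. \<bar>u j - \<sigma> j\<bar> \<le> 8 * (\<epsilon> / A))" if "0 < \<epsilon>" "\<epsilon> < A / 120" for \<epsilon>
    by (rule real_wave_exists) (use that A \<sigma> in \<open>auto simp: field_simps\<close>)
  then obtain U where U: "\<And>\<epsilon>. 0 < \<epsilon> \<Longrightarrow> \<epsilon> < A / 120 \<Longrightarrow> real_wave N (\<epsilon> / A) (U \<epsilon>) \<and> (\<forall>j\<in>sites N. \<bar>U \<epsilon> j - \<sigma> j\<bar> \<le> 8 * (\<epsilon> / A))"
    by metis
  define \<Psi> where "\<Psi> \<epsilon> t j = complex_of_real (sqrt A * U \<epsilon> j) * z * exp (- \<i> * complex_of_real (\<omega> * t))" for \<epsilon> t j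
  have "is_continuation N T (unperturbed excited A \<omega> \<theta>) \<Psi>"
    unfolding is_continuation_def
  proof (intro conjI exI[of _ "A / 120"] allI impI ballI)
    show "A / 120 > 0" using A by simp
    show "periodic_solution N \<epsilon> T (\<Psi> \<epsilon>)" if "0 < \<epsilon> \<and> \<epsilon> < A / 120" for \<epsilon>
      unfolding \<Psi>_def[abs_def] by (rule real_wave_is_periodic_solution[OF _ A \<omega> T z]) (use U that in blast)
    fix j assume j: "j \<in> sites N"
    show "uniform_limit UNIV (\<lambda>\<epsilon> t. \<Psi> \<epsilon> t j) (\<lambda>t. unperturbed excited A \<omega> \<theta> t j) (at_right 0)"
    proof (rule uniform_limitI)
      fix \<eta> :: real assume \<eta>: "0 < \<eta>"
      define b where "b = min (A / 120) (\<eta> * A / (8 * sqrt A))"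
      have b: "b > 0" "b \<le> A / 120" "b \<le> \<eta> * A / (8 * sqrt A)" using A \<eta> by (simp_all add: b_def)
      have "dist (\<Psi> \<epsilon> t j) (unperturbed excited A \<omega> \<theta> t j) < \<eta>" if \<epsilon>: "0 < \<epsilon>" "\<epsilon> < b" for \<epsilon> t
      proof -
        have "\<Psi> \<epsilon> t j - unperturbed excited A \<omega> \<theta> t j = complex_of_real (sqrt A * (U \<epsilon> j - \<sigma> j)) * (z * exp (- \<i> * complex_of_real (\<omega> * t)))"
          unfolding unperturbed_pattern[OF pd q] \<Psi>_def \<sigma>_def z_def by (simp add: algebra_simps)
        then have "cmod (\<Psi> \<epsilon> t j - unperturbed excited A \<omega> \<theta> t j) = sqrt A * \<bar>U \<epsilon> j - \<sigma> j\<bar>"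
          using A z by (simp only: norm_mult norm_of_real abs_mult) simp
        also have "\<dots> \<le> sqrt A * (8 * (\<epsilon> / A))" using U[of \<epsilon>] \<epsilon> b j A by (intro mult_left_mono) auto
        also have "\<dots> < sqrt A * (8 * ((\<eta> * A / (8 * sqrt A)) / A))"
          using \<epsilon> b(3) A by (intro mult_strict_left_mono divide_strict_right_mono) auto
        also have "\<dots> = \<eta>" using A by simp
        finally show ?thesis by (simp add: dist_norm)
      qed
      then show "\<forall>\<^sub>F \<epsilon> in at_right 0. \<forall>t\<in>UNIV. dist (\<Psi> \<epsilon> t j) (unperturbed excited A \<omega> \<theta> t j) < \<eta>"
        unfolding eventually_at_right_field using b(1) by blast
    qed
  qed
  then show ?thesis unfolding can_be_continued_def by blast
qed

text \<open>A continuation is an arbitrary family of periodic solutions. Rigidity and the real form show that each of its members is, for small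
  \<open>\<epsilon>\<close>, a standing wave to which the stability analysis applies.\<close>

lemma continuation_is_real_wave:
  fixes A \<omega> T :: real
  assumes N: "6 \<le> N" and A: "A > 0" and \<omega>: "\<omega> = 1 + A" and T: "T = 2 * pi / \<omega>"
    and nonres: "\<And>k::int. k \<noteq> 0 \<Longrightarrow> of_int k * \<omega> - 1 \<noteq> 0"
    and pd: "phase_differences \<theta> q\<^sub>2 q\<^sub>3" and q: "q\<^sub>2 \<in> {0, pi}" "q\<^sub>3 \<in> {0, pi}"
    and cont: "is_continuation N T (unperturbed excited A \<omega> \<theta>) \<Psi>"
  shows "\<exists>\<epsilon>1>0. \<forall>\<epsilon>. 0 < \<epsilon> \<and> \<epsilon> < \<epsilon>1 \<longrightarrow>
     (\<exists>u c. linearization N \<epsilon> A u (pattern q\<^sub>2 q\<^sub>3) (\<Psi> \<epsilon> 0) c \<and>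
        (\<forall>t. \<forall>k\<in>sites N. \<Psi> \<epsilon> t k = exp (- \<i> * complex_of_real ((1 + A) * t)) * \<Psi> \<epsilon> 0 k))"
proof -
  from nearby_periodic_is_standing[OF A \<omega> T nonres]
  obtain \<delta> where d: "\<delta> > 0" and std: "\<forall>N S \<theta> \<epsilon> \<psi>. 0 < \<epsilon> \<and> \<epsilon> \<le> \<delta> \<and> periodic_solution N \<epsilon> T \<psi> \<and>
       (\<forall>t. \<forall>j\<in>sites N. cmod (\<psi> t j - unperturbed S A \<omega> \<theta> t j) \<le> \<delta>)
     \<longrightarrow> standing_wave N A \<epsilon> (\<psi> 0) \<and>
        (\<forall>t. \<forall>j\<in>sites N. \<psi> t j = exp (- \<i> * complex_of_real (\<omega> * t)) * \<psi> 0 j)"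
    by blast
  define \<rho> where "\<rho> = min \<delta> (sqrt A * ((1 / 10000) / 3))"
  have \<rho>: "\<rho> > 0" "\<rho> \<le> \<delta>" "\<rho> \<le> sqrt A * ((1 / 10000) / 3)" using d A by (simp_all add: \<rho>_def)
  have lim: "\<forall>j\<in>sites N. uniform_limit UNIV (\<lambda>\<epsilon> t. \<Psi> \<epsilon> t j) (\<lambda>t. unperturbed excited A \<omega> \<theta> t j) (at_right 0)"
    using cont by (simp add: is_continuation_def)
  obtain \<epsilon>s where \<epsilon>s: "\<epsilon>s > 0" "\<forall>\<epsilon>. 0 < \<epsilon> \<and> \<epsilon> < \<epsilon>s \<longrightarrow> periodic_solution N \<epsilon> T (\<Psi> \<epsilon>)"
    using cont by (auto simp: is_continuation_def)
  have "\<forall>\<^sub>F \<epsilon> in at_right 0. \<forall>j\<in>sites N. \<forall>t\<in>UNIV. dist (\<Psi> \<epsilon> t j) (unperturbed excited A \<omega> \<theta> t j) < \<rho>"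
  proof (rule eventually_ball_finite[OF finite_sites], rule ballI)
    fix j assume "j \<in> sites N"
    then show "\<forall>\<^sub>F \<epsilon> in at_right 0. \<forall>t\<in>UNIV. dist (\<Psi> \<epsilon> t j) (unperturbed excited A \<omega> \<theta> t j) < \<rho>"
      by (rule uniform_limitD[OF bspec[OF lim] \<rho>(1)])
  qed
  then obtain b where b: "b > 0"
    "\<And>\<epsilon>. 0 < \<epsilon> \<Longrightarrow> \<epsilon> < b \<Longrightarrow> \<forall>j\<in>sites N. \<forall>t. dist (\<Psi> \<epsilon> t j) (unperturbed excited A \<omega> \<theta> t j) < \<rho>"
    unfolding eventually_at_right_field by auto
  define \<epsilon>1 where "\<epsilon>1 = Min {b, \<epsilon>s, \<delta>, A / 10000}"
  have e1: "\<epsilon>1 > 0" using b \<epsilon>s d A by (simp add: \<epsilon>1_def)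
  have "\<exists>u c. linearization N \<epsilon> A u (pattern q\<^sub>2 q\<^sub>3) (\<Psi> \<epsilon> 0) c \<and>
        (\<forall>t. \<forall>k\<in>sites N. \<Psi> \<epsilon> t k = exp (- \<i> * complex_of_real ((1 + A) * t)) * \<Psi> \<epsilon> 0 k)"
    if \<epsilon>: "0 < \<epsilon>" "\<epsilon> < \<epsilon>1" for \<epsilon>
  proof -
    have small: "\<epsilon> < b" "\<epsilon> < \<epsilon>s" "\<epsilon> < \<delta>" "\<epsilon> < A / 10000" using \<epsilon>(2) by (simp_all add: \<epsilon>1_def)
    have close: "cmod (\<Psi> \<epsilon> t j - unperturbed excited A \<omega> \<theta> t j) \<le> \<rho>" if "j \<in> sites N" for t j
      using b(2)[OF \<epsilon>(1) small(1)] that by (auto simp: dist_norm less_imp_le)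
    have "\<forall>t. \<forall>j\<in>sites N. cmod (\<Psi> \<epsilon> t j - unperturbed excited A \<omega> \<theta> t j) \<le> \<delta>"
      using close \<rho>(2) order_trans by blast
    moreover have "\<epsilon> \<le> \<delta>" using small(3) by simp
    moreover have "periodic_solution N \<epsilon> T (\<Psi> \<epsilon>)" by (rule \<epsilon>s(2)[rule_format]) (simp add: \<epsilon>(1) small(2))
    ultimately have "standing_wave N A \<epsilon> (\<Psi> \<epsilon> 0) \<and>
        (\<forall>t. \<forall>j\<in>sites N. \<Psi> \<epsilon> t j = exp (- \<i> * complex_of_real (\<omega> * t)) * \<Psi> \<epsilon> 0 j)"
      using std \<epsilon>(1) by blast
    then have w: "standing_wave N A \<epsilon> (\<Psi> \<epsilon> 0)"
      and rot: "\<forall>t. \<forall>j\<in>sites N. \<Psi> \<epsilon> t j = exp (- \<i> * complex_of_real (\<omega> * t)) * \<Psi> \<epsilon> 0 j" by (rule conjunct1, rule conjunct2)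
    define z where "z = exp (- \<i> * complex_of_real (\<theta> (-1)))"
    have near: "cmod (\<Psi> \<epsilon> 0 j - complex_of_real (sqrt A * pattern q\<^sub>2 q\<^sub>3 j) * z) \<le> sqrt A * ((1 / 10000) / 3)"
      if "j \<in> sites N" for j
      using close[OF that, of 0] \<rho>(3) unfolding unperturbed_pattern[OF pd q] z_def by simp
    have eA: "\<epsilon> / A \<le> 1 / 10000" using small(4) A by (simp add: field_simps)
    have "\<exists>c u. cmod c = 1 \<and> real_wave N (\<epsilon> / A) u \<and> (\<forall>j\<in>sites N. \<bar>u j - pattern q\<^sub>2 q\<^sub>3 j\<bar> \<le> 1 / 10000) \<and>
       (\<forall>j\<in>sites N. \<Psi> \<epsilon> 0 j = complex_of_real (sqrt A * u j) * c)"
      by (rule standing_wave_real_form[OF N A \<epsilon>(1) eA order_refl w sign_pattern_pattern[OF q] _ near]) (simp add: z_def)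
    then obtain c u where c: "cmod c = 1" and u: "real_wave N (\<epsilon> / A) u" "\<forall>j\<in>sites N. \<bar>u j - pattern q\<^sub>2 q\<^sub>3 j\<bar> \<le> 1 / 10000"
       "\<forall>j\<in>sites N. \<Psi> \<epsilon> 0 j = complex_of_real (sqrt A * u j) * c" by blast
    have "linearization N \<epsilon> A u (pattern q\<^sub>2 q\<^sub>3) (\<Psi> \<epsilon> 0) c"
      by unfold_locales (use N A \<epsilon>(1) eA sign_pattern_pattern[OF q] c u in auto)
    then show ?thesis using rot[unfolded \<omega>] by blast
  qed
  then show ?thesis using e1 by blast
qed

theorem mainTheorem2:
  fixes N :: nat and A \<omega> T :: real
  assumes "6 \<le> N" "N \<le> 10"
    and "A > 0" and "\<omega> = 1 + A" and "T = 2 * pi / \<omega>"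
    and "\<And>k::int. k \<noteq> 0 \<Longrightarrow>
      of_int k * \<omega> + 1 \<noteq> 0 \<and> of_int k * \<omega> - 1 \<noteq> 0 \<and> of_int k * \<omega> + 2 \<noteq> 0 \<and> of_int k * \<omega> - 2 \<noteq> 0"
  shows
    "(\<forall>\<theta> q\<^sub>2 q\<^sub>3. (q\<^sub>2, q\<^sub>3) \<in> {(0, 0), (0, pi), (pi, 0), (pi, pi)} \<and> phase_differences \<theta> q\<^sub>2 q\<^sub>3 \<longrightarrow>
        can_be_continued N T (unperturbed excited A \<omega> \<theta>))
   \<and> (\<forall>\<theta> \<Psi>. phase_differences \<theta> 0 pi \<and> is_continuation N T (unperturbed excited A \<omega> \<theta>) \<Psi> \<longrightarrow>
        (\<exists>\<epsilon>1>0. \<forall>\<epsilon>. 0 < \<epsilon> \<and> \<epsilon> < \<epsilon>1 \<longrightarrow> linearly_stable N \<epsilon> T (\<Psi> \<epsilon>)))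
   \<and> (\<forall>\<theta> q\<^sub>2 q\<^sub>3 \<Psi>. (q\<^sub>2, q\<^sub>3) \<in> {(0, 0), (pi, 0), (pi, pi)} \<and> phase_differences \<theta> q\<^sub>2 q\<^sub>3 \<and>
        is_continuation N T (unperturbed excited A \<omega> \<theta>) \<Psi> \<longrightarrow>
        (\<exists>\<epsilon>1>0. \<forall>\<epsilon>. 0 < \<epsilon> \<and> \<epsilon> < \<epsilon>1 \<longrightarrow> linearly_unstable N \<epsilon> T (\<Psi> \<epsilon>)))
   \<and> (\<forall>\<theta> q\<^sub>2 q\<^sub>3 (eps :: nat \<Rightarrow> real) \<psi>. phase_differences \<theta> q\<^sub>2 q\<^sub>3 \<and>
        (\<forall>n. eps n > 0) \<and> eps \<longlonglongrightarrow> 0 \<and> (\<forall>n. periodic_solution N (eps n) T (\<psi> n)) \<and>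
        (\<forall>j\<in>sites N. uniform_limit UNIV (\<lambda>n t. \<psi> n t j)
           (\<lambda>t. unperturbed excited A \<omega> \<theta> t j) sequentially) \<longrightarrow>
        ([q\<^sub>2 = 0] (rmod (2 * pi)) \<or> [q\<^sub>2 = pi] (rmod (2 * pi))) \<and>
        ([q\<^sub>3 = 0] (rmod (2 * pi)) \<or> [q\<^sub>3 = pi] (rmod (2 * pi))))"
proof -
  note N = assms(1) and A = assms(3) and \<omega> = assms(4) and T = assms(5)
  have nonres: "of_int k * \<omega> - 1 \<noteq> 0" if "k \<noteq> 0" for k :: int using assms(6)[OF that] by blast
  have T0: "T > 0" using A by (simp add: T \<omega>)
  have period: "exp (- \<i> * complex_of_real ((1 + A) * T)) = 1"
    using A by (simp add: T \<omega> exp_minus exp_eq_1)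
  note wave = continuation_is_real_wave[OF N A \<omega> T nonres]
  have i: "can_be_continued N T (unperturbed excited A \<omega> \<theta>)"
    if "(q\<^sub>2, q\<^sub>3) \<in> {(0, 0), (0, pi), (pi, 0), (pi, pi)}" "phase_differences \<theta> q\<^sub>2 q\<^sub>3" for \<theta> q\<^sub>2 q\<^sub>3
    by (rule pattern_continues[OF A \<omega> T that(2)]) (use that(1) in auto)
  have ii: "\<exists>\<epsilon>1>0. \<forall>\<epsilon>. 0 < \<epsilon> \<and> \<epsilon> < \<epsilon>1 \<longrightarrow> linearly_stable N \<epsilon> T (\<Psi> \<epsilon>)"
    if pd: "phase_differences \<theta> 0 pi" and cont: "is_continuation N T (unperturbed excited A \<omega> \<theta>) \<Psi>" for \<theta> \<Psi>
  proof -
    obtain \<epsilon>1 where e1: "\<epsilon>1 > 0" and lin: "\<forall>\<epsilon>. 0 < \<epsilon> \<and> \<epsilon> < \<epsilon>1 \<longrightarrow>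
     (\<exists>u c. linearization N \<epsilon> A u (pattern 0 pi) (\<Psi> \<epsilon> 0) c \<and>
        (\<forall>t. \<forall>k\<in>sites N. \<Psi> \<epsilon> t k = exp (- \<i> * complex_of_real ((1 + A) * t)) * \<Psi> \<epsilon> 0 k))"
      using wave[OF _ pd _ _ cont] by auto
    have "linearly_stable N \<epsilon> T (\<Psi> \<epsilon>)" if \<epsilon>: "0 < \<epsilon> \<and> \<epsilon> < \<epsilon>1" for \<epsilon>
    proof -
      obtain u c where u: "linearization N \<epsilon> A u (pattern 0 pi) (\<Psi> \<epsilon> 0) c"
        and rot: "\<forall>t. \<forall>k\<in>sites N. \<Psi> \<epsilon> t k = exp (- \<i> * complex_of_real ((1 + A) * t)) * \<Psi> \<epsilon> 0 k"
        using lin \<epsilon> by blast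
      show ?thesis
      proof (rule linearization.stable[OF u _ _ period])
        show "pattern 0 pi (-2) = 1" "pattern 0 pi 1 = -1" by (simp_all add: pattern_def)
      qed (use rot in blast)
    qed
    then show ?thesis using e1 by blast
  qed
  have iii: "\<exists>\<epsilon>1>0. \<forall>\<epsilon>. 0 < \<epsilon> \<and> \<epsilon> < \<epsilon>1 \<longrightarrow> linearly_unstable N \<epsilon> T (\<Psi> \<epsilon>)"
    if q: "(q\<^sub>2, q\<^sub>3) \<in> {(0, 0), (pi, 0), (pi, pi)}" and pd: "phase_differences \<theta> q\<^sub>2 q\<^sub>3"
      and cont: "is_continuation N T (unperturbed excited A \<omega> \<theta>) \<Psi>" for \<theta> q\<^sub>2 q\<^sub>3 \<Psi>
  proof -
    have qs: "q\<^sub>2 \<in> {0, pi}" "q\<^sub>3 \<in> {0, pi}" using q by auto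
    obtain \<epsilon>1 where e1: "\<epsilon>1 > 0" and lin: "\<forall>\<epsilon>. 0 < \<epsilon> \<and> \<epsilon> < \<epsilon>1 \<longrightarrow>
     (\<exists>u c. linearization N \<epsilon> A u (pattern q\<^sub>2 q\<^sub>3) (\<Psi> \<epsilon> 0) c \<and>
        (\<forall>t. \<forall>k\<in>sites N. \<Psi> \<epsilon> t k = exp (- \<i> * complex_of_real ((1 + A) * t)) * \<Psi> \<epsilon> 0 k))"
      using wave[OF _ pd qs cont] by auto
    have "linearly_unstable N \<epsilon> T (\<Psi> \<epsilon>)" if \<epsilon>: "0 < \<epsilon> \<and> \<epsilon> < \<epsilon>1" for \<epsilon>
    proof -
      obtain u c where u: "linearization N \<epsilon> A u (pattern q\<^sub>2 q\<^sub>3) (\<Psi> \<epsilon> 0) c"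
        and rot: "\<forall>t. \<forall>k\<in>sites N. \<Psi> \<epsilon> t k = exp (- \<i> * complex_of_real ((1 + A) * t)) * \<Psi> \<epsilon> 0 k"
        using lin \<epsilon> by blast
      interpret linearization N \<epsilon> A u "pattern q\<^sub>2 q\<^sub>3" "\<Psi> \<epsilon> 0" c by (rule u)
      have "pattern q\<^sub>2 q\<^sub>3 1 = 1 \<or> pattern q\<^sub>2 q\<^sub>3 (-2) = -1" using q by (auto simp: pattern_def)
      then have "\<exists>b. pot N (\<epsilon> / A) u b b < 0"
        using pot_indefinite_nearest pot_indefinite_next_nearest by blast
      then show ?thesis by (rule unstable[OF _ period T0]) (use rot in blast)
    qed
    then show ?thesis using e1 by blast
  qed
  have iv: "([q\<^sub>2 = 0] (rmod (2 * pi)) \<or> [q\<^sub>2 = pi] (rmod (2 * pi))) \<and>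
        ([q\<^sub>3 = 0] (rmod (2 * pi)) \<or> [q\<^sub>3 = pi] (rmod (2 * pi)))"
    if h: "phase_differences \<theta> q\<^sub>2 q\<^sub>3 \<and>
        (\<forall>n. eps n > 0) \<and> eps \<longlonglongrightarrow> 0 \<and> (\<forall>n. periodic_solution N (eps n) T (\<psi> n)) \<and>
        (\<forall>j\<in>sites N. uniform_limit UNIV (\<lambda>n t. \<psi> n t j)
           (\<lambda>t. unperturbed excited A \<omega> \<theta> t j) sequentially)" for \<theta> q\<^sub>2 q\<^sub>3 and eps :: "nat \<Rightarrow> real" and \<psi>
  proof (rule limits_have_phases_0_or_pi[OF N A \<omega> T nonres])
    show "phase_differences \<theta> q\<^sub>2 q\<^sub>3" "eps \<longlonglongrightarrow> 0" "eps n > 0" "periodic_solution N (eps n) T (\<psi> n)" for n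
      using h by blast+
    show "uniform_limit UNIV (\<lambda>n t. \<psi> n t j) (\<lambda>t. unperturbed excited A \<omega> \<theta> t j) sequentially" if "j \<in> sites N" for j
      using h that by blast
  qed
  show ?thesis
  proof (rule conjI[OF _ conjI[OF _ conjI]]; intro allI impI)
    fix \<theta> q\<^sub>2 q\<^sub>3
    assume "(q\<^sub>2, q\<^sub>3) \<in> {(0, 0), (0, pi), (pi, 0), (pi, pi)} \<and> phase_differences \<theta> q\<^sub>2 q\<^sub>3"
    then show "can_be_continued N T (unperturbed excited A \<omega> \<theta>)" by (elim conjE) (rule i)
  next
    fix \<theta> \<Psi>
    assume "phase_differences \<theta> 0 pi \<and> is_continuation N T (unperturbed excited A \<omega> \<theta>) \<Psi>"
    then show "\<exists>\<epsilon>1>0. \<forall>\<epsilon>. 0 < \<epsilon> \<and> \<epsilon> < \<epsilon>1 \<longrightarrow> linearly_stable N \<epsilon> T (\<Psi> \<epsilon>)" by (elim conjE) (rule ii)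
  next
    fix \<theta> q\<^sub>2 q\<^sub>3 \<Psi>
    assume "(q\<^sub>2, q\<^sub>3) \<in> {(0, 0), (pi, 0), (pi, pi)} \<and> phase_differences \<theta> q\<^sub>2 q\<^sub>3 \<and>
        is_continuation N T (unperturbed excited A \<omega> \<theta>) \<Psi>"
    then show "\<exists>\<epsilon>1>0. \<forall>\<epsilon>. 0 < \<epsilon> \<and> \<epsilon> < \<epsilon>1 \<longrightarrow> linearly_unstable N \<epsilon> T (\<Psi> \<epsilon>)" by (elim conjE) (rule iii)
  qed (rule iv)
qed

end
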